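(* Assume that $\mathbb{P}$ is $\psi$-mixing and let $\Gamma>0$ be a constant with $\mathbb{P}(A)\le e^{-\Gamma n}$ for all $n\ge1$ and $A\in\mathcal{C}_n$ (such a constant exists by $\psi$-mixing). For $A\in\mathcal{C}_n$ with $\mathbb{P}(A)>0$ let $\rho_A$ be defined as in the context. Then $$\sup\{\rho_A:\ A\in\mathcal{C}_n,\ \mathbb{P}(A)>0,\ n\ge1\}<1,$$ and if $\omega\in\Omega_{\mathbb{P}}$ is not a periodic sequence then $\lim_{n\to\infty}\rho_{A^\omega_n}=0$. Furthermore, let $A=[a_0,\dots,a_{n-1}]\in\mathcal{C}_n$ with $\mathbb{P}(A)>0$, $t>0$, $N=[t(\mathbb{P}(A))^{-\ell}]$, assume $\psi_n<(3/2)^{1/(\ell+1)}-1$, set $r=\pi(A)$ and $\rho=\rho_A$, and let $W$ be a Poisson random variable with parameter $t(1-\rho)$. If $n>r(d_\ell+6)$, then there exists a sequence of i.i.d. random variables $\eta_1,\eta_2,\dots$ independent of $W$ such that $\mathbb{P}\{\eta_1\in\{1,\dots,[n/r]\}\}=1$ and the compound Poisson random variable $Z=\sum_{k=1}^W\eta_k$ satisfies $$\sup_{L\subset\mathbb{N}}\big|\mathbb{P}\{S^A_N\in L\}-\mathbb{P}\{Z\in L\}\big|\le 2^{2\ell+7}(1+\psi_0)^{2\ell}(t+1)\Big(d_\ell\ell^2n^4e^{-\Gamma n/2}+\psi_n(1-e^{-\Gamma})^{-1}\Big)+2\wp\Big(10(1+\psi_0)^{2\ell}d_\ell n^2(t+1)e^{-\Gamma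 n/2}+2^\ell t\psi_n\Big).$$
   Context: $\mathbb{N}=\{0,1,2,\dots\}$; $[x]$ is the integral part of a number $x$; $\wp(x)=xe^x$. $\mathcal{A}$ is a finite or countable alphabet with more than one element, $\Omega=\mathcal{A}^{\mathbb{N}}$, $\mathcal{F}$ is the $\sigma$-algebra generated by cylinder sets, $T$ is the left shift $(T\omega)_i=\omega_{i+1}$, and $\mathbb{P}$ is a $T$-invariant probability on $(\Omega,\mathcal{F})$ such that every cylinder $[a]=\{\omega:\omega_0=a\}$, $a\in\mathcal{A}$, has positive probability. For $0\le k\le n\le\infty$, $\mathcal{F}_{k,n}$ is the $\sigma$-algebra generated by the coordinates $\omega_i$ with $k\le i\le n$ (all $i\geq k$ if $n=\infty$). For $\sigma$-algebras $\mathcal{G},\mathcal{H}\subset\mathcal{F}$, $$\psi(\mathcal{G},\mathcal{H})=\sup\Big\{\Big|\frac{\mathbb{P}(B\cap C)}{\mathbb{P}(B)\mathbb{P}(C)}-1\Big|:B\in\mathcal{G},\,C\in\mathcal{H},\ \mathbb{P}(B)\mathbb{P}(C)\neq0\Big\},\qquad \psi_m=\sup_{n\in\mathbb{N}}\psi(\mathcal{F}_{0,n},\mathcal{F}_{n+m+1,\infty}).$$ $\mathbb{P}$ is called $\psi$-mixing if $\psi_0<\infty$ and $\psi_m\to0$ as $m\to\infty$. $\mathcal{C}_n$ is the set of all $n$-cylinders $[a_0,\dots,a_{n-1}]=\{\omega\in\Omega:\omega_i=a_i,\ 0\le i\le n-1\}$. For $A\in\mathcal{C}_n$, $\pi(A)=\min\{k\in\{1,\dots,n\}:A\cap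 T^{-k}A\ne\emptyset\}$. For $\omega\in\Omega$, $A^\omega_n=[\omega_0,\dots,\omega_{n-1}]$, and $\Omega_{\mathbb{P}}=\{\omega\in\Omega:\mathbb{P}(A^\omega_n)>0\ \forall n\ge1\}$. A sequence $\omega$ is periodic if $T^d\omega=\omega$ for some $d\ge1$. Let $\ell\ge1$ and $q_i(k)=d_ik$, $i=1,\dots,\ell$, with integers $1\le d_1<d_2<\cdots<d_\ell$. For $A\in\mathcal{C}_n$: $X^A_k=\prod_{i=1}^\ell\mathbb{I}_A\circ T^{d_ik}$ and $S^A_N=\sum_{k=1}^NX^A_k$. For $R=[a_0,\dots,a_{r-1}]\in\mathcal{C}_r$ and an integer $n\ge r$, $$R^{n/r}=\Big(\bigcap_{k=0}^{[n/r]-1}T^{-kr}R\Big)\cap T^{-r[n/r]}\big([a_0,\dots,a_{n-r[n/r]-1}]\big),$$ where the last cylinder is $\Omega$ if $r$ divides $n$; thus $R^{n/r}$ is the $n$-cylinder obtained by repeating $a_0,\dots,a_{r-1}$ periodically. For $A=[a_0,\dots,a_{n-1}]\in\mathcal{C}_n$ with $\mathbb{P}(A)>0$ put $r=\pi(A)$, $R=[a_0,\dots,a_{r-1}]$, $$\kappa=\mathrm{lcm}\Big\{\frac{r}{\gcd\{r,d_i\}}:1\le i\le\ell\Big\},\qquad \rho_A=\prod_{i=1}^\ell\mathbb{P}\big(R^{(n+d_i\kappa)/r}\,\big|\,A\big).$$ *)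

theory Defs
  imports "HOL-Probability.Probability"
begin

text \<open>Sequences over the alphabet are functions from the naturals to a countable type; the
  type is finite or countably infinite, so both kinds of alphabet are covered.\<close>

definition shift :: "(nat \<Rightarrow> 'a) \<Rightarrow> nat \<Rightarrow> 'a" where
  "shift \<omega> = (\<lambda>i. \<omega> (Suc i))"

definition periodic :: "(nat \<Rightarrow> 'a) \<Rightarrow> bool" where
  "periodic \<omega> \<longleftrightarrow> (\<exists>p\<ge>1. (shift ^^ p) \<omega> = \<omega>)"

text \<open>An \<open>n\<close>-cylinder \<open>[a\<^sub>0, \<dots>, a\<^sub>n\<^sub>-\<^sub>1]\<close> is given by the word of its \<open>n\<close> letters; the
  cylinder of the empty word is the whole space.\<close>

definition cyl :: "'a list \<Rightarrow> (nat \<Rightarrow> 'a) set" where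
  "cyl w = {\<omega>. \<forall>i<length w. \<omega> i = w ! i}"

definition cylinders :: "nat \<Rightarrow> (nat \<Rightarrow> 'a) set set" where
  "cylinders n = {cyl w | w. length w = n}"

definition prefix_word :: "(nat \<Rightarrow> 'a) \<Rightarrow> nat \<Rightarrow> 'a list" where
  "prefix_word \<omega> n = map \<omega> [0..<n]"

definition supp_seqs :: "(nat \<Rightarrow> 'a) measure \<Rightarrow> (nat \<Rightarrow> 'a) set" where
  "supp_seqs M = {\<omega>. \<forall>n\<ge>1. measure M (cyl (prefix_word \<omega> n)) > 0}"

definition coord_algebra :: "nat \<Rightarrow> enat \<Rightarrow> (nat \<Rightarrow> 'a) set set" where
  "coord_algebra k n = sigma_sets UNIV {(\<lambda>\<omega>. \<omega> i) -` B | i B. k \<le> i \<and> enat i \<le> n}"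

text \<open>The mixing coefficients may be infinite, so they take extended values.\<close>

definition psi_coeff ::
    "(nat \<Rightarrow> 'a) measure \<Rightarrow> (nat \<Rightarrow> 'a) set set \<Rightarrow> (nat \<Rightarrow> 'a) set set \<Rightarrow> ennreal" where
  "psi_coeff M G H =
     (SUP (B, C) \<in> {(B, C). B \<in> G \<and> C \<in> H \<and> measure M B * measure M C \<noteq> 0}.
        ennreal \<bar>measure M (B \<inter> C) / (measure M B * measure M C) - 1\<bar>)"

definition psi :: "(nat \<Rightarrow> 'a) measure \<Rightarrow> nat \<Rightarrow> ennreal" where
  "psi M m = (SUP n::nat. psi_coeff M (coord_algebra 0 (enat n)) (coord_algebra (n + m + 1) \<infinity>))"

definition psi_mixing :: "(nat \<Rightarrow> 'a) measure \<Rightarrow> bool" where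
  "psi_mixing M \<longleftrightarrow> psi M 0 < \<infinity> \<and> psi M \<longlonglongrightarrow> 0"

text \<open>\<open>\<pi>(A)\<close> for an \<open>n\<close>-cylinder \<open>A\<close> with \<open>n \<ge> 1\<close>; the minimum is over a nonempty set, since it
  contains \<open>n\<close>.\<close>

definition first_return :: "nat \<Rightarrow> (nat \<Rightarrow> 'a) set \<Rightarrow> nat" where
  "first_return n A = Min {k \<in> {1..n}. A \<inter> (shift ^^ k) -` A \<noteq> {}}"

text \<open>The coefficients \<open>d\<^sub>1, \<dots>, d\<^sub>l\<close> are the values of \<open>d\<close> on \<open>{1..l}\<close>.\<close>

definition mult_visit ::
    "nat \<Rightarrow> (nat \<Rightarrow> nat) \<Rightarrow> (nat \<Rightarrow> 'a) set \<Rightarrow> nat \<Rightarrow> (nat \<Rightarrow> 'a) \<Rightarrow> nat" where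
  "mult_visit l d A k \<omega> = (\<Prod>i=1..l. indicator A ((shift ^^ (d i * k)) \<omega>))"

definition visit_sum ::
    "nat \<Rightarrow> (nat \<Rightarrow> nat) \<Rightarrow> (nat \<Rightarrow> 'a) set \<Rightarrow> nat \<Rightarrow> (nat \<Rightarrow> 'a) \<Rightarrow> nat" where
  "visit_sum l d A N \<omega> = (\<Sum>k=1..N. mult_visit l d A k \<omega>)"

text \<open>\<open>R\<^bsup>n/r\<^esup>\<close> for the cylinder \<open>R\<close> of a word \<open>u\<close> of length \<open>r \<ge> 1\<close> and \<open>n \<ge> r\<close>.\<close>

definition rep_cyl :: "'a list \<Rightarrow> nat \<Rightarrow> (nat \<Rightarrow> 'a) set" where
  "rep_cyl u n = (let r = length u in
     (\<Inter>k<n div r. (shift ^^ (k * r)) -` cyl u) \<inter>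
     (shift ^^ (r * (n div r))) -` cyl (take (n - r * (n div r)) u))"

definition kappa :: "nat \<Rightarrow> (nat \<Rightarrow> nat) \<Rightarrow> nat \<Rightarrow> nat" where
  "kappa l d r = Lcm {r div gcd r (d i) | i. i \<in> {1..l}}"

text \<open>\<open>\<rho>\<^sub>A\<close> for the cylinder \<open>A\<close> of the nonempty word \<open>w\<close>.\<close>

definition rho :: "(nat \<Rightarrow> 'a) measure \<Rightarrow> nat \<Rightarrow> (nat \<Rightarrow> nat) \<Rightarrow> 'a list \<Rightarrow> real" where
  "rho M l d w = (let n = length w; r = first_return n (cyl w) in
     \<Prod>i=1..l. \<P>(\<omega> in M. \<omega> \<in> rep_cyl (take r w) (n + d i * kappa l d r) \<bar> \<omega> \<in> cyl w))"

definition wp :: "real \<Rightarrow> real" where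
  "wp x = x * exp x"

end

(*
  Visits come in clumps: if the word of A has shortest period r, two visits at times less than about
  n / d_l apart differ by a multiple of kappa, so a clump is a run of visits in steps of kappa.
  Let V_k be the size of the clump that starts at time k, and 0 if none does. Off an event of small
  probability the number of visits is the sum of the V_k. The V_k are replaced one at a time by
  independent copies of a fixed one: the sum of the earlier V_q with q not close to k is a function
  of coordinates far from those of V_k and hence nearly independent of V_k by mixing, and for close q
  it is unlikely that V_q and V_k are both nonzero. As test functions take values in [0,1], the
  errors are linear in t without any smoothing. The resulting sum of i.i.d. variables, each rarely
  nonzero, is close to a compound Poisson variable, whose parameter is then corrected to
  t (1 - rho). If psi_n is not small, the bound exceeds 1.

  For the bounds on rho, let b(L) be the probability of the r-periodic word of length L, and let r
  divide c. By stationarity j |-> b(n + j c) is decreasing and convex, while psi_0 < infinity bounds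
  it by (1 + psi_0) b(n) exp(-Gamma j c); so the first decrement is a fixed proportion of b(n).
*)

theory Submission
  imports Defs
begin

section \<open>Compound Poisson laws\<close>

text \<open>The replacement takes about t / P(A)^l steps, so one step may cost only P(A)^l times
  something small. Hence mixing errors are kept relative, and the probability that two close clumps
  both start must carry the factor P(A)^l besides an exponentially small one. The exponent n / 2
  arises there: unless a periodicity argument excludes the pair, the rightmost window of the later
  visit has at least n - r >= n / 2 letters beyond the earlier visit.

  A visit at time k uses l windows, at d_1 k, ..., d_l k. Times q and k interact whenever d_i q is
  near d_j k for some i and j, even if q and k are far apart, so closeness is defined through all
  pairs of coefficients. For small k the windows of a single visit run into each other; the first K
  times are therefore discarded.

  A mixing error for every clump size up to [n/r] would bring in a factor [n/r]. It is avoided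
  because V_k >= j is the difference of two runs of visits whose probabilities decay geometrically
  in j; their sum gives the factor 1 / (1 - exp (-Gamma)).\<close>

lemma measurable_count_space2:
  fixes X :: "'a \<Rightarrow> 'b::countable" and Y :: "'a \<Rightarrow> 'c::countable"
  assumes X: "X \<in> measurable M (count_space UNIV)" and Y: "Y \<in> measurable M (count_space UNIV)"
  shows "(\<lambda>x. f (X x) (Y x)) \<in> measurable M (count_space UNIV)"
  by (rule measurable_compose_countable[where f="\<lambda>i x. f i (Y x)", OF measurable_compose[OF Y] X]) simp

lemma measurable_sum_nat:
  fixes X :: "'i \<Rightarrow> 'a \<Rightarrow> nat"
  assumes "\<And>i. i \<in> I \<Longrightarrow> X i \<in> measurable M (count_space UNIV)"
  shows "(\<lambda>x. \<Sum>i\<in>I. X i x) \<in> measurable M (count_space UNIV)"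
  using assms
proof (induction I rule: infinite_finite_induct)
  case (insert i I)
  then have "(\<lambda>x. X i x + (\<Sum>i\<in>I. X i x)) \<in> measurable M (count_space UNIV)"
    by (intro measurable_count_space2[where f="(+)"]) auto
  then show ?case using insert by simp
qed auto

text \<open>Total variation distance. Testing on functions into [0,1] instead of sets makes it
  stable under kernels: averaging such a function over \<open>K x\<close> gives another one.\<close>

definition tv_le :: "nat pmf \<Rightarrow> nat pmf \<Rightarrow> real \<Rightarrow> bool" where
  "tv_le P Q e \<longleftrightarrow> (\<forall>h::nat \<Rightarrow> real. (\<forall>x. 0 \<le> h x \<and> h x \<le> 1) \<longrightarrow>
     \<bar>measure_pmf.expectation P h - measure_pmf.expectation Q h\<bar> \<le> e)"

lemma integrable_pmf_unit:
  fixes h :: "'a \<Rightarrow> real"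
  assumes "\<And>x. 0 \<le> h x \<and> h x \<le> 1"
  shows "integrable (measure_pmf P) h"
  using assms by (intro measure_pmf.integrable_const_bound[where B=1]) auto

lemma expectation_pmf_unit:
  fixes h :: "'a \<Rightarrow> real"
  assumes "\<And>x. 0 \<le> h x \<and> h x \<le> 1"
  shows "0 \<le> measure_pmf.expectation P h \<and> measure_pmf.expectation P h \<le> 1"
proof
  show "0 \<le> measure_pmf.expectation P h" using assms by (intro integral_nonneg_AE) auto
  have "measure_pmf.expectation P h \<le> measure_pmf.expectation P (\<lambda>_. 1)"
    using assms by (intro integral_mono integrable_pmf_unit) auto
  then show "measure_pmf.expectation P h \<le> 1" by simp
qed

lemma expectation_bind_pmf_unit:
  fixes h :: "'b \<Rightarrow> real"
  assumes h: "\<And>x. 0 \<le> h x \<and> h x \<le> 1"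
  shows "measure_pmf.expectation (bind_pmf P K) h =
    measure_pmf.expectation P (\<lambda>x. measure_pmf.expectation (K x) h)"
proof -
  have E: "0 \<le> measure_pmf.expectation (K x) h \<and> measure_pmf.expectation (K x) h \<le> 1" for x
    by (rule expectation_pmf_unit[OF h])
  have "ennreal (measure_pmf.expectation (bind_pmf P K) h) = (\<integral>\<^sup>+x. h x \<partial>bind_pmf P K)"
    using h by (subst nn_integral_eq_integral) (auto intro: integrable_pmf_unit)
  also have "\<dots> = (\<integral>\<^sup>+x. (\<integral>\<^sup>+y. h y \<partial>K x) \<partial>P)" by simp
  also have "\<dots> = (\<integral>\<^sup>+x. ennreal (measure_pmf.expectation (K x) h) \<partial>P)"
    using h by (intro nn_integral_cong nn_integral_eq_integral) (auto intro: integrable_pmf_unit)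
  also have "\<dots> = ennreal (measure_pmf.expectation P (\<lambda>x. measure_pmf.expectation (K x) h))"
    using E by (intro nn_integral_eq_integral) (auto intro: integrable_pmf_unit)
  finally show ?thesis
    using expectation_pmf_unit[OF h, of "bind_pmf P K"] expectation_pmf_unit[OF E, of P]
    by (subst (asm) ennreal_inj) auto
qed

lemma tv_leD:
  "tv_le P Q e \<Longrightarrow> (\<And>x. 0 \<le> h x \<and> h x \<le> 1) \<Longrightarrow>
    \<bar>measure_pmf.expectation P h - measure_pmf.expectation Q h\<bar> \<le> e"
  unfolding tv_le_def by auto

lemma tv_le_sym: "tv_le P Q e \<Longrightarrow> tv_le Q P e"
  unfolding tv_le_def by (auto simp: abs_minus_commute)

lemma tv_le_trans: "tv_le P Q e \<Longrightarrow> tv_le Q R e' \<Longrightarrow> tv_le P R (e + e')"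
  unfolding tv_le_def by (smt (verit))

lemma tv_le_bind:
  assumes "tv_le P Q e"
  shows "tv_le (bind_pmf P K) (bind_pmf Q K) e"
  unfolding tv_le_def
proof (intro allI impI)
  fix h :: "nat \<Rightarrow> real" assume h: "\<forall>x. 0 \<le> h x \<and> h x \<le> 1"
  then have h': "\<And>x. 0 \<le> h x \<and> h x \<le> 1" by auto
  show "\<bar>measure_pmf.expectation (bind_pmf P K) h - measure_pmf.expectation (bind_pmf Q K) h\<bar> \<le> e"
    unfolding expectation_bind_pmf_unit[OF h']
    by (rule tv_leD[OF assms expectation_pmf_unit[OF h']])
qed

section \<open>Convolution of laws on the natural numbers, and Poisson laws\<close>

definition conv_pmf :: "nat pmf \<Rightarrow> nat pmf \<Rightarrow> nat pmf" where
  "conv_pmf P Q = bind_pmf P (\<lambda>x. map_pmf ((+) x) Q)"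

lemma conv_pmf_altdef: "conv_pmf P Q = bind_pmf P (\<lambda>x. bind_pmf Q (\<lambda>y. return_pmf (x + y)))"
  by (simp add: conv_pmf_def map_pmf_def)

lemma conv_pmf_commute: "conv_pmf P Q = conv_pmf Q P"
  unfolding conv_pmf_altdef by (subst bind_commute_pmf) (simp add: add.commute)

lemma conv_pmf_assoc: "conv_pmf (conv_pmf P Q) R = conv_pmf P (conv_pmf Q R)"
  unfolding conv_pmf_altdef by (simp add: bind_assoc_pmf bind_return_pmf add.assoc)

lemma conv_pmf_0 [simp]: "conv_pmf (return_pmf 0) P = P" "conv_pmf P (return_pmf 0) = P"
  by (simp_all add: conv_pmf_altdef bind_return_pmf bind_return_pmf')

lemma pmf_conv: "pmf (conv_pmf P Q) n = (\<Sum>i\<le>n. pmf P i * pmf Q (n - i))"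
proof -
  have e: "pmf (map_pmf ((+) x) Q) n = (if x \<le> n then pmf Q (n - x) else 0)" for x
  proof (cases "x \<le> n")
    case True
    then obtain k where "n = x + k" using le_Suc_ex by blast
    then show ?thesis using pmf_map_inj'[of "(+) x" Q k] by (simp add: inj_def)
  next
    case False
    then show ?thesis by (auto simp: pmf_eq_0_set_pmf)
  qed
  have "pmf (conv_pmf P Q) n = measure_pmf.expectation P (\<lambda>x. if x \<le> n then pmf Q (n - x) else 0)"
    unfolding conv_pmf_def pmf_bind e ..
  also have "\<dots> = (\<Sum>i\<le>n. (if i \<le> n then pmf Q (n - i) else 0) * pmf P i)"
    by (rule integral_measure_pmf_real) (auto split: if_splits)
  finally show ?thesis by (simp add: mult.commute)
qed

primrec conv_pow :: "nat pmf \<Rightarrow> nat \<Rightarrow> nat pmf" where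
  "conv_pow P 0 = return_pmf 0"
| "conv_pow P (Suc m) = conv_pmf P (conv_pow P m)"

lemma conv_pow_add: "conv_pow P (i + j) = conv_pmf (conv_pow P i) (conv_pow P j)"
  by (induction i) (simp_all add: conv_pmf_assoc)

lemma conv_poisson:
  assumes "0 < a" "0 < b"
  shows "conv_pmf (poisson_pmf a) (poisson_pmf b) = poisson_pmf (a + b)"
proof (rule pmf_eqI)
  fix n
  have "pmf (conv_pmf (poisson_pmf a) (poisson_pmf b)) n =
    (\<Sum>i\<le>n. (a ^ i / fact i * exp (-a)) * (b ^ (n - i) / fact (n - i) * exp (-b)))"
    using assms by (simp add: pmf_conv)
  also have "\<dots> = (\<Sum>i\<le>n. of_nat (n choose i) * a ^ i * b ^ (n - i)) * (exp (-(a+b)) / fact n)"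
    unfolding sum_distrib_right
  proof (rule sum.cong[OF refl])
    have e: "exp (-(a+b)) = exp (-a) * exp (-b)" by (simp add: exp_add[symmetric])
    show "a ^ i / fact i * exp (-a) * (b ^ (n - i) / fact (n - i) * exp (-b)) =
      of_nat (n choose i) * a ^ i * b ^ (n - i) * (exp (-(a+b)) / fact n)" if "i \<in> {..n}" for i
      using that unfolding e by (simp add: binomial_fact)
  qed
  also have "\<dots> = (a + b) ^ n / fact n * exp (-(a+b))"
    by (simp add: binomial_ring)
  finally show "pmf (conv_pmf (poisson_pmf a) (poisson_pmf b)) n = pmf (poisson_pmf (a + b)) n"
    using assms by simp
qed

lemma tv_le_conv_left: "tv_le P P' e \<Longrightarrow> tv_le (conv_pmf P Q) (conv_pmf P' Q) e"
  unfolding conv_pmf_def by (rule tv_le_bind)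

text \<open>The factors are exchanged one at a time; commutativity lets each exchange take place in
  the left factor of a convolution.\<close>

lemma tv_le_conv_pow:
  assumes "tv_le P P' e"
  shows "tv_le (conv_pow P m) (conv_pow P' m) (real m * e)"
proof (induction m)
  case 0
  then show ?case by (simp add: tv_le_def)
next
  case (Suc m)
  have "tv_le (conv_pmf P (conv_pow P m)) (conv_pmf P' (conv_pow P m)) e"
    by (rule tv_le_conv_left[OF assms])
  moreover have "tv_le (conv_pmf P' (conv_pow P m)) (conv_pmf P' (conv_pow P' m)) (real m * e)"
    unfolding conv_pmf_commute[of P'] by (rule tv_le_conv_left[OF Suc.IH])
  ultimately have "tv_le (conv_pmf P (conv_pow P m)) (conv_pmf P' (conv_pow P' m)) (e + real m * e)"
    by (rule tv_le_trans)
  then show ?case by (simp add: algebra_simps)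
qed

text \<open>A test function deviates from its value at 0 only off 0, by at most 1, and the mass off
  0 is \<open>1 - exp (- c)\<close>.\<close>

lemma tv_le_return_poisson:
  assumes "0 < c"
  shows "tv_le (poisson_pmf c) (return_pmf 0) c"
  unfolding tv_le_def
proof (intro allI impI)
  fix h :: "nat \<Rightarrow> real" assume h: "\<forall>x. 0 \<le> h x \<and> h x \<le> 1"
  have "\<bar>measure_pmf.expectation (poisson_pmf c) h - h 0\<bar> =
    \<bar>measure_pmf.expectation (poisson_pmf c) (\<lambda>x. h x - h 0)\<bar>"
    using h by (subst Bochner_Integration.integral_diff) (auto intro: integrable_pmf_unit)
  also have "\<dots> \<le> measure_pmf.expectation (poisson_pmf c) (\<lambda>x. \<bar>h x - h 0\<bar>)"
    by (rule integral_abs_bound)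
  also have "\<dots> \<le> measure_pmf.expectation (poisson_pmf c) (\<lambda>x. 1 - indicator {0} x)"
  proof (rule integral_mono)
    show "integrable (poisson_pmf c) (\<lambda>x. \<bar>h x - h 0\<bar>)"
      using h by (intro integrable_pmf_unit) (auto simp: abs_le_iff, (smt (verit))+)
    show "integrable (poisson_pmf c) (\<lambda>x. 1 - indicator {0} x :: real)"
      by (intro integrable_pmf_unit) (auto simp: indicator_def)
    show "\<bar>h x - h 0\<bar> \<le> 1 - indicator {0} x" for x
      using h[rule_format, of x] h[rule_format, of 0] by (auto simp: indicator_def abs_le_iff)
  qed
  also have "\<dots> = 1 - exp (- c)"
    using assms by (subst Bochner_Integration.integral_diff)
      (auto simp: measure_pmf_single intro: integrable_pmf_unit)
  also have "\<dots> \<le> c" using exp_ge_add_one_self[of "-c"] by simp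
  finally show "\<bar>measure_pmf.expectation (poisson_pmf c) h -
    measure_pmf.expectation (return_pmf 0) h\<bar> \<le> c" by simp
qed

text \<open>The law with the larger parameter is the one with the smaller parameter convolved with a
  Poisson law whose parameter is the difference.\<close>

lemma tv_le_poisson:
  assumes "0 < a" "0 < b"
  shows "tv_le (poisson_pmf a) (poisson_pmf b) \<bar>a - b\<bar>"
proof -
  have *: "tv_le (poisson_pmf (b + c)) (poisson_pmf b) c" if "0 < b" "0 < c" for b c :: real
    using tv_le_conv_left[OF tv_le_return_poisson[OF that(2)], of "poisson_pmf b"] that
    by (simp add: conv_poisson add.commute)
  consider "a < b" | "a = b" | "b < a" by linarith
  then show ?thesis
  proof cases
    case 1
    then show ?thesis using tv_le_sym[OF *[of a "b - a"]] assms by simp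
  next
    case 2
    then show ?thesis by (simp add: tv_le_def)
  next
    case 3
    then show ?thesis using *[of b "a - b"] assms by simp
  qed
qed

section \<open>Comparison with compound Poisson laws and their realization\<close>

definition compound_poisson :: "real \<Rightarrow> nat pmf \<Rightarrow> nat pmf" where
  "compound_poisson c \<eta> = bind_pmf (poisson_pmf c) (conv_pow \<eta>)"

lemma compound_poisson_add:
  assumes "0 < a" "0 < b"
  shows "conv_pmf (compound_poisson a \<eta>) (compound_poisson b \<eta>) = compound_poisson (a + b) \<eta>"
proof -
  have "conv_pmf (compound_poisson a \<eta>) (compound_poisson b \<eta>) =
    bind_pmf (poisson_pmf a) (\<lambda>i. bind_pmf (conv_pow \<eta> i) (\<lambda>x. bind_pmf (poisson_pmf b)
      (\<lambda>j. bind_pmf (conv_pow \<eta> j) (\<lambda>y. return_pmf (x + y)))))"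
    by (simp add: conv_pmf_altdef compound_poisson_def bind_assoc_pmf)
  also have "\<dots> = bind_pmf (poisson_pmf a) (\<lambda>i. bind_pmf (poisson_pmf b) (\<lambda>j. conv_pow \<eta> (i + j)))"
  proof (rule bind_pmf_cong[OF refl])
    fix i
    show "bind_pmf (conv_pow \<eta> i) (\<lambda>x. bind_pmf (poisson_pmf b)
        (\<lambda>j. bind_pmf (conv_pow \<eta> j) (\<lambda>y. return_pmf (x + y)))) =
      bind_pmf (poisson_pmf b) (\<lambda>j. conv_pow \<eta> (i + j))"
      by (subst bind_commute_pmf) (simp add: conv_pow_add conv_pmf_altdef)
  qed
  also have "\<dots> = bind_pmf (conv_pmf (poisson_pmf a) (poisson_pmf b)) (conv_pow \<eta>)"
    by (simp add: conv_pmf_altdef bind_assoc_pmf bind_return_pmf)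
  finally show ?thesis using assms by (simp add: conv_poisson compound_poisson_def)
qed

lemma conv_pow_compound_poisson:
  assumes "0 < p"
  shows "conv_pow (compound_poisson p \<eta>) (Suc m) = compound_poisson (real (Suc m) * p) \<eta>"
proof (induction m)
  case (Suc m)
  show ?case
    unfolding conv_pow.simps(2)[of _ "Suc m"] Suc
    using assms by (subst compound_poisson_add) (auto simp: algebra_simps intro!: add_pos_nonneg)
qed simp

text \<open>\<open>\<xi>\<close> takes one step from \<open>\<eta>\<close> with probability
  \<open>p\<close> and none otherwise; the compound law takes a Poisson number of steps. Passing
  from one count to the other moves only the mass
  \<open>p * (1 - exp (- p)) \<le> p\<^sup>2\<close>, from one step to zero or several
  steps.\<close>

lemma tv_le_compound_poisson_single:
  assumes p: "0 < p"
    and \<xi>: "\<And>h::nat \<Rightarrow> real. (\<And>x. 0 \<le> h x \<and> h x \<le> 1) \<Longrightarrow> measure_pmf.expectation \<xi> h =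
       (1 - p) * h 0 + p * measure_pmf.expectation \<eta> h"
  shows "tv_le \<xi> (compound_poisson p \<eta>) (p\<^sup>2)"
  unfolding tv_le_def
proof (intro allI impI)
  fix h :: "nat \<Rightarrow> real" assume "\<forall>x. 0 \<le> h x \<and> h x \<le> 1"
  then have h: "\<And>x. 0 \<le> h x \<and> h x \<le> 1" by auto
  define G where "G m = measure_pmf.expectation (conv_pow \<eta> m) h" for m
  have G: "0 \<le> G m \<and> G m \<le> 1" for m unfolding G_def by (rule expectation_pmf_unit[OF h])
  have G0: "G 0 = h 0" and G1: "G 1 = measure_pmf.expectation \<eta> h" by (simp_all add: G_def)
  define R where "R = measure_pmf.expectation (poisson_pmf p) (\<lambda>m. indicator {2..} m * G m)"
  have int: "integrable (poisson_pmf p) (\<lambda>m. indicator S m * G m)" for S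
    using G by (intro integrable_pmf_unit) (auto simp: indicator_def)
  have single: "measure_pmf.expectation (poisson_pmf p) (\<lambda>m. indicator {k} m * c) =
      pmf (poisson_pmf p) k * c" for k c
    by (simp add: measure_pmf_single)
  have single_eq: "(\<lambda>m. indicator {k} m * G m) = (\<lambda>m. indicator {k} m * G k)" for k
  proof
    show "indicator {k} m * G m = indicator {k} m * G k" for m by (cases "m = k") auto
  qed
  have "measure_pmf.expectation (compound_poisson p \<eta>) h = measure_pmf.expectation (poisson_pmf p) G"
    unfolding compound_poisson_def G_def by (rule expectation_bind_pmf_unit[OF h])
  also have "\<dots> = measure_pmf.expectation (poisson_pmf p)
      (\<lambda>m. indicator {0} m * G m + indicator {1} m * G m + indicator {2..} m * G m)"
    by (intro Bochner_Integration.integral_cong) (auto simp: indicator_def)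
  also have "\<dots> = measure_pmf.expectation (poisson_pmf p) (\<lambda>m. indicator {0} m * G m) +
     measure_pmf.expectation (poisson_pmf p) (\<lambda>m. indicator {1} m * G m) + R"
    unfolding R_def by (simp only: Bochner_Integration.integral_add[OF int int]
      Bochner_Integration.integral_add[OF Bochner_Integration.integrable_add[OF int int] int])
  also have "(\<lambda>m. indicator {0} m * G m) = (\<lambda>m. indicator {0} m * G 0)"
    by (rule single_eq)
  also have "(\<lambda>m. indicator {1} m * G m) = (\<lambda>m. indicator {1} m * G 1)"
    by (rule single_eq)
  finally have E: "measure_pmf.expectation (compound_poisson p \<eta>) h =
      exp (-p) * G 0 + p * exp (-p) * G 1 + R"
    unfolding single using p by simp
  have R0: "0 \<le> R" unfolding R_def using G by (intro integral_nonneg_AE) (auto simp: indicator_def)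
  have "R \<le> measure_pmf.expectation (poisson_pmf p) (\<lambda>m. 1 - indicator {0} m * 1 - indicator {1} m * 1)"
    unfolding R_def using G
    by (intro integral_mono int integrable_pmf_unit) (auto simp: indicator_def)
  also have "\<dots> = 1 - exp (-p) - p * exp (-p)"
  proof -
    have i: "integrable (poisson_pmf p) (indicator S :: nat \<Rightarrow> real)" for S
      by (intro integrable_pmf_unit) (auto simp: indicator_def)
    have "measure_pmf.expectation (poisson_pmf p) (\<lambda>m. 1 - indicator {0} m - indicator {1} m) =
      1 - pmf (poisson_pmf p) 0 - pmf (poisson_pmf p) 1"
      by (subst Bochner_Integration.integral_diff[OF Bochner_Integration.integrable_diff[OF _ i] i], simp,
        subst Bochner_Integration.integral_diff[OF _ i], simp) (simp add: measure_pmf_single)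
    then show ?thesis using p by simp
  qed
  finally have R1: "R \<le> 1 - exp (-p) - p * exp (-p)" .
  have e: "1 - p \<le> exp (-p)" using exp_ge_add_one_self[of "-p"] by simp
  have e1: "exp (-p) \<le> 1" using p by simp
  have "p * (1 - exp (-p)) \<le> p * p" using e p by (intro mult_left_mono) auto
  then have u: "p * (1 - exp (-p)) \<le> p\<^sup>2" by (simp add: power2_eq_square)
  have D: "measure_pmf.expectation \<xi> h - measure_pmf.expectation (compound_poisson p \<eta>) h =
     p * (1 - exp (-p)) * G 1 - (exp (-p) - (1 - p)) * G 0 - R"
    unfolding E \<xi>[OF h] G0 G1 by (simp add: algebra_simps)
  have a: "p * (1 - exp (-p)) * G 1 \<le> p * (1 - exp (-p)) * 1"
    using G[of 1] p e1 by (intro mult_left_mono) auto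
  have b: "0 \<le> p * (1 - exp (-p)) * G 1" using G[of 1] p e1 by simp
  have c: "(exp (-p) - (1 - p)) * G 0 \<le> (exp (-p) - (1 - p)) * 1"
    using G[of 0] e by (intro mult_left_mono) auto
  have d: "0 \<le> (exp (-p) - (1 - p)) * G 0" using G[of 0] e by simp
  show "\<bar>measure_pmf.expectation \<xi> h - measure_pmf.expectation (compound_poisson p \<eta>) h\<bar> \<le> p\<^sup>2"
    unfolding D abs_le_iff using a b c d u R0 R1 by (simp add: algebra_simps)
qed

lemma tv_le_compound_poisson:
  assumes p: "0 \<le> p" and c: "0 < c"
    and \<xi>: "\<And>h::nat \<Rightarrow> real. (\<And>x. 0 \<le> h x \<and> h x \<le> 1) \<Longrightarrow> measure_pmf.expectation \<xi> h =
       (1 - p) * h 0 + p * measure_pmf.expectation \<eta> h"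
  shows "tv_le (conv_pow \<xi> m) (compound_poisson c \<eta>) (real m * p\<^sup>2 + \<bar>real m * p - c\<bar>)"
\<comment> \<open>The parameter \<open>real m * p\<close> vanishes here, and the Poisson facts need
  a positive one. The convolution power is then a point mass at 0, and the bound to be shown is
  \<open>c\<close>.\<close>
proof (cases "p = 0 \<or> m = 0")
  case True
  have "tv_le (conv_pow \<xi> m) (return_pmf 0) (real m * 0)"
  proof (cases "p = 0")
    case True
    have "tv_le (conv_pow \<xi> m) (conv_pow (return_pmf 0) m) (real m * 0)"
      by (rule tv_le_conv_pow) (simp add: tv_le_def \<xi> True)
    moreover have "conv_pow (return_pmf 0) m = return_pmf 0" by (induction m) auto
    ultimately show ?thesis by simp
  next
    case False
    with True show ?thesis by (simp add: tv_le_def)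
  qed
  moreover have "tv_le (return_pmf 0) (compound_poisson c \<eta>) c"
    using tv_le_bind[OF tv_le_sym[OF tv_le_return_poisson[OF c]], of "conv_pow \<eta>"]
    by (simp add: compound_poisson_def bind_return_pmf)
  ultimately show ?thesis using True c by (auto dest: tv_le_trans)
next
  case False
  then obtain m' where m: "m = Suc m'" and p: "0 < p" using p by (cases m) auto
  show ?thesis
  proof (rule tv_le_trans)
    show "tv_le (conv_pow \<xi> m) (compound_poisson (real m * p) \<eta>) (real m * p\<^sup>2)"
      using tv_le_conv_pow[OF tv_le_compound_poisson_single[OF p \<xi>], of m]
      unfolding m conv_pow_compound_poisson[OF p] by simp
    show "tv_le (compound_poisson (real m * p) \<eta>) (compound_poisson c \<eta>) \<bar>real m * p - c\<bar>"
      unfolding compound_poisson_def using p c m by (intro tv_le_bind tv_le_poisson) auto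
  qed
qed

lemma compound_poisson_realization:
  fixes \<eta> :: "nat pmf"
  assumes c: "0 < c" and \<eta>: "set_pmf \<eta> \<subseteq> S"
  shows "\<exists>(Q :: (nat \<Rightarrow> nat) measure) (W :: (nat \<Rightarrow> nat) \<Rightarrow> nat) (Y :: nat \<Rightarrow> (nat \<Rightarrow> nat) \<Rightarrow> nat).
    prob_space Q \<and>
    prob_space.indep_vars Q (\<lambda>_. count_space UNIV) (\<lambda>k. if k = 0 then W else Y k) UNIV \<and>
    distr Q (count_space UNIV) W = measure_pmf (poisson_pmf c) \<and>
    (\<forall>k\<ge>1. distr Q (count_space UNIV) (Y k) = distr Q (count_space UNIV) (Y 1)) \<and>
    \<P>(x in Q. Y 1 x \<in> S) = 1 \<and>
    (\<forall>L. \<P>(x in Q. (\<Sum>k=1..W x. Y k x) \<in> L) = measure_pmf.prob (compound_poisson c \<eta>) L)"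
proof -
  \<comment> \<open>Coordinate 0 of the product space is the Poisson counter, all other coordinates
    are the summands.\<close>
  define D where "D k = (if k = 0 then poisson_pmf c else \<eta>)" for k :: nat
  define Q where "Q = PiM (UNIV :: nat set) (\<lambda>k. measure_pmf (D k))"
  interpret prod: product_prob_space "\<lambda>k. measure_pmf (D k)" UNIV
    by standard
  interpret Q: prob_space Q unfolding Q_def by (rule prod.prob_space_axioms)
  have space_Q: "space Q = UNIV" by (simp add: Q_def space_PiM)
  have sets_Q: "sets Q = sets (PiM UNIV (\<lambda>_. count_space UNIV))"
    unfolding Q_def by (rule sets_PiM_cong) auto
  have coord[measurable]: "(\<lambda>x. x k) \<in> measurable Q (count_space UNIV)" for k
    unfolding measurable_cong_sets[OF sets_Q refl] by (rule measurable_component_singleton) simp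
  have distr: "distr Q (count_space UNIV) (\<lambda>x. x k) = measure_pmf (D k)" for k
  proof -
    have "distr Q (count_space UNIV) (\<lambda>x. x k) = distr Q (measure_pmf (D k)) (\<lambda>x. x k)"
      by (rule distr_cong) auto
    also have "\<dots> = measure_pmf (D k)" unfolding Q_def by (rule prod.PiM_component) simp
    finally show ?thesis .
  qed
  have indep: "Q.indep_vars (\<lambda>_. count_space UNIV) (\<lambda>k x. x k) UNIV"
  proof (subst Q.indep_vars_iff_distr_eq_PiM)
    have "distr Q (PiM UNIV (\<lambda>_. count_space UNIV)) (\<lambda>x. \<lambda>i\<in>UNIV. x i) = distr Q Q (\<lambda>x. x)"
      by (rule distr_cong) (auto simp: sets_Q)
    also have "\<dots> = PiM UNIV (\<lambda>i. distr Q (count_space UNIV) (\<lambda>x. x i))"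
      unfolding distr by (simp add: Q_def)
    finally show "distr Q (PiM UNIV (\<lambda>_. count_space UNIV)) (\<lambda>x. \<lambda>i\<in>UNIV. x i) =
      PiM UNIV (\<lambda>i. distr Q (count_space UNIV) (\<lambda>x. x i))" .
  qed auto
  have single: "Q.prob {x. x k = i} = pmf (D k) i" for k i
  proof -
    have "pmf (D k) i = measure (distr Q (count_space UNIV) (\<lambda>x. x k)) {i}"
      unfolding distr by (simp add: measure_pmf_single)
    also have "\<dots> = Q.prob {x. x k = i}"
      by (subst measure_distr) (auto simp: space_Q vimage_def)
    finally show ?thesis by simp
  qed
  have [measurable]: "(\<lambda>x. \<Sum>k=1..m. x k) \<in> measurable Q (count_space UNIV)" for m
    by (rule measurable_sum_nat) auto
  \<comment> \<open>With the counter fixed together with the partial sum, the induction needs only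
    that coordinate \<open>Suc m\<close> is independent of the coordinates in \<open>{0..m}\<close>.
    The random number of summands is resolved afterwards by summing the case \<open>m = a\<close>
    over \<open>a\<close>.\<close>
  have joint: "Q.prob {x. x 0 = a \<and> (\<Sum>k=1..m. x k) = s} = pmf (poisson_pmf c) a * pmf (conv_pow \<eta> m) s" for a m s
  proof (induction m arbitrary: s)
    case 0
    then show ?case using single[of 0 a] by (cases "s = 0") (auto simp: D_def)
  next
    case (Suc m)
    have e: "Q.prob {x. x (Suc m) = i \<and> (x 0 = a \<and> (\<Sum>k=1..m. x k) = u)} =
      pmf \<eta> i * (pmf (poisson_pmf c) a * pmf (conv_pow \<eta> m) u)" for i u
    proof -
      define A where "A = {f \<in> space (PiM {Suc m} (\<lambda>_. count_space UNIV)). f (Suc m) = i}"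
      define B where "B = {f \<in> space (PiM {0..m} (\<lambda>_. count_space UNIV)). f 0 = a \<and> (\<Sum>k=1..m. f k) = u}"
      have [measurable]: "(\<lambda>f. f k) \<in> measurable (PiM {0..m} (\<lambda>_. count_space UNIV)) (count_space (UNIV :: nat set))"
        if "k \<le> m" for k using that by (intro measurable_component_singleton) auto
      have ms: "(\<lambda>f. \<Sum>k=1..j. f k) \<in> measurable (PiM {0..m} (\<lambda>_. count_space UNIV)) (count_space (UNIV :: nat set))"
        if "j \<le> m" for j using that by (intro measurable_sum_nat) auto
      have A: "A \<in> sets (PiM {Suc m} (\<lambda>_. count_space UNIV))"
        unfolding A_def by measurable
      have B: "B \<in> sets (PiM {0..m} (\<lambda>_. count_space UNIV))"
        unfolding B_def using ms[of m] by measurable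
      have iv: "Q.indep_var (PiM {Suc m} (\<lambda>_. count_space UNIV)) (\<lambda>x. restrict x {Suc m})
          (PiM {0..m} (\<lambda>_. count_space UNIV)) (\<lambda>x. restrict x {0..m})"
        using Q.indep_var_restrict[OF indep, of "{Suc m}" "{0..m}"] by simp
      have v1: "(\<lambda>x. (restrict x {Suc m}, restrict x {0..m})) -` (A \<times> B) \<inter> space Q =
        {x. x (Suc m) = i \<and> (x 0 = a \<and> (\<Sum>k=1..m. x k) = u)}"
        by (auto simp: A_def B_def space_Q space_PiM)
      have v2: "(\<lambda>x. restrict x {Suc m}) -` A \<inter> space Q = {x. x (Suc m) = i}"
        by (auto simp: A_def space_Q space_PiM)
      have v3: "(\<lambda>x. restrict x {0..m}) -` B \<inter> space Q = {x. x 0 = a \<and> (\<Sum>k=1..m. x k) = u}"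
        by (auto simp: B_def space_Q space_PiM)
      show ?thesis
        using Q.indep_varD[OF iv A B] unfolding v1 v2 v3 Suc.IH single by (simp add: D_def)
    qed
    have "{x. x 0 = a \<and> (\<Sum>k=1..Suc m. x k) = s} =
      (\<Union>i\<in>{..s}. {x. x (Suc m) = i \<and> (x 0 = a \<and> (\<Sum>k=1..m. x k) = s - i)})"
      by auto
    also have "Q.prob \<dots> = (\<Sum>i\<le>s. Q.prob {x. x (Suc m) = i \<and> (x 0 = a \<and> (\<Sum>k=1..m. x k) = s - i)})"
    proof (rule Q.finite_measure_finite_Union)
      have "{x \<in> space Q. x (Suc m) = i \<and> (x 0 = a \<and> (\<Sum>k=1..m. x k) = s - i)} \<in> sets Q" for i
        by measurable
      then show "(\<lambda>i. {x. x (Suc m) = i \<and> (x 0 = a \<and> (\<Sum>k=1..m. x k) = s - i)}) ` {..s} \<subseteq> sets Q"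
        by (auto simp: space_Q)
    qed (auto simp: disjoint_family_on_def)
    also have "\<dots> = pmf (poisson_pmf c) a * pmf (conv_pow \<eta> (Suc m)) s"
      unfolding e by (simp add: pmf_conv sum_distrib_left mult_ac)
    finally show ?case .
  qed
  have mY: "(\<lambda>x. \<Sum>k=1..x 0. x k) \<in> measurable Q (count_space UNIV)"
    by (rule measurable_compose_countable[where f="\<lambda>m x. \<Sum>k=1..m. x k"]) auto
  have law: "distr Q (count_space UNIV) (\<lambda>x. \<Sum>k=1..x 0. x k) = measure_pmf (compound_poisson c \<eta>)"
  proof (rule measure_eqI_countable[where A=UNIV])
    fix s :: nat
    have "emeasure (distr Q (count_space UNIV) (\<lambda>x. \<Sum>k=1..x 0. x k)) {s} = emeasure Q {x. (\<Sum>k=1..x 0. x k) = s}"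
      by (subst emeasure_distr[OF mY]) (auto simp: space_Q vimage_def)
    also have "{x. (\<Sum>k=1..x 0. x k) = s} = (\<Union>a\<in>UNIV. {x. x 0 = a \<and> (\<Sum>k=1..a. x k) = s})" by auto
    also have "emeasure Q \<dots> = (\<integral>\<^sup>+a. emeasure Q {x. x 0 = a \<and> (\<Sum>k=1..a. x k) = s} \<partial>count_space UNIV)"
    proof (rule emeasure_UN_countable)
      have "{x \<in> space Q. x 0 = a \<and> (\<Sum>k=1..a. x k) = s} \<in> sets Q" for a by measurable
      then show "{x. x 0 = a \<and> (\<Sum>k=1..a. x k) = s} \<in> sets Q" for a by (simp add: space_Q)
    qed (auto simp: disjoint_family_on_def)
    also have "\<dots> = (\<integral>\<^sup>+a. ennreal (pmf (poisson_pmf c) a) * ennreal (pmf (conv_pow \<eta> a) s) \<partial>count_space UNIV)"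
      unfolding Q.emeasure_eq_measure joint by (simp add: ennreal_mult)
    also have "\<dots> = emeasure (measure_pmf (compound_poisson c \<eta>)) {s}"
      unfolding compound_poisson_def emeasure_pmf_single ennreal_pmf_bind nn_integral_measure_pmf ..
    finally show "emeasure (distr Q (count_space UNIV) (\<lambda>x. \<Sum>k=1..x 0. x k)) {s} =
      emeasure (measure_pmf (compound_poisson c \<eta>)) {s}" .
  qed auto
  have i1: "Q.indep_vars (\<lambda>_. count_space UNIV) (\<lambda>k. if k = 0 then (\<lambda>x. x 0) else (\<lambda>x. x k)) UNIV"
  proof -
    have "(\<lambda>k. if k = (0::nat) then (\<lambda>x. x 0) else (\<lambda>x. x k)) = (\<lambda>k (x :: nat \<Rightarrow> nat). x k)"
      by (auto simp: fun_eq_iff)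
    with indep show ?thesis by (simp only:)
  qed
  have i2: "distr Q (count_space UNIV) (\<lambda>x. x 0) = measure_pmf (poisson_pmf c)"
    unfolding distr by (simp add: D_def)
  have i3: "\<forall>k\<ge>1. distr Q (count_space UNIV) (\<lambda>x. x k) = distr Q (count_space UNIV) (\<lambda>x. x 1)"
    unfolding distr by (auto simp: D_def)
  have i5: "\<forall>L. \<P>(x in Q. (\<Sum>k=1..x 0. x k) \<in> L) = measure_pmf.prob (compound_poisson c \<eta>) L"
    unfolding law[symmetric] by (subst measure_distr[OF mY]) (auto simp: space_Q vimage_def)
  have i4: "\<P>(x in Q. x 1 \<in> S) = 1"
  proof -
    have "1 = measure_pmf.prob \<eta> S" using \<eta> by (simp add: measure_pmf.prob_eq_1 AE_measure_pmf_iff subset_eq)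
    also have "measure_pmf \<eta> = distr Q (count_space UNIV) (\<lambda>x. x 1)" unfolding distr by (simp add: D_def)
    also have "measure \<dots> S = \<P>(x in Q. x 1 \<in> S)"
      by (subst measure_distr) (auto simp: space_Q vimage_def)
    finally show ?thesis by simp
  qed
  show ?thesis
    by (intro exI[of _ Q] exI[of _ "\<lambda>x. x 0"] exI[of _ "\<lambda>k x. x k"] conjI
      Q.prob_space_axioms i1 i2 i3 i4 i5)
qed

section \<open>Replacement by independent copies\<close>

text \<open>Telescoping. It replaces the values of a variable by its tail events
  \<open>j \<le> v\<close>, the form in which a clump size can be compared with an independent
  copy.\<close>

lemma tail_expansion:
  fixes f :: "nat \<Rightarrow> real"
  assumes "v \<le> J"
  shows "f v = f 0 + (\<Sum>j=1..J. of_bool (j \<le> v) * (f j - f (j - 1)))"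
proof -
  have "(\<Sum>j=1..J. of_bool (j \<le> v) * (f j - f (j - 1))) = (\<Sum>j=1..v. f j - f (j - 1))"
    using assms by (intro sum.mono_neutral_cong_right) auto
  also have "\<dots> = f v - f 0" by (induction v) auto
  finally show ?thesis by simp
qed

lemma (in prob_space) integrable_indicator_mult:
  fixes c :: real
  shows "E \<in> sets M \<Longrightarrow> integrable M (\<lambda>x. c * indicator E x)"
  by (intro integrable_mult_right integrable_real_indicator) (auto simp: emeasure_eq_measure)

lemma (in prob_space) prob_space_count_sum:
  fixes X :: "'a \<Rightarrow> nat" and f :: "nat \<Rightarrow> real"
  assumes X[measurable]: "X \<in> measurable M (count_space UNIV)" and XB: "\<And>x. X x \<le> B"
    and E[measurable]: "E \<in> sets M"
  shows "(\<integral>x. indicator E x * f (X x) \<partial>M) = (\<Sum>u\<le>B. f u * prob {x \<in> space M. x \<in> E \<and> X x = u})"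
proof -
  have "(\<integral>x. indicator E x * f (X x) \<partial>M) =
    (\<integral>x. (\<Sum>u\<le>B. f u * indicator {x \<in> space M. x \<in> E \<and> X x = u} x) \<partial>M)"
  proof (rule Bochner_Integration.integral_cong[OF refl])
    fix x assume "x \<in> space M"
    then have "(\<Sum>u\<le>B. f u * indicator {x \<in> space M. x \<in> E \<and> X x = u} x) =
      (\<Sum>u\<le>B. if u = X x then f u * indicator E x else 0)"
      by (intro sum.cong) (auto simp: indicator_def)
    then show "indicator E x * f (X x) = (\<Sum>u\<le>B. f u * indicator {x \<in> space M. x \<in> E \<and> X x = u} x)"
      using XB[of x] by simp
  qed
  also have "\<dots> = (\<Sum>u\<le>B. f u * prob {x \<in> space M. x \<in> E \<and> X x = u})"
    by (subst Bochner_Integration.integral_sum, rule integrable_indicator_mult, measurable)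
  finally show ?thesis .
qed

lemma (in prob_space) integrable_bounded_nat:
  fixes f :: "nat \<Rightarrow> real"
  assumes [measurable]: "X \<in> measurable M (count_space UNIV)" and "\<And>u. \<bar>f u\<bar> \<le> c"
  shows "integrable M (\<lambda>x. f (X x))"
  using assms by (intro integrable_const_bound[where B=c]) auto

text \<open>Only the range of the first difference of \<open>h\<close> enters, so no smoothing is needed: where
  \<open>U \<noteq> U'\<close> the integrand changes by at most 2, and where \<open>V = 0\<close> not at all.\<close>

lemma (in prob_space) replacement_step:
  fixes h :: "nat \<Rightarrow> real"
  assumes h: "\<And>x. 0 \<le> h x \<and> h x \<le> 1"
    and [measurable]: "U \<in> measurable M (count_space UNIV)" "U' \<in> measurable M (count_space UNIV)"
      "V \<in> measurable M (count_space UNIV)"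
    and VJ: "\<And>x. V x \<le> J" and UB: "\<And>x. U' x \<le> B"
    and p: "0 \<le> p"
    and \<xi>: "\<And>h::nat \<Rightarrow> real. (\<And>x. 0 \<le> h x \<and> h x \<le> 1) \<Longrightarrow> measure_pmf.expectation \<xi> h =
       (1 - p) * h 0 + p * measure_pmf.expectation \<eta> h"
    and tail: "\<And>h::nat \<Rightarrow> real. (\<And>x. 0 \<le> h x \<and> h x \<le> 1) \<Longrightarrow> measure_pmf.expectation \<xi> h =
       h 0 + (\<Sum>j=1..J. \<tau> j * (h j - h (j - 1)))"
    and mix: "\<And>j u. j \<in> {1..J} \<Longrightarrow>
       \<bar>prob {x \<in> space M. j \<le> V x \<and> U' x = u} - \<tau> j * prob {x \<in> space M. U' x = u}\<bar>
          \<le> \<delta> j * prob {x \<in> space M. U' x = u}"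
  shows "\<bar>(\<integral>x. h (U x + V x) \<partial>M) - (\<integral>x. measure_pmf.expectation \<xi> (\<lambda>y. h (U x + y)) \<partial>M)\<bar>
    \<le> 2 * prob {x \<in> space M. V x \<noteq> 0 \<and> U x \<noteq> U' x} + 2 * p * prob {x \<in> space M. U x \<noteq> U' x} +
      (\<Sum>j=1..J. \<delta> j)"
proof -
  define g where "g u = measure_pmf.expectation \<xi> (\<lambda>y. h (u + y)) - h u" for u
  define \<Delta> where "\<Delta> j u = h (u + j) - h (u + (j - 1))" for j u
  have \<Delta>: "\<bar>\<Delta> j u\<bar> \<le> 1" for j u using h[of "u + j"] h[of "u + (j - 1)"] by (simp add: \<Delta>_def abs_le_iff)
  \<comment> \<open>The two hypotheses describe the same law: the mixture with a point mass at 0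
    shows that \<open>g\<close> is at most \<open>p\<close> in size, and the tail formula matches
    \<open>g\<close> term by term with the expansion of \<open>a'\<close>.\<close>
  have g1: "g u = p * (measure_pmf.expectation \<eta> (\<lambda>y. h (u + y)) - h u)" for u
    unfolding g_def by (subst \<xi>) (use h in \<open>auto simp: algebra_simps\<close>)
  have g2: "g u = (\<Sum>j=1..J. \<tau> j * \<Delta> j u)" for u
    unfolding g_def \<Delta>_def by (subst tail) (use h in \<open>auto simp: algebra_simps\<close>)
  have gp: "\<bar>g u\<bar> \<le> p" for u
  proof -
    have "\<bar>measure_pmf.expectation \<eta> (\<lambda>y. h (u + y)) - h u\<bar> \<le> 1"
      using expectation_pmf_unit[of "\<lambda>y. h (u + y)" \<eta>, OF h] h[of u] by (auto simp: abs_le_iff)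
    then show ?thesis unfolding g1 abs_mult using p by (simp add: mult_left_le)
  qed
  have hb: "\<bar>h u\<bar> \<le> 1" for u using h[of u] by auto
  have hint: "integrable M (\<lambda>x. h (X x))" if "X \<in> measurable M (count_space UNIV)" for X
    using that hb by (rule integrable_bounded_nat)
  have gint: "integrable M (\<lambda>x. g (X x))" if "X \<in> measurable M (count_space UNIV)" for X
    using that gp by (rule integrable_bounded_nat)
  have [measurable]: "(\<lambda>x. U x + V x) \<in> measurable M (count_space UNIV)"
    "(\<lambda>x. U' x + V x) \<in> measurable M (count_space UNIV)" by measurable
  note ints = hint gint
  have [measurable]: "Measurable.pred M (\<lambda>x. U x \<noteq> U' x)"
    by (rule measurable_count_space2[where f="(\<noteq>)"]) fact+
  define a where "a x = h (U x + V x) - h (U x)" for x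
  define a' where "a' x = h (U' x + V x) - h (U' x)" for x
  have aint: "integrable M a" "integrable M a'" unfolding a_def a'_def
    by (intro Bochner_Integration.integrable_diff hint; fact)+
  have "(\<integral>x. measure_pmf.expectation \<xi> (\<lambda>y. h (U x + y)) \<partial>M) = (\<integral>x. g (U x) + h (U x) \<partial>M)"
    by (simp add: g_def)
  also have "\<dots> = (\<integral>x. g (U x) \<partial>M) + (\<integral>x. h (U x) \<partial>M)" by (simp add: ints)
  \<comment> \<open>\<open>U\<close> is exchanged for \<open>U'\<close>, the mixing hypothesis is
    applied at \<open>U'\<close>, and \<open>U'\<close> is exchanged back. The first exchange
    matters only where \<open>V\<close> is nonzero; the last one carries the factor
    \<open>p\<close>.\<close>
  finally have e1: "(\<integral>x. h (U x + V x) \<partial>M) - (\<integral>x. measure_pmf.expectation \<xi> (\<lambda>y. h (U x + y)) \<partial>M) =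
    ((\<integral>x. a x \<partial>M) - (\<integral>x. a' x \<partial>M)) + ((\<integral>x. a' x \<partial>M) - (\<integral>x. g (U' x) \<partial>M)) +
    ((\<integral>x. g (U' x) \<partial>M) - (\<integral>x. g (U x) \<partial>M))"
    unfolding a_def by (simp add: ints)
  have c1: "\<bar>(\<integral>x. a x \<partial>M) - (\<integral>x. a' x \<partial>M)\<bar> \<le> 2 * prob {x \<in> space M. V x \<noteq> 0 \<and> U x \<noteq> U' x}"
  proof -
    have "\<bar>(\<integral>x. a x \<partial>M) - (\<integral>x. a' x \<partial>M)\<bar> = \<bar>\<integral>x. a x - a' x \<partial>M\<bar>" by (simp add: aint)
    also have "\<dots> \<le> (\<integral>x. \<bar>a x - a' x\<bar> \<partial>M)" by (rule integral_abs_bound)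
    also have "\<dots> \<le> (\<integral>x. 2 * indicator {x \<in> space M. V x \<noteq> 0 \<and> U x \<noteq> U' x} x \<partial>M)"
    proof (rule integral_mono)
      fix x assume "x \<in> space M"
      then show "\<bar>a x - a' x\<bar> \<le> 2 * indicator {x \<in> space M. V x \<noteq> 0 \<and> U x \<noteq> U' x} x"
        using h[of "U x + V x"] h[of "U x"] h[of "U' x + V x"] h[of "U' x"]
        by (auto simp: a_def a'_def indicator_def abs_le_iff)
    next
      show "integrable M (\<lambda>x. 2 * indicator {x \<in> space M. V x \<noteq> 0 \<and> U x \<noteq> U' x} x :: real)"
        by (rule integrable_indicator_mult) measurable
      show "integrable M (\<lambda>x. \<bar>a x - a' x\<bar>)"
        by (intro Bochner_Integration.integrable_diff aint integrable_abs)
    qed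
    finally show ?thesis by simp
  qed
  have c3: "\<bar>(\<integral>x. g (U' x) \<partial>M) - (\<integral>x. g (U x) \<partial>M)\<bar> \<le> 2 * p * prob {x \<in> space M. U x \<noteq> U' x}"
  proof -
    have "\<bar>(\<integral>x. g (U' x) \<partial>M) - (\<integral>x. g (U x) \<partial>M)\<bar> = \<bar>\<integral>x. g (U' x) - g (U x) \<partial>M\<bar>" by (simp add: ints)
    also have "\<dots> \<le> (\<integral>x. \<bar>g (U' x) - g (U x)\<bar> \<partial>M)" by (rule integral_abs_bound)
    also have "\<dots> \<le> (\<integral>x. 2 * p * indicator {x \<in> space M. U x \<noteq> U' x} x \<partial>M)"
    proof (rule integral_mono)
      fix x assume "x \<in> space M"
      then show "\<bar>g (U' x) - g (U x)\<bar> \<le> 2 * p * indicator {x \<in> space M. U x \<noteq> U' x} x"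
        using gp[of "U x"] gp[of "U' x"] by (auto simp: indicator_def abs_le_iff)
    next
      show "integrable M (\<lambda>x. 2 * p * indicator {x \<in> space M. U x \<noteq> U' x} x)"
        by (rule integrable_indicator_mult) measurable
      show "integrable M (\<lambda>x. \<bar>g (U' x) - g (U x)\<bar>)"
        by (intro Bochner_Integration.integrable_diff gint integrable_abs) fact+
    qed
    finally show ?thesis by simp
  qed
  have c2: "\<bar>(\<integral>x. a' x \<partial>M) - (\<integral>x. g (U' x) \<partial>M)\<bar> \<le> (\<Sum>j=1..J. \<delta> j)"
  proof -
    have "(\<integral>x. a' x \<partial>M) = (\<integral>x. (\<Sum>j=1..J. indicator {x \<in> space M. j \<le> V x} x * \<Delta> j (U' x)) \<partial>M)"
    proof (rule Bochner_Integration.integral_cong[OF refl])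
      fix x assume x: "x \<in> space M"
      have "a' x = (\<Sum>j=1..J. of_bool (j \<le> V x) * \<Delta> j (U' x))"
        unfolding a'_def \<Delta>_def using tail_expansion[OF VJ, of "\<lambda>v. h (U' x + v)" x] by simp
      then show "a' x = (\<Sum>j=1..J. indicator {x \<in> space M. j \<le> V x} x * \<Delta> j (U' x))"
        using x by (simp add: indicator_def of_bool_def)
    qed
    also have "\<dots> = (\<Sum>j=1..J. \<integral>x. indicator {x \<in> space M. j \<le> V x} x * \<Delta> j (U' x) \<partial>M)"
    proof (rule Bochner_Integration.integral_sum)
      fix j show "integrable M (\<lambda>x. indicator {x \<in> space M. j \<le> V x} x * \<Delta> j (U' x))"
        using \<Delta> by (intro integrable_const_bound[where B=1] AE_I2; measurable?) (auto split: split_indicator)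
    qed
    also have "\<dots> = (\<Sum>j=1..J. \<Sum>u\<le>B. \<Delta> j u * prob {x \<in> space M. j \<le> V x \<and> U' x = u})"
      using UB by (intro sum.cong refl, subst prob_space_count_sum[where B=B]) auto
    finally have A: "(\<integral>x. a' x \<partial>M) =
      (\<Sum>j=1..J. \<Sum>u\<le>B. \<Delta> j u * prob {x \<in> space M. j \<le> V x \<and> U' x = u})" .
    have "(\<integral>x. g (U' x) \<partial>M) = (\<integral>x. indicator (space M) x * g (U' x) \<partial>M)"
      by (intro Bochner_Integration.integral_cong) auto
    also have "\<dots> = (\<Sum>u\<le>B. g u * prob {x \<in> space M. U' x = u})"
      using UB by (subst prob_space_count_sum[where B=B]) (auto cong: conj_cong)
    also have "\<dots> = (\<Sum>j=1..J. \<Sum>u\<le>B. \<Delta> j u * (\<tau> j * prob {x \<in> space M. U' x = u}))"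
      unfolding g2 sum_distrib_right by (subst sum.swap) (simp add: mult_ac)
    finally have B: "(\<integral>x. g (U' x) \<partial>M) =
      (\<Sum>j=1..J. \<Sum>u\<le>B. \<Delta> j u * (\<tau> j * prob {x \<in> space M. U' x = u}))" .
    have tot: "(\<Sum>u\<le>B. prob {x \<in> space M. U' x = u}) = 1"
      using prob_space_count_sum[of U' B "space M" "\<lambda>_. 1"] UB prob_space
      by (simp cong: conj_cong)
    have "\<bar>(\<integral>x. a' x \<partial>M) - (\<integral>x. g (U' x) \<partial>M)\<bar> = \<bar>\<Sum>j=1..J. \<Sum>u\<le>B. \<Delta> j u *
      (prob {x \<in> space M. j \<le> V x \<and> U' x = u} - \<tau> j * prob {x \<in> space M. U' x = u})\<bar>"
      unfolding A B sum_subtractf[symmetric] by (simp add: algebra_simps)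
    also have "\<dots> \<le> (\<Sum>j=1..J. \<Sum>u\<le>B. \<bar>\<Delta> j u *
      (prob {x \<in> space M. j \<le> V x \<and> U' x = u} - \<tau> j * prob {x \<in> space M. U' x = u})\<bar>)"
      by (rule order_trans[OF sum_abs]) (intro sum_mono sum_abs)
    also have "\<dots> \<le> (\<Sum>j=1..J. \<Sum>u\<le>B. 1 * (\<delta> j * prob {x \<in> space M. U' x = u}))"
      unfolding abs_mult using \<Delta> mix by (intro sum_mono mult_mono) auto
    also have "\<dots> = (\<Sum>j=1..J. \<delta> j)" by (simp add: sum_distrib_left[symmetric] tot)
    finally show ?thesis .
  qed
  show ?thesis unfolding e1 using c1 c2 c3 by linarith
qed

lemma expectation_conv_pmf:
  fixes h :: "nat \<Rightarrow> real"
  assumes h: "\<And>x. 0 \<le> h x \<and> h x \<le> 1"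
  shows "measure_pmf.expectation (conv_pmf P Q) h =
    measure_pmf.expectation P (\<lambda>x. measure_pmf.expectation Q (\<lambda>y. h (x + y)))"
  unfolding conv_pmf_def by (subst expectation_bind_pmf_unit[OF h]) simp

text \<open>\<open>\<xi>\<close> is the law of \<open>V\<close> and \<open>\<eta>\<close> its law
  given \<open>V \<noteq> 0\<close>. The mixture formula serves the comparison with a compound
  Poisson law, the tail formula the comparison of \<open>V\<close> with an independent copy.\<close>

lemma (in prob_space) exists_pmf_law:
  fixes V :: "'a \<Rightarrow> nat"
  assumes [measurable]: "V \<in> measurable M (count_space UNIV)" and VJ: "\<And>x. V x \<le> J" and J: "1 \<le> J"
  shows "\<exists>\<xi> \<eta> :: nat pmf. set_pmf \<eta> \<subseteq> {1..J} \<and>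
    (\<forall>h::nat \<Rightarrow> real. measure_pmf.expectation \<xi> h =
       (1 - prob {x \<in> space M. V x \<noteq> 0}) * h 0 + prob {x \<in> space M. V x \<noteq> 0} * measure_pmf.expectation \<eta> h) \<and>
    (\<forall>h::nat \<Rightarrow> real. measure_pmf.expectation \<xi> h =
       h 0 + (\<Sum>j=1..J. prob {x \<in> space M. j \<le> V x} * (h j - h (j - 1))))"
proof -
  define q where "q u = prob {x \<in> space M. V x = u}" for u
  have q0: "q u = 0" if "J < u" for u
  proof -
    have "V x \<noteq> u" for x using VJ[of x] that by simp
    then have "{x \<in> space M. V x = u} = {}" by simp
    then show ?thesis unfolding q_def by (simp only: measure_empty)
  qed
  have tot: "(\<Sum>u\<le>J. q u) = 1"
    using prob_space_count_sum[of V J "space M" "\<lambda>_. 1"] VJ prob_space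
    by (simp add: q_def cong: conj_cong)
  have "(\<integral>\<^sup>+u. ennreal (q u) \<partial>count_space UNIV) = (\<Sum>u\<le>J. ennreal (q u))"
    using q0 by (intro nn_integral_count_space') auto
  also have "\<dots> = ennreal (\<Sum>u\<le>J. q u)" by (rule sum_ennreal) (simp add: q_def)
  finally have "(\<integral>\<^sup>+u. ennreal (q u) \<partial>count_space UNIV) = 1" using tot by simp
  then have "pmf (embed_pmf q) u = q u" for u
    by (subst pmf_embed_pmf) (auto simp: q_def)
  then obtain \<xi> where pmf: "\<And>u. pmf \<xi> u = q u" by blast
  have set\<xi>: "u \<le> J" if "u \<in> set_pmf \<xi>" for u
    using that q0[of u] by (intro leI) (auto simp: set_pmf_iff pmf)
  have E: "measure_pmf.expectation \<xi> h = (\<Sum>u\<le>J. h u * q u)" for h :: "nat \<Rightarrow> real"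
    unfolding pmf[symmetric] by (rule integral_measure_pmf_real) (use set\<xi> in auto)
  define p where "p = prob {x \<in> space M. V x \<noteq> 0}"
  have p: "p = 1 - q 0"
    unfolding p_def q_def using prob_compl[of "{x \<in> space M. V x = 0}"]
    by (simp add: set_diff_eq cong: conj_cong)
  have sp: "(\<Sum>u=1..J. q u) = p"
    using tot p sum.atMost_shift[of q J] by (simp add: sum.atLeast1_atMost_eq lessThan_Suc_atMost)
  have split0: "(\<Sum>u\<le>J. h u * q u) = h 0 * q 0 + (\<Sum>u=1..J. h u * q u)" for h :: "nat \<Rightarrow> real"
    by (simp add: sum.atMost_shift sum.atLeast1_atMost_eq)
  have "\<exists>\<eta>. set_pmf \<eta> \<subseteq> {1..J} \<and> (\<forall>h::nat\<Rightarrow>real. p * measure_pmf.expectation \<eta> h = (\<Sum>u=1..J. h u * q u))"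
  \<comment> \<open>There is nothing to condition on if \<open>V\<close> is almost surely 0; a point
    mass at 1 then keeps the support in \<open>{1..J}\<close>.\<close>
  proof (cases "p = 0")
    case True
    have "q u = 0" if "u \<in> {1..J}" for u
      using sp that sum_nonneg_eq_0_iff[of "{1..J}" q] unfolding True by (auto simp: q_def)
    then show ?thesis using J True by (intro exI[of _ "return_pmf 1"]) auto
  next
    case False
    have ne: "set_pmf \<xi> \<inter> {1..J} \<noteq> {}"
    proof
      assume "set_pmf \<xi> \<inter> {1..J} = {}"
      then have "q u = 0" if "u \<in> {1..J}" for u
        using that by (auto simp: set_pmf_iff pmf)
      then show False using sp False by simp
    qed
    have meas: "measure_pmf.prob \<xi> {1..J} = p"
      by (subst measure_measure_pmf_finite) (auto simp: pmf sp[simplified])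
    have "measure_pmf.expectation (cond_pmf \<xi> {1..J}) h = (\<Sum>u=1..J. h u * (q u / p))" for h :: "nat \<Rightarrow> real"
    proof -
      have "measure_pmf.expectation (cond_pmf \<xi> {1..J}) h = (\<Sum>u=1..J. h u * pmf (cond_pmf \<xi> {1..J}) u)"
        by (rule integral_measure_pmf_real) (use set_cond_pmf[OF ne] in auto)
      also have "\<dots> = (\<Sum>u=1..J. h u * (q u / p))"
        unfolding pmf_cond[OF ne] meas pmf by (intro sum.cong) auto
      finally show ?thesis .
    qed
    then show ?thesis using False set_cond_pmf[OF ne]
      by (intro exI[of _ "cond_pmf \<xi> {1..J}"]) (auto simp: sum_distrib_left)
  qed
  then obtain \<eta> where \<eta>: "set_pmf \<eta> \<subseteq> {1..J}"
    "\<And>h::nat\<Rightarrow>real. p * measure_pmf.expectation \<eta> h = (\<Sum>u=1..J. h u * q u)" by blast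
  have "measure_pmf.expectation \<xi> h = h 0 + (\<Sum>j=1..J. prob {x \<in> space M. j \<le> V x} * (h j - h (j - 1)))"
    for h :: "nat \<Rightarrow> real"
  proof -
    have t: "prob {x \<in> space M. j \<le> V x} = (\<Sum>u\<le>J. of_bool (j \<le> u) * q u)" for j
    proof -
      have "prob {x \<in> space M. j \<le> V x} = (\<integral>x. indicator {x \<in> space M. j \<le> V x} x \<partial>M)"
        by simp
      also have "\<dots> = (\<integral>x. indicator (space M) x * of_bool (j \<le> V x) \<partial>M)"
        by (intro Bochner_Integration.integral_cong) (auto simp: indicator_def)
      also have "\<dots> = (\<Sum>u\<le>J. of_bool (j \<le> u) * q u)"
        unfolding q_def using VJ by (subst prob_space_count_sum[where B=J]) (auto cong: conj_cong)
      finally show ?thesis .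
    qed
    have "measure_pmf.expectation \<xi> h =
      (\<Sum>u\<le>J. (h 0 + (\<Sum>j=1..J. of_bool (j \<le> u) * (h j - h (j - 1)))) * q u)"
      unfolding E by (intro sum.cong refl, subst tail_expansion[of _ J h, symmetric]) auto
    also have "\<dots> = h 0 * (\<Sum>u\<le>J. q u) + (\<Sum>u\<le>J. \<Sum>j=1..J. of_bool (j \<le> u) * q u * (h j - h (j - 1)))"
      unfolding distrib_right sum.distrib sum_distrib_left sum_distrib_right by (simp only: mult_ac)
    also have "\<dots> = h 0 + (\<Sum>j=1..J. prob {x \<in> space M. j \<le> V x} * (h j - h (j - 1)))"
      unfolding tot t sum_distrib_right by (subst sum.swap) (simp only: mult_1_right)
    finally show ?thesis .
  qed
  moreover have "measure_pmf.expectation \<xi> h = (1 - p) * h 0 + p * measure_pmf.expectation \<eta> h"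
    for h :: "nat \<Rightarrow> real"
  proof -
    have "1 - p = q 0" using p by simp
    then show ?thesis unfolding E \<eta>(2) by (simp only: split0[of h] mult.commute)
  qed
  ultimately show ?thesis using \<eta>(1) unfolding p_def by (intro exI[of _ \<xi>] exI[of _ \<eta>] conjI allI)
qed

text \<open>\<open>V0\<close> is the variable whose copies are used, and \<open>U' i\<close> stands
  for the part of \<open>\<Sum>k<i. V k\<close> that is nearly independent of \<open>V i\<close>.
  Variables are replaced from the last to the first, so what precedes \<open>V i\<close> is still
  the original partial sum.\<close>

theorem (in prob_space) compound_poisson_approximation:
  fixes V U' :: "nat \<Rightarrow> 'a \<Rightarrow> nat" and V0 :: "'a \<Rightarrow> nat"
  defines "p \<equiv> prob {x \<in> space M. V0 x \<noteq> 0}"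
  assumes V[measurable]: "\<And>i. V i \<in> measurable M (count_space UNIV)"
    and U'[measurable]: "\<And>i. U' i \<in> measurable M (count_space UNIV)"
    and V0[measurable]: "V0 \<in> measurable M (count_space UNIV)"
    and VJ: "\<And>i x. V i x \<le> J" and V0J: "\<And>x. V0 x \<le> J" and J: "1 \<le> J"
    and UB: "\<And>i x. i < m \<Longrightarrow> U' i x \<le> B"
    and mix: "\<And>i j u. i < m \<Longrightarrow> j \<in> {1..J} \<Longrightarrow>
       \<bar>prob {x \<in> space M. j \<le> V i x \<and> U' i x = u} -
         prob {x \<in> space M. j \<le> V0 x} * prob {x \<in> space M. U' i x = u}\<bar>
          \<le> \<delta> j * prob {x \<in> space M. U' i x = u}"
    and c: "0 < c"
  obtains \<eta> where "set_pmf \<eta> \<subseteq> {1..J}"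
    "\<And>h::nat \<Rightarrow> real. (\<And>x. 0 \<le> h x \<and> h x \<le> 1) \<Longrightarrow>
      \<bar>(\<integral>x. h (\<Sum>i<m. V i x) \<partial>M) - measure_pmf.expectation (compound_poisson c \<eta>) h\<bar> \<le>
       (\<Sum>i<m. 2 * prob {x \<in> space M. V i x \<noteq> 0 \<and> (\<Sum>k<i. V k x) \<noteq> U' i x} +
           2 * p * prob {x \<in> space M. (\<Sum>k<i. V k x) \<noteq> U' i x} + (\<Sum>j=1..J. \<delta> j)) +
       (real m * p\<^sup>2 + \<bar>real m * p - c\<bar>)"
proof -
  obtain \<xi> \<eta> where law: "set_pmf \<eta> \<subseteq> {1..J} \<and> (\<forall>h::nat \<Rightarrow> real. measure_pmf.expectation \<xi> h =
       (1 - p) * h 0 + p * measure_pmf.expectation \<eta> h) \<and>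
     (\<forall>h::nat \<Rightarrow> real. measure_pmf.expectation \<xi> h =
       h 0 + (\<Sum>j=1..J. prob {x \<in> space M. j \<le> V0 x} * (h j - h (j - 1))))"
    using exists_pmf_law[OF V0 V0J J] unfolding p_def by (elim exE)
  note set\<eta> = law[THEN conjunct1] and \<xi> = law[THEN conjunct2, THEN conjunct1, rule_format]
    and tail = law[THEN conjunct2, THEN conjunct2, rule_format]
  have p0: "0 \<le> p" by (simp add: p_def)
  show thesis
  proof (rule that[OF set\<eta>])
    fix h :: "nat \<Rightarrow> real" assume h: "\<And>x. 0 \<le> h x \<and> h x \<le> 1"
    define e where "e i = 2 * prob {x \<in> space M. V i x \<noteq> 0 \<and> (\<Sum>k<i. V k x) \<noteq> U' i x} +
           2 * p * prob {x \<in> space M. (\<Sum>k<i. V k x) \<noteq> U' i x} + (\<Sum>j=1..J. \<delta> j)" for i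
    \<comment> \<open>\<open>H k\<close> averages over the \<open>k\<close> copies already in place.
      It is again a function into [0,1], so the replacement step applies to it.\<close>
    define H where "H k u = measure_pmf.expectation (conv_pow \<xi> k) (\<lambda>y. h (u + y))" for k u
    have H: "0 \<le> H k u \<and> H k u \<le> 1" for k u
      unfolding H_def by (rule expectation_pmf_unit) (rule h)
    have HS: "H (Suc k) u = measure_pmf.expectation \<xi> (\<lambda>y. H k (u + y))" for k u
      unfolding H_def conv_pow.simps by (subst expectation_conv_pmf) (use h in \<open>auto simp: add.assoc\<close>)
    have step: "\<bar>(\<integral>x. H k (\<Sum>j<Suc i. V j x) \<partial>M) - (\<integral>x. H (Suc k) (\<Sum>j<i. V j x) \<partial>M)\<bar> \<le> e i"
      if "i < m" for i k
      unfolding HS e_def sum.lessThan_Suc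
      by (rule replacement_step[OF H _ U' V VJ UB[OF that] p0 \<xi> tail mix[OF that]]) auto
    have "\<bar>(\<integral>x. H (m - i) (\<Sum>j<i. V j x) \<partial>M) - H m 0\<bar> \<le> (\<Sum>k<i. e k)" if "i \<le> m" for i
      using that
    proof (induction i)
      case 0
      then show ?case using prob_space by simp
    next
      case (Suc i)
      then have "Suc (m - Suc i) = m - i" by simp
      with step[of i "m - Suc i"] Suc show ?case by (simp del: sum.lessThan_Suc add: sum.lessThan_Suc[of e])
    qed
    from this[of m] have "\<bar>(\<integral>x. h (\<Sum>j<m. V j x) \<partial>M) - measure_pmf.expectation (conv_pow \<xi> m) h\<bar> \<le> (\<Sum>k<m. e k)"
      by (simp add: H_def)
    moreover have "\<bar>measure_pmf.expectation (conv_pow \<xi> m) h - measure_pmf.expectation (compound_poisson c \<eta>) h\<bar>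
      \<le> real m * p\<^sup>2 + \<bar>real m * p - c\<bar>"
      by (rule tv_leD[OF tv_le_compound_poisson[OF p0 c \<xi>] h])
    ultimately show "\<bar>(\<integral>x. h (\<Sum>i<m. V i x) \<partial>M) - measure_pmf.expectation (compound_poisson c \<eta>) h\<bar> \<le>
       (\<Sum>i<m. 2 * prob {x \<in> space M. V i x \<noteq> 0 \<and> (\<Sum>k<i. V k x) \<noteq> U' i x} +
           2 * p * prob {x \<in> space M. (\<Sum>k<i. V k x) \<noteq> U' i x} + (\<Sum>j=1..J. \<delta> j)) +
       (real m * p\<^sup>2 + \<bar>real m * p - c\<bar>)"
      unfolding e_def by linarith
  qed
qed

section \<open>Mixing for cylinder events\<close>

text \<open>The prescribed letters are read off a whole sequence \<open>y\<close>, so patterns on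
  overlapping coordinate sets are automatically compatible and unions of sets become intersections
  of events.\<close>

definition pat :: "nat set \<Rightarrow> (nat \<Rightarrow> 'a) \<Rightarrow> (nat \<Rightarrow> 'a) set" where
  "pat F y = {\<omega>. \<forall>i\<in>F. \<omega> i = y i}"

text \<open>One implication is enough, since the hypothesis is symmetric in the two
  sequences.\<close>

definition determined :: "nat set \<Rightarrow> (nat \<Rightarrow> 'a) set \<Rightarrow> bool" where
  "determined F E \<longleftrightarrow> (\<forall>\<omega> \<omega>'. (\<forall>i\<in>F. \<omega> i = \<omega>' i) \<longrightarrow> \<omega> \<in> E \<longrightarrow> \<omega>' \<in> E)"

lemma pat_Un: "pat (F \<union> G) y = pat F y \<inter> pat G y"
  by (auto simp: pat_def)

lemma pat_empty [simp]: "pat {} y = UNIV"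
  by (simp add: pat_def)

lemma pat_antimono: "F \<subseteq> G \<Longrightarrow> pat G y \<subseteq> pat F y"
  by (auto simp: pat_def)

lemma pat_cong: "(\<And>i. i \<in> F \<Longrightarrow> y i = z i) \<Longrightarrow> pat F y = pat F z"
  by (auto simp: pat_def)

lemma funpow_shift: "(shift ^^ k) \<omega> i = \<omega> (i + k)"
  by (induction k arbitrary: \<omega> i) (simp_all add: shift_def funpow_swap1)

lemma determinedD: "determined F E \<Longrightarrow> (\<And>i. i \<in> F \<Longrightarrow> \<omega> i = \<omega>' i) \<Longrightarrow> \<omega> \<in> E \<longleftrightarrow> \<omega>' \<in> E"
  unfolding determined_def by metis

lemma pat_in_coord_algebra:
  assumes "finite F" "\<And>i. i \<in> F \<Longrightarrow> k \<le> i \<and> enat i \<le> n"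
  shows "pat F y \<in> coord_algebra k n"
proof -
  interpret sigma_algebra UNIV "coord_algebra k n"
    unfolding coord_algebra_def by (rule sigma_algebra_sigma_sets) auto
  have basic: "(\<lambda>\<omega>. \<omega> i) -` {y i} \<in> coord_algebra k n" if "i \<in> F" for i
    unfolding coord_algebra_def using assms(2)[OF that] by (intro sigma_sets.Basic) auto
  have "pat G y \<in> coord_algebra k n" if "G \<subseteq> F" for G
    using finite_subset[OF that assms(1)] that
  proof (induction G rule: finite_induct)
    case empty
    then show ?case using top by simp
  next
    case (insert i G)
    have "pat (insert i G) y = (\<lambda>\<omega>. \<omega> i) -` {y i} \<inter> pat G y" by (auto simp: pat_def)
    then show ?case using insert basic[of i] by auto
  qed
  then show ?thesis by simp
qed

lemma rel_bound:
  fixes x p e :: real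
  shows "\<bar>x - p\<bar> \<le> e * p \<Longrightarrow> (1 - e) * p \<le> x \<and> x \<le> (1 + e) * p"
  by (simp add: abs_le_iff left_diff_distrib distrib_right)

lemma rel_boundI:
  fixes x p e :: real
  shows "(1 - e) * p \<le> x \<Longrightarrow> x \<le> (1 + e) * p \<Longrightarrow> \<bar>x - p\<bar> \<le> e * p"
  by (simp add: abs_le_iff left_diff_distrib distrib_right)

text \<open>\<open>X\<close> encodes the restriction of a sequence to \<open>F\<close>. When its
  values lie in a countable type, \<open>E\<close> splits into countably many patterns and countable
  additivity becomes available.\<close>

lemma determined_eq_UN:
  assumes "determined F E" and "\<And>\<omega> \<omega>'. X \<omega> = X \<omega>' \<longleftrightarrow> (\<forall>i\<in>F. \<omega> i = \<omega>' i)"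
  shows "E = (\<Union>v\<in>X ` E. X -` {v})"
proof -
  have "\<omega> \<in> E" if "X \<omega> = X \<omega>'" "\<omega>' \<in> E" for \<omega> \<omega>'
    using that determinedD[OF assms(1), of \<omega> \<omega>'] assms(2)[of \<omega> \<omega>'] by blast
  then show ?thesis by blast
qed

section \<open>Mixing estimates for patterns under a stationary measure\<close>

locale stationary_process = prob_space M for M :: "(nat \<Rightarrow> 'a::countable) measure" +
  assumes sets_M: "sets M = sigma_sets UNIV (\<Union>n. cylinders n)"
    and invariant: "distr M M shift = M"
begin

lemma space_M [simp]: "space M = UNIV"
proof -
  have "UNIV \<in> sets M" unfolding sets_M by (rule sigma_sets_top)
  from sets.sets_into_space[OF this] show ?thesis by auto
qed

lemma sets_cyl: "cyl w \<in> sets M"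
  unfolding sets_M by (rule sigma_sets.Basic) (auto simp: cylinders_def)

lemma coord_measurable [measurable]: "(\<lambda>\<omega>. \<omega> i) \<in> measurable M (count_space UNIV)"
proof -
  have "(\<lambda>\<omega>. \<omega> i) -` {a} \<inter> space M \<in> sets M" for a
  proof -
    have "(\<lambda>\<omega>. \<omega> i) -` {a} = (\<Union>w\<in>{w. length w = Suc i \<and> w ! i = a}. cyl w)"
    proof (intro set_eqI iffI)
      fix \<omega> :: "nat \<Rightarrow> 'a" assume "\<omega> \<in> (\<lambda>\<omega>. \<omega> i) -` {a}"
      then show "\<omega> \<in> (\<Union>w\<in>{w. length w = Suc i \<and> w ! i = a}. cyl w)"
        by (intro UN_I[of "map \<omega> [0..<Suc i]"]) (auto simp: cyl_def nth_append simp del: upt_Suc)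
    qed (auto simp: cyl_def)
    then show ?thesis using sets_cyl by (auto intro!: sets.countable_UN')
  qed
  then show ?thesis by (simp add: measurable_count_space_eq2_countable)
qed

lemma sets_pat: "finite F \<Longrightarrow> pat F y \<in> sets M"
proof -
  assume [simp]: "finite F"
  have "{\<omega> \<in> space M. \<forall>i\<in>F. \<omega> i = y i} \<in> sets M" by measurable
  then show ?thesis by (simp add: pat_def)
qed

lemma shift_measurable: "shift \<in> measurable M M"
proof (rule measurable_sigma_sets[OF sets_M])
  fix A :: "(nat \<Rightarrow> 'a) set" assume "A \<in> (\<Union>n. cylinders n)"
  then obtain w where A: "A = cyl w" by (auto simp: cylinders_def)
  have "{\<omega> \<in> space M. \<forall>i<length w. \<omega> (Suc i) = w ! i} \<in> sets M" by measurable
  then show "shift -` A \<inter> space M \<in> sets M" by (simp add: A cyl_def shift_def vimage_def)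
qed auto

lemma prob_shift: "A \<in> sets M \<Longrightarrow> prob ((shift ^^ k) -` A) = prob A"
proof (induction k)
  case (Suc k)
  have vs: "(shift ^^ Suc k) -` A = shift -` ((shift ^^ k) -` A) \<inter> space M" for k
    by (auto simp: funpow_swap1)
  have m: "(shift ^^ k) -` A \<in> sets M" for k
  proof (induction k)
    case 0
    then show ?case using Suc by simp
  next
    case (Suc k)
    show ?case unfolding vs using measurable_sets[OF shift_measurable Suc] .
  qed
  have "prob ((shift ^^ Suc k) -` A) = prob (shift -` ((shift ^^ k) -` A) \<inter> space M)"
    by (simp only: vs)
  also have "\<dots> = measure (distr M M shift) ((shift ^^ k) -` A)"
    by (rule measure_distr[symmetric, OF shift_measurable m])
  also have "\<dots> = prob A" using Suc unfolding invariant by blast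
  finally show ?case .
qed simp

lemma pat_interval_eq_cyl: "pat {s..<s + L} y = (shift ^^ s) -` cyl (map y [s..<s + L])"
proof -
  have "(\<forall>i\<in>{s..<s + L}. \<omega> i = y i) \<longleftrightarrow> (\<forall>i<L. \<omega> (i + s) = y (s + i))" for \<omega>
  proof
    assume a: "\<forall>i<L. \<omega> (i + s) = y (s + i)"
    show "\<forall>i\<in>{s..<s + L}. \<omega> i = y i"
    proof
      fix i assume "i \<in> {s..<s + L}"
      then show "\<omega> i = y i" using a[rule_format, of "i - s"] by auto
    qed
  qed (auto simp: add.commute)
  then show ?thesis by (auto simp: pat_def cyl_def funpow_shift)
qed

lemma prob_pat_translate: "prob (pat {s..<s + L} y) = prob (pat {0..<L} (\<lambda>i. y (s + i)))"
proof -
  have "map y [s..<s + L] = map (\<lambda>i. y (s + i)) [0..<0 + L]"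
    by (rule nth_equalityI) auto
  then have "pat {s..<s + L} y = (shift ^^ s) -` pat {0..<0 + L} (\<lambda>i. y (s + i))"
    unfolding pat_interval_eq_cyl by simp
  then show ?thesis using prob_shift[OF sets_pat, of "{0..<0 + L}" s] by simp
qed

text \<open>The mixing coefficient without division; for null events both sides vanish.\<close>

lemma mixing_bound:
  assumes fin: "psi M m < \<infinity>"
    and B: "B \<in> coord_algebra 0 (enat n)" "B \<in> sets M"
    and C: "C \<in> coord_algebra (n + m + 1) \<infinity>" "C \<in> sets M"
  shows "\<bar>prob (B \<inter> C) - prob B * prob C\<bar> \<le> enn2real (psi M m) * (prob B * prob C)"
proof (cases "prob B * prob C = 0")
  case True
  then have "prob (B \<inter> C) \<le> 0"
    using finite_measure_mono[of "B \<inter> C" B] finite_measure_mono[of "B \<inter> C" C] B C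
    by (auto simp: mult_eq_0_iff)
  then have "prob (B \<inter> C) = 0" by (rule antisym[OF _ measure_nonneg])
  then show ?thesis unfolding True by simp
next
  case False
  then have pos: "prob B * prob C > 0" using measure_nonneg[of M B] measure_nonneg[of M C]
    by (simp add: less_le)
  have "ennreal \<bar>prob (B \<inter> C) / (prob B * prob C) - 1\<bar> \<le>
    psi_coeff M (coord_algebra 0 (enat n)) (coord_algebra (n + m + 1) \<infinity>)"
    unfolding psi_coeff_def using B C False by (intro SUP_upper2[where i="(B, C)"]) auto
  also have "\<dots> \<le> psi M m" unfolding psi_def by (rule SUP_upper) simp
  also have "\<dots> = ennreal (enn2real (psi M m))" using fin by simp
  finally have "\<bar>prob (B \<inter> C) / (prob B * prob C) - 1\<bar> \<le> enn2real (psi M m)"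
    by (subst (asm) ennreal_le_iff) auto
  then have "\<bar>prob (B \<inter> C) / (prob B * prob C) - 1\<bar> * (prob B * prob C) \<le>
    enn2real (psi M m) * (prob B * prob C)"
    using pos by (intro mult_right_mono) auto
  also have "\<bar>prob (B \<inter> C) / (prob B * prob C) - 1\<bar> * (prob B * prob C) =
    \<bar>(prob (B \<inter> C) / (prob B * prob C) - 1) * (prob B * prob C)\<bar>"
    using pos by (intro abs_mult_pos) simp
  also have "(prob (B \<inter> C) / (prob B * prob C) - 1) * (prob B * prob C) = prob (B \<inter> C) - prob B * prob C"
    using False by (simp add: left_diff_distrib)
  finally show ?thesis .
qed

lemma mixing_pat:
  assumes fin: "psi M m < \<infinity>" and F: "finite F" and G: "finite G"
    and sep: "\<And>f g. f \<in> F \<Longrightarrow> g \<in> G \<Longrightarrow> f + m < g"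
  shows "\<bar>prob (pat (F \<union> G) y) - prob (pat F y) * prob (pat G y)\<bar>
    \<le> enn2real (psi M m) * (prob (pat F y) * prob (pat G y))"
proof (cases "F = {}")
  case True
  then show ?thesis using prob_space by simp
next
  case False
  define b where "b = Max F"
  have "pat F y \<in> coord_algebra 0 (enat b)"
    by (rule pat_in_coord_algebra[OF F]) (use F in \<open>auto simp: b_def\<close>)
  moreover have "pat G y \<in> coord_algebra (b + m + 1) \<infinity>"
    using sep[of b] Max_in[OF F False] by (intro pat_in_coord_algebra[OF G]) (auto simp: b_def Suc_le_eq)
  ultimately show ?thesis
    unfolding pat_Un using sets_pat[OF F] sets_pat[OF G] by (intro mixing_bound fin) auto
qed

text \<open>A window between two far away parts is nearly independent of the two parts together:
  both probabilities are compared with the product over the three parts.\<close>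

lemma mixing_window:
  assumes fin: "psi M m < \<infinity>" and small: "enn2real (psi M m) \<le> 1 / 5" and G: "finite G"
    and sep: "\<And>g. g \<in> G \<Longrightarrow> g + m < s \<or> s + L + m \<le> g"
  shows "\<bar>prob (pat (G \<union> {s..<s + L}) y) - prob (pat G y) * prob (pat {s..<s + L} y)\<bar>
    \<le> 4 * enn2real (psi M m) * (prob (pat G y) * prob (pat {s..<s + L} y))"
proof -
  define \<psi> where "\<psi> = enn2real (psi M m)"
  have \<psi>: "0 \<le> \<psi>" "\<psi> \<le> 1 / 5" using small by (auto simp: \<psi>_def)
  define G1 where "G1 = {g \<in> G. g + m < s}"
  define G2 where "G2 = G - G1"
  have G12: "G = G1 \<union> G2" "finite G1" "finite G2" using G by (auto simp: G1_def G2_def)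
  have g2: "g \<in> G2 \<Longrightarrow> s + L + m \<le> g" for g using sep by (auto simp: G1_def G2_def)
  define a b c where "a = prob (pat G1 y)" and "b = prob (pat {s..<s + L} y)" and "c = prob (pat G2 y)"
  define x u z where "x = prob (pat (G \<union> {s..<s + L}) y)" and "u = prob (pat (G1 \<union> {s..<s + L}) y)"
    and "z = prob (pat G y)"
  have nn: "0 \<le> a" "0 \<le> b" "0 \<le> c" "0 \<le> u" by (auto simp: a_def b_def c_def u_def)
  have e: "G \<union> {s..<s + L} = (G1 \<union> {s..<s + L}) \<union> G2" using G12 by auto
  have s1: "g + m < s" if "g \<in> G1" for g using that by (simp add: G1_def)
  have sepw: "\<And>f g. f \<in> G1 \<Longrightarrow> g \<in> G2 \<Longrightarrow> f + m < g"
    "\<And>f g. f \<in> G1 \<Longrightarrow> g \<in> {s..<s + L} \<Longrightarrow> f + m < g"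
    "\<And>f g. f \<in> {s..<s + L} \<Longrightarrow> g \<in> G2 \<Longrightarrow> f + m < g"
  proof -
    show "f + m < g" if "f \<in> G1" "g \<in> G2" for f g using s1[OF that(1)] g2[OF that(2)] by linarith
    show "f + m < g" if "f \<in> G1" "g \<in> {s..<s + L}" for f g using s1[OF that(1)] that(2) by auto
    show "f + m < g" if "f \<in> {s..<s + L}" "g \<in> G2" for f g using g2[OF that(2)] that(1) by auto
  qed
  have 1: "\<bar>x - u * c\<bar> \<le> \<psi> * (u * c)"
    unfolding x_def u_def c_def \<psi>_def e
    by (rule mixing_pat[OF fin]) (use G12 sepw in auto)
  have 2: "\<bar>u - a * b\<bar> \<le> \<psi> * (a * b)"
    unfolding a_def u_def b_def \<psi>_def
    by (rule mixing_pat[OF fin]) (use G12 sepw in auto)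
  have 3: "\<bar>z - a * c\<bar> \<le> \<psi> * (a * c)"
    unfolding a_def z_def c_def \<psi>_def G12(1)
    by (rule mixing_pat[OF fin]) (use G12 sepw in auto)
  have x: "(1 - \<psi>) * (u * c) \<le> x" "x \<le> (1 + \<psi>) * (u * c)"
    and u: "(1 - \<psi>) * (a * b) \<le> u" "u \<le> (1 + \<psi>) * (a * b)"
    and z: "(1 - \<psi>) * (a * c) \<le> z" "z \<le> (1 + \<psi>) * (a * c)"
    using rel_bound[OF 1] rel_bound[OF 2] rel_bound[OF 3] by blast+
  have abc: "0 \<le> a * b * c" using nn by simp
  have n: "0 \<le> 1 + \<psi>" "0 \<le> 1 - \<psi>" "0 \<le> 1 + 4 * \<psi>" "0 \<le> 1 - 4 * \<psi>" using \<psi> by auto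
  have "x \<le> (1 + \<psi>) * (u * c)" by (rule x)
  also have "\<dots> \<le> (1 + \<psi>) * (((1 + \<psi>) * (a * b)) * c)"
    by (intro mult_left_mono mult_right_mono u n nn)
  also have "\<dots> = (1 + \<psi>)\<^sup>2 * (a * b * c)" by (simp add: power2_eq_square)
  \<comment> \<open>After expansion this is \<open>5 * \<psi>\<^sup>2 \<le> \<psi>\<close>, which is
    where the bound 1/5 on the coefficient comes from.\<close>
  also have "\<dots> \<le> ((1 + 4 * \<psi>) * (1 - \<psi>)) * (a * b * c)"
  proof (rule mult_right_mono[OF _ abc])
    have "\<psi> * \<psi> \<le> \<psi> * (1 / 5)" using \<psi> by (intro mult_left_mono) auto
    then show "(1 + \<psi>)\<^sup>2 \<le> (1 + 4 * \<psi>) * (1 - \<psi>)" by (simp add: power2_eq_square algebra_simps)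
  qed
  also have "\<dots> = (1 + 4 * \<psi>) * (((1 - \<psi>) * (a * c)) * b)" by simp
  also have "\<dots> \<le> (1 + 4 * \<psi>) * (z * b)"
    by (intro mult_left_mono mult_right_mono z n nn)
  finally have U: "x \<le> (1 + 4 * \<psi>) * (z * b)" .
  have "(1 - 4 * \<psi>) * (z * b) \<le> (1 - 4 * \<psi>) * (((1 + \<psi>) * (a * c)) * b)"
    by (intro mult_left_mono mult_right_mono z n nn)
  also have "\<dots> = ((1 - 4 * \<psi>) * (1 + \<psi>)) * (a * b * c)" by simp
  also have "\<dots> \<le> (1 - \<psi>)\<^sup>2 * (a * b * c)"
  proof (rule mult_right_mono[OF _ abc])
    have "0 \<le> \<psi> * \<psi>" by simp
    then show "(1 - 4 * \<psi>) * (1 + \<psi>) \<le> (1 - \<psi>)\<^sup>2"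
      using \<psi> unfolding power2_eq_square by (simp add: algebra_simps)
  qed
  also have "\<dots> = (1 - \<psi>) * (((1 - \<psi>) * (a * b)) * c)" by (simp add: power2_eq_square)
  also have "\<dots> \<le> (1 - \<psi>) * (u * c)"
    by (intro mult_left_mono mult_right_mono u n nn)
  also have "\<dots> \<le> x" by (rule x)
  finally have "(1 - 4 * \<psi>) * (z * b) \<le> x" .
  then show ?thesis
    unfolding x_def[symmetric] z_def[symmetric] b_def[symmetric] \<psi>_def[symmetric]
    by (rule rel_boundI[OF _ U])
qed

text \<open>The windows are split off one at a time. What remains may lie on both sides of the
  window removed, so each step costs the factor of \<open>mixing_window\<close>.\<close>

lemma mixing_windows:
  fixes s L :: "'i \<Rightarrow> nat" and y :: "nat \<Rightarrow> 'a"
  assumes fin: "psi M m < \<infinity>" and small: "enn2real (psi M m) \<le> 1 / 5"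
    and F: "finite F" and I: "finite I"
    and sep: "\<And>i f. i \<in> I \<Longrightarrow> f \<in> F \<Longrightarrow> f + m < s i \<or> s i + L i + m \<le> f"
    and sep': "\<And>i j. i \<in> I \<Longrightarrow> j \<in> I \<Longrightarrow> i \<noteq> j \<Longrightarrow> s i + L i + m \<le> s j \<or> s j + L j + m \<le> s i"
  defines "P \<equiv> prob (pat F y) * (\<Prod>i\<in>I. prob (pat {s i..<s i + L i} y))"
  shows "(1 - 4 * enn2real (psi M m)) ^ card I * P \<le> prob (pat (F \<union> (\<Union>i\<in>I. {s i..<s i + L i})) y) \<and>
    prob (pat (F \<union> (\<Union>i\<in>I. {s i..<s i + L i})) y) \<le> (1 + 4 * enn2real (psi M m)) ^ card I * P"
  using I sep sep' unfolding P_def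
proof (induction I)
  case empty
  then show ?case by simp
next
  case (insert k I)
  let ?W = "\<lambda>i. {s i..<s i + L i}" and ?\<psi> = "enn2real (psi M m)"
  let ?G = "F \<union> (\<Union>i\<in>I. ?W i)"
  define g w where "g = prob (pat ?G y)" and "w = prob (pat (?W k) y)"
  define p where "p = prob (pat F y) * (\<Prod>i\<in>I. prob (pat (?W i) y))"
  have IH: "(1 - 4 * ?\<psi>) ^ card I * p \<le> g" "g \<le> (1 + 4 * ?\<psi>) ^ card I * p"
    unfolding g_def p_def using insert.IH insert.prems by auto
  have e: "F \<union> (\<Union>i\<in>insert k I. ?W i) = ?G \<union> ?W k" by auto
  have "\<bar>prob (pat (?G \<union> ?W k) y) - g * w\<bar> \<le> 4 * ?\<psi> * (g * w)"
    unfolding g_def w_def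
  proof (rule mixing_window[OF fin small])
    fix x assume "x \<in> ?G"
    then consider "x \<in> F" | i where "i \<in> I" "x \<in> ?W i" by auto
    then show "x + m < s k \<or> s k + L k + m \<le> x"
    proof cases
      case 2
      then have "i \<noteq> k" using insert by auto
      then show ?thesis using insert.prems(2)[of i k] 2 by auto
    qed (use insert.prems(1)[of k x] in auto)
  qed (use F insert in auto)
  then have *: "(1 - 4 * ?\<psi>) * (g * w) \<le> prob (pat (?G \<union> ?W k) y)"
    "prob (pat (?G \<union> ?W k) y) \<le> (1 + 4 * ?\<psi>) * (g * w)"
    by (auto dest: rel_bound)
  have w: "0 \<le> w" by (simp add: w_def)
  have c: "card (insert k I) = Suc (card I)" using insert by simp
  have pr: "prob (pat F y) * (\<Prod>i\<in>insert k I. prob (pat (?W i) y)) = p * w"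
    using insert unfolding p_def w_def by simp
  have "(1 - 4 * ?\<psi>) ^ Suc (card I) * (p * w) = (1 - 4 * ?\<psi>) * (((1 - 4 * ?\<psi>) ^ card I * p) * w)" by simp
  also have "\<dots> \<le> (1 - 4 * ?\<psi>) * (g * w)" using IH w small by (intro mult_left_mono mult_right_mono) auto
  finally have 1: "(1 - 4 * ?\<psi>) ^ Suc (card I) * (p * w) \<le> prob (pat (?G \<union> ?W k) y)" using * by simp
  have "(1 + 4 * ?\<psi>) * (g * w) \<le> (1 + 4 * ?\<psi>) * (((1 + 4 * ?\<psi>) ^ card I * p) * w)"
    using IH w by (intro mult_left_mono mult_right_mono) auto
  then have 2: "prob (pat (?G \<union> ?W k) y) \<le> (1 + 4 * ?\<psi>) ^ Suc (card I) * (p * w)" using * by simp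
  show ?case unfolding e c pr using 1 2 by blast
qed

lemma mixing_windows_linear:
  fixes s L :: "'i \<Rightarrow> nat" and y :: "nat \<Rightarrow> 'a"
  assumes fin: "psi M m < \<infinity>" and small: "enn2real (psi M m) \<le> 1 / 5"
    "real (card I) * enn2real (psi M m) \<le> 1 / 16"
    and F: "finite F" and I: "finite I"
    and sep: "\<And>i f. i \<in> I \<Longrightarrow> f \<in> F \<Longrightarrow> f + m < s i \<or> s i + L i + m \<le> f"
    and sep': "\<And>i j. i \<in> I \<Longrightarrow> j \<in> I \<Longrightarrow> i \<noteq> j \<Longrightarrow> s i + L i + m \<le> s j \<or> s j + L j + m \<le> s i"
  defines "P \<equiv> prob (pat F y) * (\<Prod>i\<in>I. prob (pat {s i..<s i + L i} y))"
  shows "\<bar>prob (pat (F \<union> (\<Union>i\<in>I. {s i..<s i + L i})) y) - P\<bar> \<le> 5 * real (card I) * enn2real (psi M m) * P"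
proof -
  define \<psi> where "\<psi> = enn2real (psi M m)"
  define x where "x = 4 * (real (card I) * \<psi>)"
  have \<psi>: "0 \<le> \<psi>" "\<psi> \<le> 1 / 5" using small by (auto simp: \<psi>_def)
  have x: "0 \<le> x" "x \<le> 1 / 4" using small \<psi> by (auto simp: x_def \<psi>_def)
  have P: "0 \<le> P" unfolding P_def by (intro mult_nonneg_nonneg prod_nonneg) auto
  have "(1 + 4 * \<psi>) ^ card I \<le> exp (4 * \<psi>) ^ card I"
    using \<psi> exp_ge_add_one_self by (intro power_mono) auto
  also have "\<dots> = exp x" by (simp add: exp_of_nat_mult[symmetric] x_def)
  also have "\<dots> \<le> 1 + x + x\<^sup>2" using x by (intro exp_bound) auto
  \<comment> \<open>The hypothesis on \<open>card I\<close> gives \<open>x \<le> 1 / 4\<close>, and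
    \<open>5 / 4 * 4\<close> is the constant 5 of the conclusion.\<close>
  also have "\<dots> \<le> 1 + x + x * (1 / 4)"
    using x unfolding power2_eq_square by (intro add_left_mono mult_left_mono) auto
  also have "\<dots> = 1 + 5 * real (card I) * \<psi>" by (simp add: x_def)
  finally have u: "(1 + 4 * \<psi>) ^ card I \<le> 1 + 5 * real (card I) * \<psi>" .
  have "1 - 5 * real (card I) * \<psi> \<le> 1 + real (card I) * (- 4 * \<psi>)" using \<psi> by simp
  also have "\<dots> \<le> (1 + (- 4 * \<psi>)) ^ card I" using \<psi> by (intro Bernoulli_inequality) auto
  finally have l: "1 - 5 * real (card I) * \<psi> \<le> (1 - 4 * \<psi>) ^ card I" by simp
  have *: "(1 - 4 * \<psi>) ^ card I * P \<le> prob (pat (F \<union> (\<Union>i\<in>I. {s i..<s i + L i})) y) \<and>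
    prob (pat (F \<union> (\<Union>i\<in>I. {s i..<s i + L i})) y) \<le> (1 + 4 * \<psi>) ^ card I * P"
    unfolding P_def \<psi>_def by (rule mixing_windows[OF fin small(1) F I sep sep'])
  show ?thesis
    unfolding \<psi>_def[symmetric]
    by (rule rel_boundI[OF order_trans[OF mult_right_mono[OF l P] conjunct1[OF *]]
      order_trans[OF conjunct2[OF *] mult_right_mono[OF u P]]])
qed

lemma sets_determined:
  assumes F: "finite F" and E: "determined F E"
  shows "E \<in> sets M"
proof -
  define X where "X \<omega> = map \<omega> (sorted_list_of_set F)" for \<omega> :: "nat \<Rightarrow> 'a"
  have X: "X \<omega> = X \<omega>' \<longleftrightarrow> (\<forall>i\<in>F. \<omega> i = \<omega>' i)" for \<omega> \<omega>'
    using F by (auto simp: X_def)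
  have p: "X -` {X y} = pat F y" for y using X by (auto simp: pat_def)
  have "E = (\<Union>v\<in>X ` E. X -` {v})" by (rule determined_eq_UN[OF E X])
  also have "\<dots> \<in> sets M" using p sets_pat[OF F] by (intro sets.countable_UN') auto
  finally show ?thesis .
qed

text \<open>The error is relative to the probability of each atom, so it adds up over the countably
  many patterns that make up \<open>E\<close>.\<close>

lemma atoms_bound:
  assumes F: "finite F" and E: "determined F E" and Q: "Q \<in> sets M" and e: "0 \<le> a" "0 \<le> e"
    and atoms: "\<And>y. \<bar>prob (Q \<inter> pat F y) - a * prob (pat F y)\<bar> \<le> e * prob (pat F y)"
  shows "\<bar>prob (Q \<inter> E) - a * prob E\<bar> \<le> e * prob E"
proof -
  define X where "X \<omega> = map \<omega> (sorted_list_of_set F)" for \<omega> :: "nat \<Rightarrow> 'a"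
  have X: "X \<omega> = X \<omega>' \<longleftrightarrow> (\<forall>i\<in>F. \<omega> i = \<omega>' i)" for \<omega> \<omega>'
    using F by (auto simp: X_def)
  have p: "X -` {X y} = pat F y" for y using X by (auto simp: pat_def)
  define V where "V = X ` E"
  have V: "countable V" by simp
  have Eq: "E = (\<Union>v\<in>V. X -` {v})"
    unfolding V_def by (rule determined_eq_UN[OF E X])
  have sX: "X -` {v} \<in> sets M" if "v \<in> V" for v using that p sets_pat[OF F] by (auto simp: V_def)
  have QE: "emeasure M (Q \<inter> E) = (\<integral>\<^sup>+v. emeasure M (Q \<inter> X -` {v}) \<partial>count_space V)"
  proof -
    have "Q \<inter> E = (\<Union>v\<in>V. Q \<inter> X -` {v})" using Eq by auto
    then show ?thesis
      using Q sX by (simp only:) (intro emeasure_UN_countable V, auto simp: disjoint_family_on_def)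
  qed
  have EE: "emeasure M E = (\<integral>\<^sup>+v. emeasure M (X -` {v}) \<partial>count_space V)"
    using sX by (subst Eq) (intro emeasure_UN_countable V, auto simp: disjoint_family_on_def)
  have at: "prob (Q \<inter> X -` {v}) \<le> (a + e) * prob (X -` {v})"
    "(a - e) * prob (X -` {v}) \<le> prob (Q \<inter> X -` {v})" if "v \<in> V" for v
  proof -
    obtain y where "v = X y" using \<open>v \<in> V\<close> by (auto simp: V_def)
    then show "prob (Q \<inter> X -` {v}) \<le> (a + e) * prob (X -` {v})"
      "(a - e) * prob (X -` {v}) \<le> prob (Q \<inter> X -` {v})"
      using atoms[of y] by (auto simp: p abs_le_iff algebra_simps)
  qed
  have "ennreal (prob (Q \<inter> E)) \<le> (\<integral>\<^sup>+v. ennreal (a + e) * emeasure M (X -` {v}) \<partial>count_space V)"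
    unfolding emeasure_eq_measure[symmetric] QE
    unfolding emeasure_eq_measure using at(1) e
    by (intro nn_integral_mono) (auto simp: ennreal_mult[symmetric] simp del: ennreal_plus intro!: ennreal_leI)
  also have "\<dots> = ennreal ((a + e) * prob E)"
    using EE e by (subst nn_integral_cmult) (auto simp: emeasure_eq_measure ennreal_mult simp del: ennreal_plus)
  finally have U: "prob (Q \<inter> E) \<le> (a + e) * prob E" using e by (subst (asm) ennreal_le_iff) auto
  have L: "(a - e) * prob E \<le> prob (Q \<inter> E)"
  \<comment> \<open>Integrals of extended nonnegative functions carry the lower bound only if its
    coefficient is nonnegative; otherwise the bound is trivial.\<close>
  proof (cases "0 \<le> a - e")
    case True
    have "ennreal ((a - e) * prob E) = (\<integral>\<^sup>+v. ennreal (a - e) * emeasure M (X -` {v}) \<partial>count_space V)"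
      using EE True by (subst nn_integral_cmult) (auto simp: emeasure_eq_measure ennreal_mult simp del: ennreal_plus)
    also have "\<dots> \<le> ennreal (prob (Q \<inter> E))"
      unfolding emeasure_eq_measure[symmetric] QE
      unfolding emeasure_eq_measure using at(2) True
      by (intro nn_integral_mono) (auto simp: ennreal_mult[symmetric] simp del: ennreal_plus intro!: ennreal_leI)
    finally show ?thesis by (subst (asm) ennreal_le_iff) auto
  next
    case False
    then have "(a - e) * prob E \<le> 0" by (intro mult_nonpos_nonneg) auto
    then show ?thesis using measure_nonneg[of M "Q \<inter> E"] by linarith
  qed
  show ?thesis using U L by (simp add: abs_le_iff algebra_simps)
qed

end

section \<open>Periodic words\<close>

locale psi_process = stationary_process +
  fixes \<Gamma> :: real
  assumes \<Gamma>_pos: "0 < \<Gamma>" and psi0_fin: "psi M 0 < \<infinity>"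
    and cyl_bound: "\<And>n A. n \<ge> 1 \<Longrightarrow> A \<in> cylinders n \<Longrightarrow> measure M A \<le> exp (- \<Gamma> * real n)"
begin

abbreviation \<psi>0 :: real where "\<psi>0 \<equiv> enn2real (psi M 0)"

lemma prob_interval_le: "prob (pat {s..<s + L} y) \<le> exp (- \<Gamma> * real L)"
proof (cases "L = 0")
  case False
  have "prob (pat {s..<s + L} y) = prob (cyl (map y [s..<s + L]))"
    unfolding pat_interval_eq_cyl by (rule prob_shift[OF sets_cyl])
  also have "\<dots> \<le> exp (- \<Gamma> * real L)"
    using False by (intro cyl_bound) (auto simp: cylinders_def intro!: exI[of _ "map y [s..<s + L]"])
  finally show ?thesis .
qed simp

text \<open>No gap is left before the new interval, which is why the coefficient is the one for gap
  0. Only the length of the interval counts, whatever the pattern on \<open>F\<close>.\<close>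

lemma prob_pat_append:
  assumes "finite F" "\<And>f. f \<in> F \<Longrightarrow> f < s"
  shows "prob (pat (F \<union> {s..<s + L}) y) \<le> (1 + \<psi>0) * prob (pat F y) * exp (- \<Gamma> * real L)"
proof -
  have "\<bar>prob (pat (F \<union> {s..<s + L}) y) - prob (pat F y) * prob (pat {s..<s + L} y)\<bar>
    \<le> \<psi>0 * (prob (pat F y) * prob (pat {s..<s + L} y))"
    by (rule mixing_pat[OF psi0_fin]) (use assms in fastforce)+
  then have "prob (pat (F \<union> {s..<s + L}) y) \<le> (1 + \<psi>0) * (prob (pat F y) * prob (pat {s..<s + L} y))"
    using rel_bound by blast
  also have "\<dots> \<le> (1 + \<psi>0) * (prob (pat F y) * exp (- \<Gamma> * real L))"
    by (intro mult_left_mono prob_interval_le) auto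
  finally show ?thesis by (simp add: mult_ac)
qed

end

locale word_process = psi_process M \<Gamma> for M :: "(nat \<Rightarrow> 'a::countable) measure" and \<Gamma> +
  fixes w :: "'a list" and l :: nat and d :: "nat \<Rightarrow> nat"
  assumes w_ne: "w \<noteq> []" and w_pos: "prob (cyl w) > 0"
    and l: "1 \<le> l" and d_1: "1 \<le> d 1" and d_mono: "strict_mono_on {1..l} d"
begin

abbreviation n :: nat where "n \<equiv> length w"

definition r :: nat where "r = first_return n (cyl w)"

abbreviation \<kappa> :: nat where "\<kappa> \<equiv> kappa l d r"

text \<open>The periodic continuation of the first \<open>r\<close> letters. By
  \<open>pw_nth\<close> it agrees with \<open>w\<close> on its whole length.\<close>

definition pw :: "nat \<Rightarrow> 'a" where "pw m = w ! (m mod r)"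

definition occ :: "nat \<Rightarrow> nat \<Rightarrow> (nat \<Rightarrow> 'a) set" where
  "occ s L = {\<omega>. \<forall>m<L. \<omega> (s + m) = pw m}"

definition b :: "nat \<Rightarrow> real" where "b L = prob (occ 0 L)"

text \<open>Returns of the cylinder to itself are the periods of the word; hence \<open>r\<close> is
  the shortest period, the length itself counting as one.\<close>

lemma overlap_iff:
  "cyl w \<inter> (shift ^^ k) -` cyl w \<noteq> {} \<longleftrightarrow> (\<forall>i. i + k < n \<longrightarrow> w ! (i + k) = w ! i)"
proof
  assume "cyl w \<inter> (shift ^^ k) -` cyl w \<noteq> {}"
  then obtain \<omega> where "\<forall>i<n. \<omega> i = w ! i" "\<forall>i<n. \<omega> (i + k) = w ! i"
    by (auto simp: cyl_def funpow_shift)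
  then show "\<forall>i. i + k < n \<longrightarrow> w ! (i + k) = w ! i" by (metis add_lessD1)
next
  assume a: "\<forall>i. i + k < n \<longrightarrow> w ! (i + k) = w ! i"
  \<comment> \<open>A second copy of \<open>w\<close> is laid down from position \<open>k\<close>
    on. Entries from \<open>n + k\<close> on lie outside both copies, and their value does not
    matter.\<close>
  define \<omega> where "\<omega> i = (if i < n then w ! i else w ! (i - k))" for i
  have "\<omega> \<in> cyl w \<inter> (shift ^^ k) -` cyl w"
    using a by (auto simp: cyl_def funpow_shift \<omega>_def)
  then show "cyl w \<inter> (shift ^^ k) -` cyl w \<noteq> {}" by blast
qed

lemma r_mem: "r \<in> {k \<in> {1..n}. cyl w \<inter> (shift ^^ k) -` cyl w \<noteq> {}}"
proof -
  have "n \<in> {k \<in> {1..n}. cyl w \<inter> (shift ^^ k) -` cyl w \<noteq> {}}"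
    using w_ne by (simp add: overlap_iff Suc_le_eq)
  then show ?thesis unfolding r_def first_return_def by (intro Min_in) auto
qed

lemma r_bounds: "1 \<le> r" "r \<le> n" and r_period: "i + r < n \<Longrightarrow> w ! (i + r) = w ! i"
  using r_mem unfolding overlap_iff by auto

lemma r_minimal:
  assumes "1 \<le> k" "k < r" shows "\<not> (\<forall>i. i + k < n \<longrightarrow> w ! (i + k) = w ! i)"
proof
  assume "\<forall>i. i + k < n \<longrightarrow> w ! (i + k) = w ! i"
  then have "k \<in> {k \<in> {1..n}. cyl w \<inter> (shift ^^ k) -` cyl w \<noteq> {}}"
    using assms r_bounds by (simp add: overlap_iff)
  then have "r \<le> k" unfolding r_def first_return_def by (intro Min_le) auto
  with assms show False by simp
qed

lemma pw_nth: "m < n \<Longrightarrow> pw m = w ! m"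
proof (induction m rule: less_induct)
  case (less m)
  show ?case
  proof (cases "m < r")
    case False
    then have "pw m = pw (m - r)" by (simp add: pw_def le_mod_geq)
    also have "\<dots> = w ! (m - r)" using less False r_bounds by auto
    also have "\<dots> = w ! m" using r_period[of "m - r"] less False by simp
    finally show ?thesis .
  qed (simp add: pw_def)
qed

lemma pw_add: "r dvd c \<Longrightarrow> pw (m + c) = pw m"
  by (auto simp: pw_def elim!: dvdE)

lemma pw_add': "r dvd c \<Longrightarrow> pw (c + m) = pw m"
  using pw_add by (simp add: add.commute)

lemma cyl_eq_occ: "cyl w = occ 0 n"
  by (auto simp: cyl_def occ_def pw_nth)

lemma shift_cyl: "(shift ^^ s) \<omega> \<in> cyl w \<longleftrightarrow> \<omega> \<in> occ s n"
  by (auto simp: cyl_def occ_def pw_nth funpow_shift add.commute)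

text \<open>The quotient and the remainder of a position modulo \<open>r\<close> give its block and
  its place there; the last block may be incomplete.\<close>

lemma rep_cyl_eq_occ: "rep_cyl (take r w) L = occ 0 L"
proof -
  have len: "length (take r w) = r" using r_bounds by simp
  have rep: "\<omega> \<in> rep_cyl (take r w) L \<longleftrightarrow>
    (\<forall>k<L div r. \<forall>i<r. \<omega> (i + k * r) = w ! i) \<and> (\<forall>i<L mod r. \<omega> (i + r * (L div r)) = w ! i)" for \<omega>
  proof -
    have e: "L - r * (L div r) = L mod r" by (simp add: minus_mult_div_eq_mod)
    have lt: "L mod r < r" using r_bounds by simp
    then have len': "length (take (L mod r) (take r w)) = L mod r"
      unfolding length_take using r_bounds by linarith
    show ?thesis
      unfolding rep_cyl_def Let_def cyl_def len e len' vimage_def mem_Collect_eq funpow_shift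
      using lt by auto
  qed
  have occ: "(\<forall>k<L div r. \<forall>i<r. \<omega> (i + k * r) = w ! i) \<and> (\<forall>i<L mod r. \<omega> (i + r * (L div r)) = w ! i)
    \<longleftrightarrow> \<omega> \<in> occ 0 L" for \<omega>
  proof
    assume a: "(\<forall>k<L div r. \<forall>i<r. \<omega> (i + k * r) = w ! i) \<and> (\<forall>i<L mod r. \<omega> (i + r * (L div r)) = w ! i)"
    show "\<omega> \<in> occ 0 L" unfolding occ_def
    proof (intro CollectI allI impI)
      fix m assume m: "m < L"
      have e: "m = m mod r + (m div r) * r" by simp
      show "\<omega> (0 + m) = pw m"
      proof (cases "m div r < L div r")
        case True
        moreover have "m mod r < r" using r_bounds by simp
        ultimately have "\<omega> (m mod r + (m div r) * r) = w ! (m mod r)" using a by blast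
        then show ?thesis by (simp add: pw_def)
      next
        case False
        then have q: "m div r = L div r" using m div_le_mono[of m L r] by simp
        have "m div r * r + m mod r < L div r * r + L mod r" using m by simp
        then have "m mod r < L mod r" unfolding q by (rule add_less_imp_less_left)
        then have "\<omega> (m mod r + r * (L div r)) = w ! (m mod r)" using a by blast
        then show ?thesis unfolding q[symmetric] by (simp add: pw_def)
      qed
    qed
  next
    assume o: "\<omega> \<in> occ 0 L"
    have "\<omega> (i + k * r) = w ! i" if "k < L div r" "i < r" for k i
    proof -
      have "i + k * r < (k + 1) * r" using that by simp
      also have "\<dots> \<le> (L div r) * r" using that by (intro mult_right_mono) auto
      also have "\<dots> \<le> L" by simp
      finally show ?thesis using o that by (auto simp: occ_def pw_def)
    qed
    moreover have "\<omega> (i + r * (L div r)) = w ! i" if "i < L mod r" for i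
    proof -
      have "i < r" using that r_bounds mod_less_divisor[of r L] by linarith
      moreover have "i + r * (L div r) < L" using that mult_div_mod_eq[of r L] by linarith
      ultimately show ?thesis using o by (auto simp: occ_def pw_def)
    qed
    ultimately show "(\<forall>k<L div r. \<forall>i<r. \<omega> (i + k * r) = w ! i) \<and>
      (\<forall>i<L mod r. \<omega> (i + r * (L div r)) = w ! i)" by blast
  qed
  show ?thesis using rep occ by blast
qed

lemma occ_eq_pat: "occ s L = pat {s..<s + L} (\<lambda>i. pw (i - s))"
proof (intro set_eqI iffI)
  fix \<omega> assume a: "\<omega> \<in> occ s L"
  show "\<omega> \<in> pat {s..<s + L} (\<lambda>i. pw (i - s))" unfolding pat_def
  proof (intro CollectI ballI)
    fix i assume "i \<in> {s..<s + L}"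
    then show "\<omega> i = pw (i - s)" using a[unfolded occ_def, THEN CollectD, rule_format, of "i - s"] by auto
  qed
qed (auto simp: occ_def pat_def)

lemma occ_eq_pat_self: "y \<in> occ s L \<Longrightarrow> occ s L = pat {s..<s + L} y"
  unfolding occ_eq_pat by (rule pat_cong) (auto simp: pat_def)

lemma sets_occ [measurable]: "occ s L \<in> sets M"
  unfolding occ_eq_pat by (rule sets_pat) simp

lemma prob_occ: "prob (occ s L) = b L"
  unfolding b_def occ_eq_pat prob_pat_translate[of s] by simp

lemma b_nonneg: "0 \<le> b L" by (simp add: b_def)

lemma b_n: "b n = prob (cyl w)" "0 < b n"
  using w_pos by (simp_all add: b_def cyl_eq_occ)

section \<open>Probabilities of long periodic words\<close>

lemma b_append: "b (L + L') \<le> (1 + \<psi>0) * b L * exp (- \<Gamma> * real L')"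
proof -
  have "b (L + L') = prob (pat ({0..<L} \<union> {L..<L + L'}) pw)"
    unfolding b_def occ_eq_pat by (simp add: ivl_disj_un_two(3))
  also have "\<dots> \<le> (1 + \<psi>0) * prob (pat {0..<L} pw) * exp (- \<Gamma> * real L')"
    by (rule prob_pat_append) auto
  finally show ?thesis by (simp add: b_def occ_eq_pat)
qed

lemma b_antimono: "L \<le> L' \<Longrightarrow> b L' \<le> b L"
  unfolding b_def by (intro finite_measure_mono sets_occ) (auto simp: occ_def)

text \<open>Displaced by a multiple of the period, both occurrences continue the same periodic
  sequence; \<open>c \<le> K\<close> rules out a gap between them.\<close>

lemma occ_append:
  assumes "r dvd c" "c \<le> K" shows "occ s K \<inter> occ (s + c) L = occ s (max K (c + L))"
proof (intro set_eqI iffI)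
  fix \<omega> assume a: "\<omega> \<in> occ s K \<inter> occ (s + c) L"
  show "\<omega> \<in> occ s (max K (c + L))" unfolding occ_def
  proof (intro CollectI allI impI)
    fix m assume m: "m < max K (c + L)"
    show "\<omega> (s + m) = pw m"
    proof (cases "m < K")
      case False
      then have "c \<le> m" "m - c < L" using m assms by auto
      moreover have "pw (c + (m - c)) = pw (m - c)" by (rule pw_add'[OF assms(1)])
      moreover have "\<omega> (s + c + (m - c)) = pw (m - c)"
        using a \<open>m - c < L\<close> unfolding occ_def by blast
      ultimately show ?thesis by simp
    qed (use a in \<open>simp add: occ_def\<close>)
  qed
next
  fix \<omega> assume a: "\<omega> \<in> occ s (max K (c + L))"
  have "\<omega> (s + c + m) = pw m" if "m < L" for m
    using a[unfolded occ_def, THEN CollectD, rule_format, of "c + m"] that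
    by (simp add: pw_add'[OF assms(1)] add.assoc)
  then show "\<omega> \<in> occ s K \<inter> occ (s + c) L" using a by (auto simp: occ_def)
qed

text \<open>If from time 0 the periodicity lasts for \<open>L + c\<close> but not for
  \<open>L + c + c\<close> letters, then from time \<open>c\<close> it lasts for \<open>L\<close>
  but not for \<open>L + c\<close> letters. Stationarity turns this inclusion into a comparison of
  decrements.\<close>

lemma b_convex:
  assumes "r dvd c" shows "b (L + c) - b (L + c + c) \<le> b L - b (L + c)"
proof -
  have sub: "occ s (L + k) \<subseteq> occ s L" for s L k by (auto simp: occ_def)
  have diff: "b L - b (L + k) = prob (occ s L - occ s (L + k))" for s L k
    unfolding prob_occ[of s, symmetric] by (intro finite_measure_Diff[symmetric] sets_occ sub)
  have "occ 0 (L + c) - occ 0 (L + c + c) \<subseteq> occ c L - occ c (L + c)"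
    using occ_append[OF assms, of "L + c" 0 L] occ_append[OF assms, of "L + c" 0 "L + c"]
    by (auto simp: add_ac)
  then have "prob (occ 0 (L + c) - occ 0 (L + c + c)) \<le> prob (occ c L - occ c (L + c))"
    by (intro finite_measure_mono) auto
  then show ?thesis unfolding diff[symmetric] .
qed

lemma b_decrement:
  assumes "r dvd c" shows "b L - b (L + j * c) \<le> real j * (b L - b (L + c))"
proof -
  have D: "b (L + j * c) - b (L + j * c + c) \<le> b L - b (L + c)" for j
  proof (induction j)
    case (Suc j)
    have "b (L + j * c + c) - b (L + j * c + c + c) \<le> b (L + j * c) - b (L + j * c + c)"
      by (rule b_convex[OF assms])
    with Suc show ?case by (simp add: add_ac)
  qed simp
  show ?thesis
  proof (induction j)
    case (Suc j)
    then show ?case using D[of j] by (simp add: algebra_simps)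
  qed simp
qed

section \<open>The step of a clump, bounds on rho, and periods of the word\<close>

lemma d_strict: "i \<in> {1..l} \<Longrightarrow> j \<in> {1..l} \<Longrightarrow> i < j \<Longrightarrow> d i < d j"
  using d_mono by (auto simp: strict_mono_on_def)

lemma d_bounds: "i \<in> {1..l} \<Longrightarrow> 1 \<le> d i" "i \<in> {1..l} \<Longrightarrow> d i \<le> d l"
proof -
  assume i: "i \<in> {1..l}"
  show "1 \<le> d i" using d_strict[of 1 i] d_1 i by (cases "i = 1") auto
  show "d i \<le> d l" using d_strict[of i l] i by (cases "i = l") auto
qed

lemma kappa_dvd: "i \<in> {1..l} \<Longrightarrow> r dvd d i * \<kappa>"
proof -
  assume i: "i \<in> {1..l}"
  have "r div gcd r (d i) dvd \<kappa>" unfolding kappa_def using i by (intro dvd_Lcm) auto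
  then have "d i * (r div gcd r (d i)) dvd d i * \<kappa>" by simp
  moreover have "r dvd d i * (r div gcd r (d i))"
  proof -
    have "d i * (r div gcd r (d i)) = (d i div gcd r (d i)) * r"
      by (simp add: div_mult_swap dvd_div_mult)
    then show ?thesis by simp
  qed
  ultimately show ?thesis by (rule dvd_trans[rotated])
qed

text \<open>After division by the gcd the cofactor of \<open>d i\<close> is coprime to
  \<open>r div gcd r (d i)\<close>, so the latter divides \<open>s\<close>. Together with
  \<open>kappa_dvd\<close>, the time shifts that preserve the phase in every window are exactly the
  multiples of \<open>\<kappa>\<close>.\<close>

lemma kappa_minimal:
  assumes "\<And>i. i \<in> {1..l} \<Longrightarrow> r dvd d i * s"
  shows "\<kappa> dvd s"
  unfolding kappa_def
proof (rule Lcm_least)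
  fix x assume "x \<in> {r div gcd r (d i) |i. i \<in> {1..l}}"
  then obtain i where i: "i \<in> {1..l}" and x: "x = r div gcd r (d i)" by auto
  have g: "gcd r (d i) \<noteq> 0" using r_bounds by simp
  have "r div gcd r (d i) dvd (d i * s) div gcd r (d i)"
    using assms[OF i] g by (intro div_dvd_div[THEN iffD2]) auto
  also have "(d i * s) div gcd r (d i) = (d i div gcd r (d i)) * s"
    by (simp add: dvd_div_mult)
  finally have "r div gcd r (d i) dvd (d i div gcd r (d i)) * s" .
  moreover have "coprime (r div gcd r (d i)) (d i div gcd r (d i))"
    using r_bounds by (intro div_gcd_coprime) auto
  ultimately show "x dvd s" unfolding x by (simp add: coprime_dvd_mult_right_iff)
qed

lemma kappa_bounds: "1 \<le> \<kappa>" "\<kappa> \<le> r"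
proof -
  have "\<kappa> dvd r" by (rule kappa_minimal) simp
  then show "\<kappa> \<le> r" "1 \<le> \<kappa>"
    using r_bounds dvd_imp_le[of \<kappa> r] dvd_pos_nat[of r \<kappa>] by (simp_all add: Suc_le_eq)
qed

lemma l_mem: "l \<in> {1..l}" using l by simp

lemma r_le: "1 \<le> r" "r \<le> d l * \<kappa>"
proof -
  have "0 < d l * \<kappa>" using kappa_bounds d_bounds(1)[OF l_mem] by simp
  then show "r \<le> d l * \<kappa>" using kappa_dvd[OF l_mem] by (intro dvd_imp_le)
qed (rule r_bounds)

lemma rho_eq: "rho M l d w = (\<Prod>i=1..l. b (n + d i * \<kappa>) / b n)"
proof -
  have "\<P>(\<omega> in M. \<omega> \<in> occ 0 (n + k) \<bar> \<omega> \<in> cyl w) = b (n + k) / b n" for k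
  proof -
    have "{x \<in> space M. x \<in> occ 0 (n + k) \<and> x \<in> cyl w} = occ 0 (n + k)"
      by (auto simp: cyl_eq_occ occ_def)
    then show ?thesis unfolding cond_prob_def by (simp add: b_def cyl_eq_occ)
  qed
  then show ?thesis unfolding rho_def Let_def r_def[symmetric] rep_cyl_eq_occ by simp
qed

text \<open>All factors are at most 1, so a single one is an upper bound; the last belongs to the
  longest word.\<close>

lemma rho_le_last: "rho M l d w \<le> b (n + d l * \<kappa>) / b n"
proof -
  have f: "0 \<le> b (n + d i * \<kappa>) / b n" "b (n + d i * \<kappa>) / b n \<le> 1" for i
    using b_n b_nonneg b_antimono[of n "n + d i * \<kappa>"] by auto
  have "{1..l} = insert l {1..<l}" using l by auto
  then have "rho M l d w = b (n + d l * \<kappa>) / b n * (\<Prod>i=1..<l. b (n + d i * \<kappa>) / b n)"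
    unfolding rho_eq by simp
  also have "\<dots> \<le> b (n + d l * \<kappa>) / b n * 1"
    using f by (intro mult_left_mono prod_le_1) auto
  finally show ?thesis by simp
qed

lemma rho_nonneg: "0 \<le> rho M l d w"
  unfolding rho_eq using b_nonneg by (intro prod_nonneg) auto

text \<open>The word is prolonged by \<open>d l * \<kappa> \<ge> r\<close> letters. This yields the
  limit along a nonperiodic sequence, where \<open>r\<close> tends to infinity.\<close>

lemma rho_le_exp: "rho M l d w \<le> (1 + \<psi>0) * exp (- \<Gamma> * real r)"
proof -
  have "b (n + d l * \<kappa>) \<le> (1 + \<psi>0) * b n * exp (- \<Gamma> * real (d l * \<kappa>))" by (rule b_append)
  also have "\<dots> \<le> (1 + \<psi>0) * b n * exp (- \<Gamma> * real r)"
    using r_le \<Gamma>_pos b_n by (intro mult_left_mono) (auto simp del: of_nat_mult)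
  finally have "b (n + d l * \<kappa>) / b n \<le> (1 + \<psi>0) * exp (- \<Gamma> * real r)"
    using b_n by (simp add: divide_le_eq mult_ac)
  with rho_le_last show ?thesis by linarith
qed

text \<open>The condition on \<open>j\<close> involves only \<open>\<psi>0\<close> and
  \<open>\<Gamma>\<close>, so one \<open>j\<close> serves all words. After \<open>j\<close>
  prolongations at least half of \<open>b n\<close> is lost, and none of them loses more than the
  first.\<close>

lemma rho_le_uniform:
  assumes j: "1 \<le> j" "(1 + \<psi>0) * exp (- \<Gamma> * real j) \<le> 1 / 2"
  shows "rho M l d w \<le> 1 - 1 / (2 * real j)"
proof -
  define c where "c = d l * \<kappa>"
  have c: "1 \<le> c" "r dvd c"
    using r_le kappa_dvd[OF l_mem] unfolding c_def by (linarith, simp)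
  have "b (n + j * c) \<le> (1 + \<psi>0) * b n * exp (- \<Gamma> * real (j * c))" by (rule b_append)
  also have "\<dots> \<le> (1 + \<psi>0) * b n * exp (- \<Gamma> * real j)"
  proof -
    have "real j \<le> real (j * c)" using c by (simp only: of_nat_le_iff) simp
    then show ?thesis using \<Gamma>_pos b_n by (intro mult_left_mono) (auto simp del: of_nat_mult)
  qed
  also have "\<dots> = ((1 + \<psi>0) * exp (- \<Gamma> * real j)) * b n" by simp
  also have "\<dots> \<le> 1 / 2 * b n" using j b_n by (intro mult_right_mono) auto
  finally have "b n - 1 / 2 * b n \<le> real j * (b n - b (n + c))"
    using b_decrement[OF c(2), of n j] by linarith
  then have "b (n + c) / b n \<le> 1 - 1 / (2 * real j)"
    using j b_n by (simp add: field_simps)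
  with rho_le_last show ?thesis unfolding c_def by linarith
qed

text \<open>A form of the theorem of Fine and Wilf. As \<open>p + r \<le> n\<close>, every residue
  \<open>m\<close> modulo \<open>r\<close> satisfies \<open>m + p < n\<close>, so the periodic
  continuation has period \<open>p\<close> as well. Then \<open>p mod r\<close> is a period of
  \<open>w\<close>, which minimality of \<open>r\<close> allows only if it is 0.\<close>

lemma fine_wilf:
  assumes p: "\<And>i. i + p < n \<Longrightarrow> w ! (i + p) = w ! i" and pn: "p + r \<le> n"
  shows "r dvd p"
proof (rule ccontr)
  assume "\<not> r dvd p"
  then have k: "1 \<le> p mod r" "p mod r < r" using r_bounds by (auto simp: dvd_eq_mod_eq_0)
  have pp: "pw (m + p) = pw m" for m
  proof -
    have lt: "m mod r + p < n" using pn r_bounds mod_less_divisor[of r m] by linarith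
    have "pw (m + p) = pw (m mod r + p)" by (simp add: pw_def mod_simps)
    also have "\<dots> = w ! (m mod r + p)" using lt by (rule pw_nth)
    also have "\<dots> = w ! (m mod r)" using lt by (rule p)
    finally show ?thesis by (simp add: pw_def)
  qed
  have "w ! (i + p mod r) = w ! i" if "i + p mod r < n" for i
  proof -
    have "w ! (i + p mod r) = pw (i + p mod r)" using that by (simp add: pw_nth)
    also have "\<dots> = pw (i + p)" by (simp add: pw_def mod_simps)
    also have "\<dots> = pw i" by (rule pp)
    also have "\<dots> = w ! i" using that by (simp add: pw_nth)
    finally show ?thesis .
  qed
  with r_minimal[OF k] show False by blast
qed

end

section \<open>Clumps of visits\<close>

locale clump_process = word_process +
  assumes n_large: "r * (d l + 6) < n" and psin_fin: "psi M n < \<infinity>"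
    and psin_small: "enn2real (psi M n) \<le> 1 / (128 * 4 ^ l)"
begin

abbreviation \<psi>n :: real where "\<psi>n \<equiv> enn2real (psi M n)"

text \<open>The cap on clump sizes. It is small enough for \<open>J * \<kappa> \<le> n\<close>, and
  large enough that two visits \<open>J * \<kappa>\<close> apart share fewer than \<open>r\<close>
  letters of the window for \<open>d l\<close>.\<close>

definition J :: nat where "J = n div r"

text \<open>The four multiples of \<open>d l * n\<close> pay for the spread
  \<open>d i * (J * \<kappa>)\<close> of a clump, the length of the word, the gap \<open>n\<close>,
  and the step back by \<open>d i * \<kappa>\<close>.\<close>

definition K :: nat where "K = 4 * d l * n"

definition vis :: "nat \<Rightarrow> (nat \<Rightarrow> 'a) set" where
  "vis k = (\<Inter>i\<in>{1..l}. occ (d i * k) n)"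

text \<open>This is \<open>e + 1\<close> visits in steps of \<open>\<kappa>\<close>, written as one
  longer occurrence per window so that mixing applies to it directly.\<close>

definition run :: "nat \<Rightarrow> nat \<Rightarrow> (nat \<Rightarrow> 'a) set" where
  "run e k = (\<Inter>i\<in>{1..l}. occ (d i * k) (n + d i * (e * \<kappa>)))"

text \<open>The probability that \<open>run e k\<close> would have if its windows were
  independent.\<close>

definition a :: "nat \<Rightarrow> real" where "a e = (\<Prod>i=1..l. b (n + d i * (e * \<kappa>)))"

definition first :: "nat \<Rightarrow> nat \<Rightarrow> (nat \<Rightarrow> 'a) set" where "first e k = run e k - vis (k - \<kappa>)"

text \<open>The size, truncated at \<open>J\<close>, of the clump of visits starting at time \<open>k\<close>; it is 0 if no
  clump starts there. Within a clump consecutive visits are \<open>\<kappa>\<close> apart.\<close>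

definition V :: "nat \<Rightarrow> (nat \<Rightarrow> 'a) \<Rightarrow> nat" where
  "V k \<omega> = (\<Sum>e<J. of_bool (\<omega> \<in> first e k))"

text \<open>The coordinates that \<open>V k\<close> depends on. They begin at
  \<open>d i * (k - \<kappa>)\<close> because the start of a clump at \<open>k\<close> excludes a
  visit at \<open>k - \<kappa>\<close>.\<close>

definition zone :: "nat \<Rightarrow> nat set" where
  "zone k = (\<Union>i\<in>{1..l}. {d i * (k - \<kappa>)..<d i * (k + J * \<kappa>) + n})"

definition near :: "nat \<Rightarrow> nat \<Rightarrow> bool" where
  "near q k \<longleftrightarrow> (\<exists>i\<in>{1..l}. \<exists>j\<in>{1..l}. \<bar>int (d i * q) - int (d j * k)\<bar> \<le> int K)"

lemma sizes: "1 \<le> J" "J * \<kappa> \<le> n" "\<kappa> \<le> n" "d l * \<kappa> \<le> n" "2 * r \<le> n" "n < r * J + r" "1 \<le> d l" "1 \<le> n" "n \<le> d l * n"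
proof -
  show d: "1 \<le> d l" by (rule d_bounds(1)[OF l_mem])
  have dr: "d l * \<kappa> \<le> d l * r" "1 \<le> r" using kappa_bounds r_bounds by auto
  have nn: "r * d l + 6 * r < n" using n_large by (simp add: algebra_simps)
  then show "2 * r \<le> n" "1 \<le> n" by simp_all
  show "d l * \<kappa> \<le> n" using dr(1) nn mult.commute[of r "d l"] by linarith
  show "\<kappa> \<le> n" using kappa_bounds nn by simp
  show "1 \<le> J" using r_bounds by (simp add: J_def Suc_le_eq div_greater_zero_iff)
  have "J * \<kappa> \<le> J * r" using kappa_bounds by simp
  also have "\<dots> \<le> n" by (simp add: J_def)
  finally show "J * \<kappa> \<le> n" .
  show "n < r * J + r"
    unfolding J_def using dr(2) mult_div_mod_eq[of r n] mod_less_divisor[of r n] by linarith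
  show "n \<le> d l * n" using d by simp
qed

lemma psi_l: "\<psi>n \<le> 1 / 5" "real l * \<psi>n \<le> 1 / 128"
proof -
  have l4: "real l \<le> 4 ^ l"
  proof -
    have "l < 4 ^ l" by (rule less_exp[THEN less_le_trans]) (rule power_mono, auto)
    then show ?thesis by (metis less_imp_le of_nat_le_iff of_nat_numeral of_nat_power)
  qed
  have "real l * \<psi>n \<le> 4 ^ l * (1 / (128 * 4 ^ l))"
    using l4 psin_small by (intro mult_mono) auto
  then show *: "real l * \<psi>n \<le> 1 / 128" by simp
  have "1 * \<psi>n \<le> real l * \<psi>n" using l by (intro mult_right_mono) auto
  with * show "\<psi>n \<le> 1 / 5" by simp
qed

section \<open>Runs and clumps as events\<close>

lemma run_0: "run 0 k = vis k"
  by (simp add: run_def vis_def)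

lemma sets_run [measurable]: "run e k \<in> sets M"
  unfolding run_def using l by (intro sets.finite_INT) auto

lemma sets_vis [measurable]: "vis k \<in> sets M"
  unfolding run_0[symmetric] by (rule sets_run)

lemma sets_first [measurable]: "first e k \<in> sets M"
  unfolding first_def by measurable

lemma d_kappa: "i \<in> {1..l} \<Longrightarrow> d i * \<kappa> \<le> n"
  using sizes d_bounds(2)[of i] by (meson le_trans mult_le_mono1)

lemma occ_sub: "r dvd c \<Longrightarrow> c + L \<le> L' \<Longrightarrow> occ s L' \<subseteq> occ (s + c) L"
proof
  fix \<omega> assume c: "r dvd c" "c + L \<le> L'" and o: "\<omega> \<in> occ s L'"
  show "\<omega> \<in> occ (s + c) L" unfolding occ_def
  proof (intro CollectI allI impI)
    fix m assume "m < L"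
    then have "\<omega> (s + (c + m)) = pw (c + m)" using o c by (auto simp: occ_def)
    then show "\<omega> (s + c + m) = pw m" by (simp add: pw_add'[OF c(1)] add.assoc)
  qed
qed

text \<open>Because \<open>d i * \<kappa> \<le> n\<close>, a visit and the run after it overlap or
  touch in every window, so their occurrences glue together.\<close>

lemma run_Suc: "run (Suc e) k = vis k \<inter> run e (k + \<kappa>)"
proof -
  have "occ (d i * k) n \<inter> occ (d i * (k + \<kappa>)) (n + d i * (e * \<kappa>)) = occ (d i * k) (n + d i * (Suc e * \<kappa>))"
    if i: "i \<in> {1..l}" for i
  proof -
    have "occ (d i * k) n \<inter> occ (d i * k + d i * \<kappa>) (n + d i * (e * \<kappa>)) =
      occ (d i * k) (max n (d i * \<kappa> + (n + d i * (e * \<kappa>))))"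
      by (rule occ_append[OF kappa_dvd[OF i] d_kappa[OF i]])
    moreover have "max n (d i * \<kappa> + (n + d i * (e * \<kappa>))) = n + d i * (Suc e * \<kappa>)"
      by (simp add: algebra_simps)
    ultimately show ?thesis by (simp add: algebra_simps)
  qed
  then show ?thesis unfolding run_def vis_def INT_Int_distrib[symmetric] by (intro INF_cong) auto
qed

lemma run_antimono: "e \<le> e' \<Longrightarrow> run e' k \<subseteq> run e k"
proof -
  assume "e \<le> e'"
  then have "n + d i * (e * \<kappa>) \<le> n + d i * (e' * \<kappa>)" for i by (simp add: mult_le_mono)
  then have "occ (d i * k) (n + d i * (e' * \<kappa>)) \<subseteq> occ (d i * k) (n + d i * (e * \<kappa>))" for i
    using occ_sub[of 0] by simp
  then show ?thesis unfolding run_def by blast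
qed

lemma run_visits: "\<omega> \<in> run e k \<longleftrightarrow> (\<forall>j\<le>e. \<omega> \<in> vis (k + j * \<kappa>))"
proof (induction e arbitrary: k)
  case 0
  then show ?case by (simp add: run_0)
next
  case (Suc e)
  have "(\<forall>j\<le>Suc e. \<omega> \<in> vis (k + j * \<kappa>)) \<longleftrightarrow>
    \<omega> \<in> vis k \<and> (\<forall>j\<le>e. \<omega> \<in> vis (k + Suc j * \<kappa>))"
    by (metis (no_types, lifting) Suc_le_mono add.right_neutral le0 mult_0 not0_implies_Suc)
  then show ?case unfolding run_Suc by (simp add: Suc add.assoc)
qed

lemma first_iff: "\<kappa> \<le> k \<Longrightarrow> first e k = run e k - run (Suc e) (k - \<kappa>)"
  by (auto simp: first_def run_Suc)

lemma first_antimono: "e \<le> e' \<Longrightarrow> first e' k \<subseteq> first e k"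
  using run_antimono by (auto simp: first_def)

lemma V_le: "V k \<omega> \<le> J"
proof -
  have "V k \<omega> \<le> (\<Sum>e<J. 1)" unfolding V_def by (rule sum_mono) auto
  then show ?thesis by simp
qed

text \<open>The events \<open>first e k\<close> decrease in \<open>e\<close>, so the indices at
  which they hold form an initial segment, and \<open>V\<close> is its length.\<close>

lemma V_ge_iff:
  assumes "j \<in> {1..J}"
  shows "j \<le> V k \<omega> \<longleftrightarrow> \<omega> \<in> first (j - 1) k"
proof -
  define S where "S = {e. e < J \<and> \<omega> \<in> first e k}"
  have V: "V k \<omega> = card S"
    unfolding V_def S_def by (simp add: of_bool_def sum.If_cases lessThan_def Collect_conj_eq Int_commute)
  have fin: "finite S" by (simp add: S_def)
  show ?thesis
  proof
    assume "\<omega> \<in> first (j - 1) k"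
    moreover have "e \<le> j - 1 \<and> e < J" if "e < j" for e using that assms by auto
    ultimately have "{..<j} \<subseteq> S"
      using first_antimono[of _ "j - 1" k] by (fastforce simp: S_def)
    from card_mono[OF fin this] show "j \<le> V k \<omega>" by (simp add: V)
  next
    assume j: "j \<le> V k \<omega>"
    show "\<omega> \<in> first (j - 1) k"
    proof (rule ccontr)
      assume "\<omega> \<notin> first (j - 1) k"
      then have "e < j - 1" if "e \<in> S" for e
        using first_antimono[of "j - 1" e k] that unfolding S_def by (cases "e < j - 1") auto
      then have "S \<subseteq> {..<j - 1}" by blast
      from card_mono[OF _ this] have "V k \<omega> \<le> j - 1" by (simp add: V)
      with j assms show False by (cases j) auto
    qed
  qed
qed

lemma V_nonzero_iff: "V k \<omega> \<noteq> 0 \<longleftrightarrow> \<omega> \<in> vis k - vis (k - \<kappa>)"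
  using V_ge_iff[of 1 k \<omega>] sizes(1) by (auto simp: Suc_le_eq first_def run_0)

lemma V_measurable [measurable]: "V k \<in> measurable M (count_space UNIV)"
proof -
  have "(\<lambda>\<omega>. of_bool (\<omega> \<in> first e k) :: nat) \<in> measurable M (count_space UNIV)" for e
    by (rule measurable_compose[of _ M "count_space UNIV"]) auto
  then show ?thesis unfolding V_def by (intro measurable_sum_nat)
qed

lemma V_determined:
  assumes "\<And>x. x \<in> zone k \<Longrightarrow> \<omega> x = \<omega>' x" and k: "\<kappa> \<le> k"
  shows "V k \<omega> = V k \<omega>'"
proof -
  have z: "\<omega> x = \<omega>' x" if "i \<in> {1..l}" "d i * (k - \<kappa>) \<le> x" "x < d i * (k + J * \<kappa>) + n" for i x
    using that by (intro assms) (auto simp: zone_def)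
  have o: "\<omega> \<in> occ s L \<longleftrightarrow> \<omega>' \<in> occ s L"
    if "i \<in> {1..l}" "d i * (k - \<kappa>) \<le> s" "s + L \<le> d i * (k + J * \<kappa>) + n" for i s L
  proof -
    have "\<omega> (s + m) = \<omega>' (s + m)" if "m < L" for m
      using \<open>i \<in> {1..l}\<close> \<open>d i * (k - \<kappa>) \<le> s\<close> \<open>s + L \<le> _\<close> that by (intro z[of i]) auto
    then show ?thesis by (auto simp: occ_def)
  qed
  have "\<omega> \<in> occ (d i * k) (n + d i * (e * \<kappa>)) \<longleftrightarrow> \<omega>' \<in> occ (d i * k) (n + d i * (e * \<kappa>))"
    if "i \<in> {1..l}" "e < J" for i e
  proof (rule o[OF that(1)])
    have "e * \<kappa> \<le> J * \<kappa>" using that by simp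
    then have "d i * (e * \<kappa>) \<le> d i * (J * \<kappa>)" by (rule mult_le_mono2)
    then show "d i * k + (n + d i * (e * \<kappa>)) \<le> d i * (k + J * \<kappa>) + n" by (simp add: distrib_left)
  qed simp
  moreover have "\<omega> \<in> occ (d i * (k - \<kappa>)) n \<longleftrightarrow> \<omega>' \<in> occ (d i * (k - \<kappa>)) n" if "i \<in> {1..l}" for i
    by (rule o[OF that]) auto
  ultimately have "\<omega> \<in> first e k \<longleftrightarrow> \<omega>' \<in> first e k" if "e < J" for e
    using that by (auto simp: first_def run_def vis_def)
  then show ?thesis unfolding V_def by (intro sum.cong) auto
qed

section \<open>Probabilities of runs, of clump starts and of pairs of them\<close>

lemma a_nonneg: "0 \<le> a e"
  unfolding a_def using b_nonneg by (intro prod_nonneg) auto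

lemma a_antimono: "e \<le> e' \<Longrightarrow> a e' \<le> a e"
  unfolding a_def using b_nonneg by (intro prod_mono conjI b_antimono) auto

lemma a_0: "a 0 = b n ^ l" by (simp add: a_def)

lemma a_0_pos: "0 < a 0" using b_n by (simp add: a_0)

lemma a_0_le: "a 0 \<le> exp (- \<Gamma> * real n)"
proof -
  have "b n \<le> 1" by (simp add: b_def)
  then have "b n ^ l \<le> b n ^ 1" using l b_n by (intro power_decreasing) auto
  also have "\<dots> \<le> exp (- \<Gamma> * real n)"
    using prob_interval_le[of 0 n] unfolding b_def occ_eq_pat by simp
  finally show ?thesis by (simp add: a_0)
qed

text \<open>\<open>a 0 - a 1\<close> approximates the probability that a clump starts at a given
  time. This is how the factor \<open>1 - rho M l d w\<close> enters the Poisson parameter.\<close>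

lemma rho_a: "a 0 * (1 - rho M l d w) = a 0 - a 1"
  using b_n by (simp add: rho_eq a_def prod_dividef right_diff_distrib)

text \<open>The decay in \<open>e\<close> is taken from the window for \<open>d l\<close> alone; the
  other windows keep their full factor \<open>b n\<close>, so that \<open>a 0\<close> survives in
  the bound.\<close>

lemma a_le: "a e \<le> (1 + \<psi>0) * a 0 * exp (- \<Gamma>) ^ e"
proof -
  have s: "{1..l} = insert l {1..<l}" using l by auto
  have f: "(\<Prod>i=1..<l. b (n + d i * (e * \<kappa>))) \<le> (\<Prod>i=1..<l. b n)"
    using b_nonneg by (intro prod_mono conjI b_antimono) auto
  have e1: "e * 1 \<le> d l * (e * \<kappa>)"
    using sizes(7) kappa_bounds by (metis le_trans mult_le_mono2 mult_le_mono1 mult_1)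
  have "b (n + d l * (e * \<kappa>)) \<le> (1 + \<psi>0) * b n * exp (- \<Gamma> * real (d l * (e * \<kappa>)))" by (rule b_append)
  also have "\<dots> \<le> (1 + \<psi>0) * b n * exp (- \<Gamma> * real e)"
    using e1 \<Gamma>_pos b_nonneg by (intro mult_left_mono) (auto simp del: of_nat_mult)
  also have "exp (- \<Gamma> * real e) = exp (- \<Gamma>) ^ e" by (simp add: exp_of_nat_mult[symmetric] mult.commute)
  finally have g: "b (n + d l * (e * \<kappa>)) \<le> (1 + \<psi>0) * b n * exp (- \<Gamma>) ^ e" .
  have "a e = b (n + d l * (e * \<kappa>)) * (\<Prod>i=1..<l. b (n + d i * (e * \<kappa>)))"
    unfolding a_def s by simp
  also have "\<dots> \<le> ((1 + \<psi>0) * b n * exp (- \<Gamma>) ^ e) * (\<Prod>i=1..<l. b n)"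
    using f g b_nonneg by (intro mult_mono prod_nonneg mult_nonneg_nonneg) auto
  also have "\<dots> = (1 + \<psi>0) * (b n * b n ^ (l - 1)) * exp (- \<Gamma>) ^ e" by simp
  also have "b n * b n ^ (l - 1) = a 0" using l by (simp add: a_0 power_Suc[symmetric] del: power_Suc)
  finally show ?thesis .
qed

lemma sum_a_le: "(\<Sum>e<m. a e) \<le> (1 + \<psi>0) * a 0 * inverse (1 - exp (- \<Gamma>))"
proof -
  have x: "0 < exp (- \<Gamma>)" "exp (- \<Gamma>) < 1" using \<Gamma>_pos by auto
  have "(\<Sum>e<m. a e) \<le> (\<Sum>e<m. (1 + \<psi>0) * a 0 * exp (- \<Gamma>) ^ e)" by (intro sum_mono a_le)
  also have "\<dots> = (1 + \<psi>0) * a 0 * (\<Sum>e<m. exp (- \<Gamma>) ^ e)" by (simp add: sum_distrib_left)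
  also have "(\<Sum>e<m. exp (- \<Gamma>) ^ e) = (1 - exp (- \<Gamma>) ^ m) * inverse (1 - exp (- \<Gamma>))"
    using x by (simp add: sum_gp_strict divide_inverse)
  also have "\<dots> \<le> 1 * inverse (1 - exp (- \<Gamma>))" using x by (intro mult_right_mono) auto
  finally show ?thesis using a_0_pos by (simp add: mult_left_mono)
qed

text \<open>On an atom of the coordinates in \<open>F\<close> the event becomes a single pattern on
  \<open>F\<close> and \<open>l\<close> separated windows. The condition on \<open>k\<close> has
  slack \<open>n\<close> so that it can also be used at \<open>k - \<kappa>\<close>.\<close>

lemma run_mixing:
  assumes F: "finite F" "determined F E" and e: "e \<le> J" and k: "K \<le> k + n"
    and sep: "\<And>i f. i \<in> {1..l} \<Longrightarrow> f \<in> F \<Longrightarrow>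
       f + n < d i * k \<or> d i * k + (n + d i * (e * \<kappa>)) + n \<le> f"
  shows "\<bar>prob (run e k \<inter> E) - a e * prob E\<bar> \<le> 5 * real l * \<psi>n * a e * prob E"
proof (rule atoms_bound[OF F sets_run a_nonneg])
  show "0 \<le> 5 * real l * \<psi>n * a e" using a_nonneg by simp
  fix y
  let ?s = "\<lambda>i. d i * k" and ?L = "\<lambda>i. n + d i * (e * \<kappa>)"
  let ?W = "\<lambda>i. {?s i..<?s i + ?L i}"
  have ordered: "?s i + ?L i + n \<le> ?s j" if ij: "i \<in> {1..l}" "j \<in> {1..l}" "i < j" for i j
  proof -
    have "e * \<kappa> \<le> n" using e sizes(2) by (meson le_trans mult_le_mono1)
    then have "d i * (e * \<kappa>) \<le> d l * n" using d_bounds[OF ij(1)] by (intro mult_le_mono) auto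
    then have "?L i + n \<le> k" using k sizes(9) unfolding K_def by linarith
    \<comment> \<open>Windows of different coefficients start at least \<open>k\<close> apart, and
      \<open>k\<close> is at least the length of a window plus the gap.\<close>
    moreover have "(d i + 1) * k \<le> d j * k" using d_strict[OF ij] by (intro mult_le_mono1) simp
    ultimately show ?thesis by simp
  qed
  have sep': "?s i + ?L i + n \<le> ?s j \<or> ?s j + ?L j + n \<le> ?s i"
    if "i \<in> {1..l}" "j \<in> {1..l}" "i \<noteq> j" for i j
    using ordered[of i j] ordered[of j i] that by linarith
  have unique: "i = j" if "i \<in> {1..l}" "j \<in> {1..l}" "m \<in> ?W i" "m \<in> ?W j" for i j m
    using sep'[of i j] that by force
  \<comment> \<open>One sequence that carries the periodic word on each window and \<open>y\<close>
    elsewhere; the windows are disjoint, so the choice of \<open>i\<close> is forced.\<close>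
  define z where "z m = (if \<exists>i\<in>{1..l}. m \<in> ?W i then pw (m - ?s (SOME i. i \<in> {1..l} \<and> m \<in> ?W i)) else y m)" for m
  have z_in: "z m = pw (m - ?s i)" if "i \<in> {1..l}" "m \<in> ?W i" for i m
  proof -
    have "(SOME i. i \<in> {1..l} \<and> m \<in> ?W i) = i"
      using that unique by (intro some_equality) blast+
    then show ?thesis using that unfolding z_def by auto
  qed
  have z_out: "z m = y m" if "m \<in> F" for m
    using sep[OF _ that] unfolding z_def by force
  have W: "pat (?W i) z = occ (?s i) (?L i)" if "i \<in> {1..l}" for i
    unfolding occ_eq_pat by (rule pat_cong) (rule z_in[OF that])
  have Fy: "pat F y = pat F z" by (rule pat_cong) (simp add: z_out)
  have Q: "run e k \<inter> pat F y = pat (F \<union> (\<Union>i\<in>{1..l}. ?W i)) z"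
  proof -
    have "run e k = (\<Inter>i\<in>{1..l}. pat (?W i) z)" unfolding run_def by (intro INF_cong refl W[symmetric])
    also have "\<dots> = pat (\<Union>i\<in>{1..l}. ?W i) z" by (auto simp: pat_def)
    finally show ?thesis unfolding Fy pat_Un by blast
  qed
  have A: "(\<Prod>i\<in>{1..l}. prob (pat (?W i) z)) = a e"
    unfolding a_def by (rule prod.cong[OF refl]) (simp only: W prob_occ)
  have "\<bar>prob (pat (F \<union> (\<Union>i\<in>{1..l}. ?W i)) z) - prob (pat F z) * (\<Prod>i\<in>{1..l}. prob (pat (?W i) z))\<bar>
    \<le> 5 * real (card {1..l}) * \<psi>n * (prob (pat F z) * (\<Prod>i\<in>{1..l}. prob (pat (?W i) z)))"
    by (rule mixing_windows_linear[OF psin_fin psi_l(1) _ F(1) _ sep sep']) (use psi_l in auto)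
  then show "\<bar>prob (run e k \<inter> pat F y) - a e * prob (pat F y)\<bar> \<le> 5 * real l * \<psi>n * a e * prob (pat F y)"
    unfolding Q unfolding Fy A by (simp add: mult_ac)
qed

lemma prob_run: "e \<le> J \<Longrightarrow> K \<le> k + n \<Longrightarrow> \<bar>prob (run e k) - a e\<bar> \<le> 5 * real l * \<psi>n * a e"
  using run_mixing[of "{}" UNIV e k] prob_space by (simp add: determined_def)

lemma prob_vis: assumes "K \<le> k + n" shows "prob (vis k) \<le> 2 * a 0"
proof -
  have "prob (vis k) \<le> (1 + 5 * real l * \<psi>n) * a 0"
    using prob_run[OF _ assms, of 0] unfolding run_0 by (intro conjunct2[OF rel_bound]) auto
  also have "\<dots> \<le> 2 * a 0" using psi_l a_nonneg by (intro mult_right_mono) auto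
  finally show ?thesis .
qed

text \<open>By \<open>first_iff\<close> the event is a difference of two nested runs, so
  \<open>run_mixing\<close> is applied to both and the errors add.\<close>

lemma first_mixing:
  assumes F: "finite F" "determined F E" and e: "e < J" and k: "K \<le> k"
    and sep: "\<And>i f. i \<in> {1..l} \<Longrightarrow> f \<in> F \<Longrightarrow>
       f + n < d i * (k - \<kappa>) \<or> d i * (k + J * \<kappa>) + n + n \<le> f"
  shows "\<bar>prob (first e k \<inter> E) - (a e - a (Suc e)) * prob E\<bar> \<le>
    5 * real l * \<psi>n * (a e + a (Suc e)) * prob E"
proof -
  have kk: "\<kappa> \<le> k" using k sizes unfolding K_def by linarith
  have le: "d i * (e * \<kappa>) \<le> d i * (J * \<kappa>)" for i
    using e by (intro mult_le_mono2 mult_le_mono1) simp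
  have kd: "d i * (k - \<kappa>) + d i * \<kappa> = d i * k" for i
    using kk by (simp add: distrib_left[symmetric])
  have 1: "\<bar>prob (run e k \<inter> E) - a e * prob E\<bar> \<le> 5 * real l * \<psi>n * a e * prob E"
  proof (rule run_mixing[OF F])
    show "f + n < d i * k \<or> d i * k + (n + d i * (e * \<kappa>)) + n \<le> f" if "i \<in> {1..l}" "f \<in> F" for i f
      using sep[OF that] le[of i] kd[of i] unfolding distrib_left by (elim disjE; linarith)
  qed (use e k in auto)
  have 2: "\<bar>prob (run (Suc e) (k - \<kappa>) \<inter> E) - a (Suc e) * prob E\<bar> \<le> 5 * real l * \<psi>n * a (Suc e) * prob E"
  proof (rule run_mixing[OF F])
    show "f + n < d i * (k - \<kappa>) \<or> d i * (k - \<kappa>) + (n + d i * (Suc e * \<kappa>)) + n \<le> f"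
      if "i \<in> {1..l}" "f \<in> F" for i f
      using sep[OF that] le[of i] kd[of i] unfolding distrib_left mult_Suc by (elim disjE; linarith)
  qed (use e k sizes kk in auto)
  have E: "E \<in> sets M" by (rule sets_determined[OF F])
  have sub: "run (Suc e) (k - \<kappa>) \<subseteq> run e k" using kk by (auto simp: run_Suc)
  have "first e k \<inter> E = (run e k \<inter> E) - (run (Suc e) (k - \<kappa>) \<inter> E)"
    unfolding first_iff[OF kk] by auto
  then have "prob (first e k \<inter> E) = prob (run e k \<inter> E) - prob (run (Suc e) (k - \<kappa>) \<inter> E)"
    using sub E by (simp only:) (intro finite_measure_Diff, auto)
  then have "prob (first e k \<inter> E) - (a e - a (Suc e)) * prob E =
    (prob (run e k \<inter> E) - a e * prob E) - (prob (run (Suc e) (k - \<kappa>) \<inter> E) - a (Suc e) * prob E)"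
    by (simp add: left_diff_distrib)
  also have "\<bar>\<dots>\<bar> \<le> 5 * real l * \<psi>n * a e * prob E + 5 * real l * \<psi>n * a (Suc e) * prob E"
    using 1 2 by linarith
  finally show ?thesis by (simp add: distrib_left distrib_right)
qed

text \<open>In the window for \<open>d l\<close> the visit at \<open>k\<close> prescribes at least
  \<open>n - r \<ge> n / 2\<close> letters beyond all windows of the visit at \<open>q\<close>. The
  factor \<open>a 0\<close> comes from the visit at \<open>q\<close>.\<close>

lemma pair_bound:
  assumes q: "K \<le> q + n" and k: "q \<le> k" and s: "n \<le> d l * (k - q) + r"
  shows "prob (vis q \<inter> vis k) \<le> 2 * (1 + \<psi>0) * a 0 * exp (- \<Gamma> * real n / 2)"
proof (cases "vis q \<inter> vis k = {}")
  case True
  then show ?thesis using a_nonneg by simp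
next
  case False
  \<comment> \<open>A common point makes both visits patterns of one sequence.\<close>
  then obtain y where y: "y \<in> vis q" "y \<in> vis k" by auto
  define F where "F = (\<Union>i\<in>{1..l}. {d i * q..<d i * q + n})"
  \<comment> \<open>The letters not yet fixed by the earlier visit begin at \<open>s\<close>: after
    the earlier window for \<open>d l\<close>, or at the start of the later one if that comes
    afterwards.\<close>
  define s L where "s = max (d l * k) (d l * q + n)" and "L = d l * k + n - s"
  have dk: "d l * q + d l * (k - q) = d l * k" using k by (simp add: distrib_left[symmetric])
  have L: "n \<le> L + r" "s + L = d l * k + n" using s dk by (auto simp: L_def s_def)
  have vq: "vis q = pat F y"
  proof -
    have "vis q = (\<Inter>i\<in>{1..l}. pat {d i * q..<d i * q + n} y)"
      unfolding vis_def using y by (intro INF_cong refl occ_eq_pat_self) (auto simp: vis_def)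
    also have "\<dots> = pat F y" by (auto simp: pat_def F_def)
    finally show ?thesis .
  qed
  have vk: "vis k \<subseteq> pat {s..<s + L} y"
  proof -
    have "vis k \<subseteq> occ (d l * k) n" using l_mem by (auto simp: vis_def)
    also have "\<dots> = pat {d l * k..<d l * k + n} y"
      using y l_mem by (intro occ_eq_pat_self) (auto simp: vis_def)
    also have "\<dots> \<subseteq> pat {s..<s + L} y" using L by (intro pat_antimono) (auto simp: s_def)
    finally show ?thesis .
  qed
  have "prob (vis q \<inter> vis k) \<le> prob (pat (F \<union> {s..<s + L}) y)"
    using vk unfolding vq pat_Un by (intro finite_measure_mono) (auto simp: F_def intro!: sets.Int sets_pat)
  also have "\<dots> \<le> (1 + \<psi>0) * prob (pat F y) * exp (- \<Gamma> * real L)"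
  proof (rule prob_pat_append)
    show "f < s" if f: "f \<in> F" for f
    proof -
      obtain i where i: "i \<in> {1..l}" "f < d i * q + n" using f by (auto simp: F_def)
      have "d i * q \<le> d l * q" by (intro mult_le_mono1 d_bounds(2) i)
      with i have "f < d l * q + n" by linarith
      then show ?thesis by (simp add: s_def)
    qed
  qed (auto simp: F_def)
  also have "\<dots> \<le> (1 + \<psi>0) * (2 * a 0) * exp (- \<Gamma> * real n / 2)"
  proof (rule mult_mono)
    show "(1 + \<psi>0) * prob (pat F y) \<le> (1 + \<psi>0) * (2 * a 0)"
      unfolding vq[symmetric] using prob_vis[OF q] by (intro mult_left_mono) auto
    have "real n \<le> 2 * real L" using L(1) sizes(5) by linarith
    then show "exp (- \<Gamma> * real L) \<le> exp (- \<Gamma> * real n / 2)" using \<Gamma>_pos by simp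
  qed (use a_nonneg in auto)
  finally show ?thesis by (simp only: mult_ac)
qed

text \<open>If the windows for \<open>d l\<close> share at least \<open>r\<close> letters,
  \<open>fine_wilf\<close> makes \<open>k - q\<close> a multiple of \<open>\<kappa>\<close>, and the
  visit then forced at \<open>k - \<kappa>\<close> contradicts the start of a clump at
  \<open>k\<close>. Otherwise \<open>pair_bound\<close> applies.\<close>

lemma V_pair_bound:
  assumes q: "K \<le> q + n" and k: "q < k"
  shows "prob {\<omega>. V k \<omega> \<noteq> 0 \<and> V q \<omega> \<noteq> 0} \<le> 2 * (1 + \<psi>0) * a 0 * exp (- \<Gamma> * real n / 2)"
proof (cases "d l * (k - q) + r \<le> n")
  case True
  define s where "s = k - q"
  have ks: "k = q + s" "1 \<le> s" using k by (auto simp: s_def)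
  have "\<omega> \<in> vis (k - \<kappa>)" if v: "\<omega> \<in> vis k" "\<omega> \<in> vis q" for \<omega>
  proof -
    have dv: "r dvd d i * s" if i: "i \<in> {1..l}" for i
    proof (rule fine_wilf)
      have "d i * s \<le> d l * s" using d_bounds(2)[OF i] by simp
      then show "d i * s + r \<le> n" using True unfolding s_def by linarith
      fix x assume x: "x + d i * s < n"
      have "\<omega> (d i * k + x) = pw x" using v(1) i x by (auto simp: vis_def occ_def)
      moreover have "\<omega> (d i * q + (x + d i * s)) = pw (x + d i * s)"
        using v(2) i x unfolding vis_def occ_def by blast
      ultimately show "w ! (x + d i * s) = w ! x"
        using x by (simp add: pw_nth ks algebra_simps)
    qed
    from kappa_minimal[OF dv] obtain j where j: "s = j * \<kappa>" by (metis dvdE mult.commute)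
    then obtain j' where j': "j = Suc j'" using ks by (cases j) auto
    have e: "k - \<kappa> = q + j' * \<kappa>" by (simp add: ks j j')
    show ?thesis unfolding vis_def
    proof
      fix i assume i: "i \<in> {1..l}"
      \<comment> \<open>The two occurrences glue into one that contains the occurrence needed at
        \<open>k - \<kappa>\<close>.\<close>
      have "\<omega> \<in> occ (d i * q) n \<inter> occ (d i * q + d i * s) n"
        using v i by (auto simp: vis_def ks distrib_left)
      also have "occ (d i * q) n \<inter> occ (d i * q + d i * s) n = occ (d i * q) (max n (d i * s + n))"
      proof (rule occ_append[OF dv[OF i]])
        have "d i * s \<le> d l * s" using d_bounds(2)[OF i] by simp
        then show "d i * s \<le> n" using True unfolding s_def by linarith
      qed
      also have "\<dots> \<subseteq> occ (d i * q + d i * (j' * \<kappa>)) n"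
      proof (rule occ_sub)
        show "r dvd d i * (j' * \<kappa>)" using kappa_dvd[OF i] by (metis dvd_mult mult.left_commute)
        show "d i * (j' * \<kappa>) + n \<le> max n (d i * s + n)" by (simp add: j j')
      qed
      finally show "\<omega> \<in> occ (d i * (k - \<kappa>)) n" by (simp add: e distrib_left)
    qed
  qed
  then have "{\<omega>. V k \<omega> \<noteq> 0 \<and> V q \<omega> \<noteq> 0} = {}" unfolding V_nonzero_iff by blast
  then show ?thesis using a_nonneg by (simp only: measure_empty) simp
next
  case False
  have "prob {\<omega>. V k \<omega> \<noteq> 0 \<and> V q \<omega> \<noteq> 0} \<le> prob (vis q \<inter> vis k)"
    unfolding V_nonzero_iff by (intro finite_measure_mono) auto
  also have "\<dots> \<le> 2 * (1 + \<psi>0) * a 0 * exp (- \<Gamma> * real n / 2)"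
    using q k False by (intro pair_bound) auto
  finally show ?thesis .
qed

section \<open>Distant and close times\<close>

lemma finite_zone: "finite (zone k)"
  unfolding zone_def by auto

lemma far_separated:
  assumes far: "\<not> near q k" and q: "K \<le> q" and k: "K \<le> k" and x: "x \<in> zone q" and i: "i \<in> {1..l}"
  shows "x + n < d i * (k - \<kappa>) \<or> d i * (k + J * \<kappa>) + n + n \<le> x"
proof -
  obtain j where j: "j \<in> {1..l}" "d j * (q - \<kappa>) \<le> x" "x < d j * (q + J * \<kappa>) + n"
    using x by (auto simp: zone_def)
  have "\<not> \<bar>int (d j * q) - int (d i * k)\<bar> \<le> int K" using far i j by (auto simp: near_def)
  then have c: "d j * q > d i * k + K \<or> d j * q + K < d i * k" by linarith
  have e: "d p * (y - \<kappa>) + d p * \<kappa> = d p * y" if "K \<le> y" for p y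
  proof -
    have "\<kappa> \<le> y" using that sizes unfolding K_def mult.assoc by linarith
    then show ?thesis by (simp add: distrib_left[symmetric])
  qed
  have dJ: "d p * (J * \<kappa>) \<le> d l * n" if "p \<in> {1..l}" for p
    by (intro mult_le_mono d_bounds(2) that sizes(2))
  have K4: "K = 4 * (d l * n)" by (simp add: K_def)
  note facts = e[OF q, of j] e[OF k, of i] dJ[OF j(1)] dJ[OF i] d_kappa[OF j(1)] d_kappa[OF i] sizes(9)
  from c show ?thesis
  proof
    assume "d j * q > d i * k + K"
    then show ?thesis using j(2) facts unfolding K4 distrib_left by linarith
  next
    assume "d j * q + K < d i * k"
    then show ?thesis using j(3) facts unfolding K4 distrib_left by linarith
  qed
qed

text \<open>For each pair of coefficients, multiplication by \<open>d i\<close> maps the close times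
  injectively into an interval of \<open>2 * K + 1\<close> integers.\<close>

lemma near_card: "finite {q. near q k}" "card {q. near q k} \<le> l\<^sup>2 * (2 * K + 1)"
proof -
  define A where "A i j = {q. \<bar>int (d i * q) - int (d j * k)\<bar> \<le> int K}" for i j
  have A: "finite (A i j) \<and> card (A i j) \<le> 2 * K + 1" if i: "i \<in> {1..l}" for i j
  proof -
    let ?f = "\<lambda>q. int (d i * q)" and ?I = "{int (d j * k) - int K..int (d j * k) + int K}"
    have inj: "inj_on ?f (A i j)" using d_bounds(1)[OF i] by (auto simp: inj_on_def)
    have sub: "?f ` A i j \<subseteq> ?I" by (auto simp: A_def abs_le_iff)
    have "card (A i j) \<le> card ?I" by (rule card_inj_on_le[OF inj sub]) simp
    also have "\<dots> = 2 * K + 1" by simp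
    finally show ?thesis using inj_on_finite[OF inj sub] by simp
  qed
  have e: "{q. near q k} = (\<Union>i\<in>{1..l}. \<Union>j\<in>{1..l}. A i j)" by (auto simp: near_def A_def)
  show "finite {q. near q k}" unfolding e using A by auto
  have "card {q. near q k} \<le> (\<Sum>i\<in>{1..l}. card (\<Union>j\<in>{1..l}. A i j))"
    unfolding e by (rule card_UN_le) simp
  also have "\<dots> \<le> (\<Sum>i\<in>{1..l}. \<Sum>j\<in>{1..l}. card (A i j))" by (intro sum_mono card_UN_le) simp
  also have "\<dots> \<le> (\<Sum>i\<in>{1..l}. \<Sum>j\<in>{1..l}. 2 * K + 1)" using A by (intro sum_mono) auto
  also have "\<dots> = l\<^sup>2 * (2 * K + 1)" by (simp add: power2_eq_square algebra_simps)
  finally show "card {q. near q k} \<le> l\<^sup>2 * (2 * K + 1)" .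
qed

section \<open>Counting visits by clumps\<close>

lemma visit_sum_eq: "visit_sum l d (cyl w) N \<omega> = card {k \<in> {1..N}. \<omega> \<in> vis k}"
proof -
  have "mult_visit l d (cyl w) k \<omega> = of_bool (\<omega> \<in> vis k)" for k
  proof -
    have "mult_visit l d (cyl w) k \<omega> = (\<Prod>i=1..l. of_bool (\<omega> \<in> occ (d i * k) n))"
      unfolding mult_visit_def by (intro prod.cong refl) (simp add: indicator_def shift_cyl)
    also have "\<dots> = of_bool (\<forall>i\<in>{1..l}. \<omega> \<in> occ (d i * k) n)"
      by (cases "\<forall>i\<in>{1..l}. \<omega> \<in> occ (d i * k) n") (auto intro!: prod_zero)
    finally show ?thesis by (simp add: vis_def)
  qed
  then have "visit_sum l d (cyl w) N \<omega> = (\<Sum>k\<in>{1..N}. of_bool (\<omega> \<in> vis k))"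
    by (simp add: visit_sum_def)
  also have "\<dots> = card ({1..N} \<inter> {k. \<omega> \<in> vis k})"
    by (simp add: of_bool_def sum.If_cases)
  also have "{1..N} \<inter> {k. \<omega> \<in> vis k} = {k \<in> {1..N}. \<omega> \<in> vis k}" by auto
  finally show ?thesis .
qed

text \<open>A visit at time \<open>m\<close> is number \<open>e\<close>, counted from 0, of the clump that starts at \<open>m - e \<kappa>\<close>.\<close>

lemma visit_sum_eq_clumps:
  assumes h1: "\<And>k. 1 \<le> k \<Longrightarrow> k \<le> K + J * \<kappa> \<Longrightarrow> \<omega> \<notin> vis k"
    and h2: "\<And>k. N < k \<Longrightarrow> k \<le> N + J * \<kappa> \<Longrightarrow> \<omega> \<notin> vis k"
    and h3: "\<And>m. K + J * \<kappa> < m \<Longrightarrow> m \<le> N \<Longrightarrow> \<omega> \<notin> vis (m - J * \<kappa>) \<inter> vis m"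
  shows "visit_sum l d (cyl w) N \<omega> = (\<Sum>k\<in>{K<..N}. V k \<omega>)"
proof -
  define P where "P = (SIGMA k:{K<..N}. {e\<in>{..<J}. \<omega> \<in> first e k})"
  define f where "f = (\<lambda>(k, e). k + e * \<kappa>)"
  have "bij_betw f P {k \<in> {1..N}. \<omega> \<in> vis k}"
    unfolding bij_betw_def
  proof
    \<comment> \<open>If one visit belonged to two clumps, the clump with the earlier start would
      have a visit exactly \<open>\<kappa>\<close> before the later start.\<close>
    have neq: False if "(k, e) \<in> P" "(k', e') \<in> P" "k + e * \<kappa> = k' + e' * \<kappa>" "e < e'" for k e k' e'
    proof -
      obtain j where j: "e' = Suc (e + j)" using \<open>e < e'\<close> less_imp_Suc_add by blast
      then have "k = k' + Suc j * \<kappa>" using that by (simp add: algebra_simps)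
      then have "k - \<kappa> = k' + j * \<kappa>" by simp
      moreover have "\<omega> \<in> vis (k' + j * \<kappa>)" using that j by (auto simp: P_def first_def run_visits)
      ultimately show False using that by (auto simp: P_def first_def)
    qed
    show "inj_on f P"
    proof (rule inj_onI)
      fix x y assume xy: "x \<in> P" "y \<in> P" "f x = f y"
      obtain k e k' e' where c: "x = (k, e)" "y = (k', e')" by fastforce
      then have "e = e'" using neq[of k e k' e'] neq[of k' e' k e] xy unfolding f_def
        by (metis case_prod_conv nat_neq_iff)
      then show "x = y" using xy c by (simp add: f_def)
    qed
    show "f ` P = {k \<in> {1..N}. \<omega> \<in> vis k}"
    proof (intro set_eqI iffI)
      fix m assume "m \<in> f ` P"
      then obtain k e where ke: "K < k" "k \<le> N" "e < J" "\<omega> \<in> first e k" and m: "m = k + e * \<kappa>"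
        by (auto simp: P_def f_def)
      have v: "\<omega> \<in> vis m" using ke m by (auto simp: first_def run_visits)
      have "e * \<kappa> \<le> J * \<kappa>" using ke by simp
      then have "m \<le> N" using h2[of m] v ke m by (meson add_le_mono not_less)
      then show "m \<in> {k \<in> {1..N}. \<omega> \<in> vis k}" using v ke m by auto
    next
      fix m assume m: "m \<in> {k \<in> {1..N}. \<omega> \<in> vis k}"
      have mK: "K + J * \<kappa> < m"
      proof (rule ccontr)
        assume "\<not> K + J * \<kappa> < m"
        then show False using h1[of m] m by auto
      qed
      \<comment> \<open>The number of visits directly before \<open>m\<close> in steps of
        \<open>\<kappa>\<close>. It is below \<open>J\<close> by \<open>h3\<close>, and
        \<open>mK\<close> then keeps the start of the clump beyond \<open>K\<close>.\<close>
      define e where "e = (LEAST j. \<omega> \<notin> vis (m - Suc j * \<kappa>))"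
      have "\<omega> \<notin> vis (m - Suc (J - 1) * \<kappa>)" using h3[OF mK] m sizes(1) by auto
      then have e: "e \<le> J - 1" "\<omega> \<notin> vis (m - Suc e * \<kappa>)"
        unfolding e_def by (rule Least_le, rule LeastI)
      have before: "\<omega> \<in> vis (m - Suc j * \<kappa>)" if "j < e" for j
        using not_less_Least[of j "\<lambda>j. \<omega> \<notin> vis (m - Suc j * \<kappa>)"] that by (simp add: e_def)
      define k where "k = m - e * \<kappa>"
      have eJ: "e < J" using e sizes(1) by simp
      have "e * \<kappa> \<le> J * \<kappa>" using eJ by (intro mult_le_mono1) simp
      then have "e * \<kappa> \<le> m" "K < k" using mK unfolding k_def by linarith+
      then have k: "K < k" "k \<le> N" "m = k + e * \<kappa>" using m by (auto simp: k_def)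
      have "\<omega> \<in> vis (k + j * \<kappa>)" if "j \<le> e" for j
      proof (cases "j = e")
        case True
        then show ?thesis using m k by simp
      next
        case False
        then obtain i where i: "e = Suc (j + i)" using \<open>j \<le> e\<close> by (metis le_neq_implies_less less_imp_Suc_add)
        then have "k + j * \<kappa> = m - Suc i * \<kappa>" using k(3) by (simp add: algebra_simps)
        then show ?thesis using before[of i] i by simp
      qed
      moreover have "k - \<kappa> = m - Suc e * \<kappa>" by (simp add: k_def)
      ultimately have "\<omega> \<in> first e k" using e by (simp add: first_def run_visits)
      then show "m \<in> f ` P" using k eJ by (intro image_eqI[of _ _ "(k, e)"]) (auto simp: P_def f_def)
    qed
  qed
  then have "card {k \<in> {1..N}. \<omega> \<in> vis k} = card P" by (simp add: bij_betw_same_card)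
  also have "\<dots> = (\<Sum>k\<in>{K<..N}. card {e\<in>{..<J}. \<omega> \<in> first e k})"
    unfolding P_def by (rule card_SigmaI) auto
  also have "\<dots> = (\<Sum>k\<in>{K<..N}. V k \<omega>)"
  proof (rule sum.cong[OF refl])
    fix k
    have "{e\<in>{..<J}. \<omega> \<in> first e k} = {..<J} \<inter> {e. \<omega> \<in> first e k}" by auto
    then show "card {e\<in>{..<J}. \<omega> \<in> first e k} = V k \<omega>"
      unfolding V_def by (simp add: of_bool_def sum.If_cases)
  qed
  finally show ?thesis unfolding visit_sum_eq .
qed

abbreviation \<epsilon> :: real where "\<epsilon> \<equiv> exp (- \<Gamma> * real n / 2)"

lemma exp_le_eps: "exp (- \<Gamma> * real n) \<le> \<epsilon>"
  using \<Gamma>_pos by simp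

lemma prob_vis_le: "prob (vis k) \<le> \<epsilon>"
proof -
  have "prob (vis k) \<le> prob (occ (d l * k) n)"
    using l_mem by (intro finite_measure_mono) (auto simp: vis_def)
  also have "\<dots> \<le> exp (- \<Gamma> * real n)" unfolding occ_eq_pat by (rule prob_interval_le)
  finally show ?thesis using exp_le_eps by linarith
qed

text \<open>Visits near the two ends have at most \<open>K + 2 * n\<close> possible times, so the
  crude bound \<open>\<epsilon>\<close> is enough for them. A clump exceeding the cap needs two
  visits \<open>J * \<kappa>\<close> apart, which may happen at up to \<open>N\<close> times; there
  the factor \<open>a 0\<close> is needed to compensate \<open>N\<close>.\<close>

lemma prob_visit_sum_neq:
  "prob {\<omega>. visit_sum l d (cyl w) N \<omega> \<noteq> (\<Sum>k\<in>{K<..N}. V k \<omega>)} \<le>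
    real (K + 2 * n) * \<epsilon> + real N * (2 * (1 + \<psi>0) * a 0 * \<epsilon>)"
proof -
  let ?I = "{1..K + J * \<kappa>} \<union> {N<..N + J * \<kappa>}" and ?I' = "{K + J * \<kappa><..N}"
  define B1 where "B1 = (\<Union>k\<in>?I. vis k)"
  define B2 where "B2 = (\<Union>m\<in>?I'. vis (m - J * \<kappa>) \<inter> vis m)"
  have meas: "B1 \<in> sets M" "B2 \<in> sets M" unfolding B1_def B2_def by auto
  have "\<omega> \<in> B1 \<union> B2" if "visit_sum l d (cyl w) N \<omega> \<noteq> (\<Sum>k\<in>{K<..N}. V k \<omega>)" for \<omega>
  proof (rule ccontr)
    assume "\<omega> \<notin> B1 \<union> B2"
    then have "visit_sum l d (cyl w) N \<omega> = (\<Sum>k\<in>{K<..N}. V k \<omega>)"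
      by (intro visit_sum_eq_clumps) (auto simp: B1_def B2_def)
    with that show False by simp
  qed
  then have "prob {\<omega>. visit_sum l d (cyl w) N \<omega> \<noteq> (\<Sum>k\<in>{K<..N}. V k \<omega>)} \<le> prob (B1 \<union> B2)"
    using meas by (intro finite_measure_mono) auto
  also have "\<dots> \<le> prob B1 + prob B2" using meas by (rule measure_Un_le)
  also have "prob B1 \<le> (\<Sum>k\<in>?I. prob (vis k))"
    unfolding B1_def by (rule finite_measure_subadditive_finite) auto
  also have "\<dots> \<le> real (card ?I) * \<epsilon>" using prob_vis_le by (rule sum_bounded_above)
  also have "\<dots> \<le> real (K + 2 * n) * \<epsilon>"
  proof -
    have "card ?I \<le> card {1..K + J * \<kappa>} + card {N<..N + J * \<kappa>}" by (rule card_Un_le)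
    also have "\<dots> \<le> K + 2 * n" using sizes(2) by simp
    finally show ?thesis by (intro mult_right_mono) (simp_all only: of_nat_le_iff exp_ge_zero)
  qed
  also have "prob B2 \<le> (\<Sum>m\<in>?I'. prob (vis (m - J * \<kappa>) \<inter> vis m))"
    unfolding B2_def by (rule finite_measure_subadditive_finite) auto
  also have "\<dots> \<le> (\<Sum>m\<in>?I'. 2 * (1 + \<psi>0) * a 0 * \<epsilon>)"
  proof (rule sum_mono)
    fix m assume m: "m \<in> ?I'"
    have "n \<le> J * r + r" using sizes(6) by (simp add: mult.commute)
    also have "\<dots> \<le> J * (d l * \<kappa>) + r" using r_le by simp
    also have "\<dots> = d l * (m - (m - J * \<kappa>)) + r" using m by simp
    finally show "prob (vis (m - J * \<kappa>) \<inter> vis m) \<le> 2 * (1 + \<psi>0) * a 0 * \<epsilon>"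
      using m by (intro pair_bound) auto
  qed
  also have "\<dots> = real (card ?I') * (2 * (1 + \<psi>0) * a 0 * \<epsilon>)" by simp
  also have "\<dots> \<le> real N * (2 * (1 + \<psi>0) * a 0 * \<epsilon>)"
    using a_nonneg by (intro mult_right_mono) auto
  finally show ?thesis by simp
qed

text \<open>The variable copied is \<open>V (K + 1)\<close>, at the first time that is kept, and
  \<open>U' i\<close> collects the earlier clumps at times not close to
  \<open>K + 1 + i\<close>.\<close>

lemma clumps_approximation:
  fixes t :: real and N :: nat
  assumes t: "0 < t" and N: "real N * a 0 \<le> t" "t \<le> (real N + 1) * a 0"
    and rho: "rho M l d w < 1"
  obtains \<eta> where "set_pmf \<eta> \<subseteq> {1..J}"
    "\<And>h::nat \<Rightarrow> real. (\<And>x. 0 \<le> h x \<and> h x \<le> 1) \<Longrightarrow>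
      \<bar>(\<integral>\<omega>. h (\<Sum>k\<in>{K<..N}. V k \<omega>) \<partial>M) -
        measure_pmf.expectation (compound_poisson (t * (1 - rho M l d w)) \<eta>) h\<bar> \<le>
      12 * real (l\<^sup>2 * (2 * K + 1)) * (1 + \<psi>0) * t * \<epsilon> +
      20 * real l * \<psi>n * (1 + \<psi>0) * t * inverse (1 - exp (- \<Gamma>)) +
      4 * t * \<epsilon> + 2 * real (K + 1) * \<epsilon> + 10 * real l * \<psi>n * t"
proof -
  define m where "m = N - K"
  define c where "c = t * (1 - rho M l d w)"
  define C where "C = l\<^sup>2 * (2 * K + 1)"
  define far where "far i = {q \<in> {K<..K + i}. \<not> near q (K + 1 + i)}" for i
  define U' where "U' i \<omega> = (\<Sum>q\<in>far i. V q \<omega>)" for i \<omega>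
  \<comment> \<open>Twice the error of \<open>first_mixing\<close>: once for
    \<open>V (K + 1 + i)\<close> and once for the reference variable
    \<open>V (K + 1)\<close>.\<close>
  define \<delta> where "\<delta> j = 10 * real l * \<psi>n * (a (j - 1) + a j)" for j
  define p where "p = prob {\<omega> \<in> space M. V (K + 1) \<omega> \<noteq> 0}"
  have kappa_K: "\<kappa> \<le> K" using sizes unfolding K_def by linarith
  have fin_far: "finite (far i)" for i by (simp add: far_def)
  have sumV: "(\<Sum>j<i. V (K + 1 + j) \<omega>) = (\<Sum>q\<in>{K<..K + i}. V q \<omega>)" for i \<omega>
  proof (induction i)
    case (Suc i)
    have "{K<..K + Suc i} = insert (K + 1 + i) {K<..K + i}" by auto
    then show ?case using Suc by simp
  qed simp
  have U'_meas[measurable]: "U' i \<in> measurable M (count_space UNIV)" for i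
    unfolding U'_def by (rule measurable_sum_nat) simp
  have tailV: "{\<omega>. j \<le> V k \<omega>} = first (j - 1) k" if "j \<in> {1..J}" for j k
    using V_ge_iff[OF that] by auto
  have first0: "\<bar>prob (first e (K + 1)) - (a e - a (Suc e))\<bar> \<le> 5 * real l * \<psi>n * (a e + a (Suc e))"
    if "e < J" for e
    using first_mixing[of "{}" UNIV e "K + 1"] that prob_space by (simp add: determined_def)
  have mix: "\<bar>prob {\<omega> \<in> space M. j \<le> V (K + 1 + i) \<omega> \<and> U' i \<omega> = u} -
      prob {\<omega> \<in> space M. j \<le> V (K + 1) \<omega>} * prob {\<omega> \<in> space M. U' i \<omega> = u}\<bar>
      \<le> \<delta> j * prob {\<omega> \<in> space M. U' i \<omega> = u}" if j: "j \<in> {1..J}" for i j u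
  proof -
    define E where "E = {\<omega>. U' i \<omega> = u}"
    define F where "F = (\<Union>q\<in>far i. zone q)"
    have F: "finite F" using fin_far finite_zone by (auto simp: F_def)
    have det: "determined F E"
      unfolding determined_def
    proof (intro allI impI)
      fix \<omega> \<omega>' assume a: "\<forall>x\<in>F. \<omega> x = \<omega>' x" and o: "\<omega> \<in> E"
      have "V q \<omega> = V q \<omega>'" if "q \<in> far i" for q
        using a that kappa_K by (intro V_determined) (auto simp: F_def far_def)
      then have "U' i \<omega> = U' i \<omega>'" unfolding U'_def by (intro sum.cong) auto
      with o show "\<omega>' \<in> E" by (simp add: E_def)
    qed
    let ?e = "j - 1"
    have e: "?e < J" "Suc ?e = j" using j by auto
    define A where "A = prob (first ?e (K + 1 + i) \<inter> E)"
    define B where "B = prob (first ?e (K + 1))"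
    define D where "D = 5 * real l * \<psi>n * (a ?e + a j)"
    have 1: "\<bar>A - (a ?e - a j) * prob E\<bar> \<le> D * prob E"
    proof -
      have "x + n < d i' * (K + 1 + i - \<kappa>) \<or> d i' * (K + 1 + i + J * \<kappa>) + n + n \<le> x"
        if i': "i' \<in> {1..l}" and x: "x \<in> F" for i' x
      proof -
        obtain q where q: "q \<in> far i" "x \<in> zone q" using x by (auto simp: F_def)
        then have "\<not> near q (K + 1 + i)" "K \<le> q" by (auto simp: far_def)
        then show ?thesis by (intro far_separated[OF _ _ _ q(2) i']) auto
      qed
      then show ?thesis
        using first_mixing[OF F det e(1), of "K + 1 + i"] unfolding e(2) A_def D_def by fastforce
    qed
    have 2: "\<bar>B - (a ?e - a j)\<bar> \<le> D" using first0[OF e(1)] unfolding e(2) B_def D_def .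
    have "\<bar>A - B * prob E\<bar> \<le> \<bar>A - (a ?e - a j) * prob E\<bar> + \<bar>B - (a ?e - a j)\<bar> * prob E"
    proof -
      have "A - B * prob E = (A - (a ?e - a j) * prob E) - (B - (a ?e - a j)) * prob E"
        by (simp add: left_diff_distrib)
      also have "\<bar>\<dots>\<bar> \<le> \<bar>A - (a ?e - a j) * prob E\<bar> + \<bar>(B - (a ?e - a j)) * prob E\<bar>"
        by (rule abs_triangle_ineq4)
      also have "\<bar>(B - (a ?e - a j)) * prob E\<bar> = \<bar>B - (a ?e - a j)\<bar> * prob E"
        by (simp add: abs_mult)
      finally show ?thesis .
    qed
    also have "\<dots> \<le> D * prob E + D * prob E" using 1 2 by (intro add_mono mult_right_mono) auto
    also have "\<dots> = \<delta> j * prob E" by (simp add: D_def \<delta>_def)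
    finally have "\<bar>A - B * prob E\<bar> \<le> \<delta> j * prob E" .
    moreover have "{\<omega> \<in> space M. j \<le> V (K + 1 + i) \<omega> \<and> U' i \<omega> = u} = first ?e (K + 1 + i) \<inter> E"
      using tailV[OF j, of "K + 1 + i"] by (auto simp: E_def)
    moreover have "{\<omega> \<in> space M. j \<le> V (K + 1) \<omega>} = first ?e (K + 1)" using tailV[OF j, of "K + 1"] by simp
    moreover have "{\<omega> \<in> space M. U' i \<omega> = u} = E" by (simp add: E_def)
    ultimately show ?thesis by (simp only: A_def B_def)
  qed
  have UB: "U' i \<omega> \<le> m * J" if "i < m" for i \<omega>
  proof -
    have "U' i \<omega> \<le> (\<Sum>q\<in>far i. J)" unfolding U'_def by (intro sum_mono V_le)
    also have "\<dots> = card (far i) * J" by simp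
    also have "card (far i) \<le> card {K<..K + i}" by (intro card_mono) (auto simp: far_def)
    finally have "U' i \<omega> \<le> i * J" by simp
    also have "\<dots> \<le> m * J" using that by (intro mult_le_mono1) simp
    finally show ?thesis .
  qed
  have c: "0 < c" using t rho by (simp add: c_def)
  obtain \<eta> where \<eta>: "set_pmf \<eta> \<subseteq> {1..J}"
    and approx: "\<And>h::nat \<Rightarrow> real. (\<And>x. 0 \<le> h x \<and> h x \<le> 1) \<Longrightarrow>
      \<bar>(\<integral>\<omega>. h (\<Sum>i<m. V (K + 1 + i) \<omega>) \<partial>M) - measure_pmf.expectation (compound_poisson c \<eta>) h\<bar> \<le>
       (\<Sum>i<m. 2 * prob {\<omega> \<in> space M. V (K + 1 + i) \<omega> \<noteq> 0 \<and> (\<Sum>k<i. V (K + 1 + k) \<omega>) \<noteq> U' i \<omega>} +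
           2 * p * prob {\<omega> \<in> space M. (\<Sum>k<i. V (K + 1 + k) \<omega>) \<noteq> U' i \<omega>} + (\<Sum>j=1..J. \<delta> j)) +
       (real m * p\<^sup>2 + \<bar>real m * p - c\<bar>)"
    unfolding p_def
    by (rule compound_poisson_approximation[where V="\<lambda>i. V (K + 1 + i)" and ?V0.0="V (K + 1)" and U'=U'
        and J=J and B="m * J" and \<delta>=\<delta> and m=m and c=c])
      (use V_le sizes(1) UB mix c in \<open>auto simp del: space_M\<close>)
  have psi_l0: "0 \<le> real l * \<psi>n" by simp
  have probV: "prob {\<omega>. V k \<omega> \<noteq> 0} \<le> 2 * a 0" if "K \<le> k" for k
  proof -
    have "prob {\<omega>. V k \<omega> \<noteq> 0} \<le> prob (vis k)"
      unfolding V_nonzero_iff by (intro finite_measure_mono) auto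
    also have "\<dots> \<le> 2 * a 0" using that by (intro prob_vis) simp
    finally show ?thesis .
  qed
  have p: "0 \<le> p" "p \<le> 2 * a 0" using probV[of "K + 1"] by (auto simp: p_def)
  have a0: "0 < a 0" "a 0 \<le> \<epsilon>" using a_0_pos a_0_le exp_le_eps by (auto intro: order_trans)
  define \<theta> where "\<theta> = 2 * (1 + \<psi>0) * a 0 * \<epsilon>"
  have \<theta>: "0 \<le> \<theta>" using a0 by (simp add: \<theta>_def)
  let ?G = "inverse (1 - exp (- \<Gamma>))"
  have step: "2 * prob {\<omega> \<in> space M. V (K + 1 + i) \<omega> \<noteq> 0 \<and> (\<Sum>k<i. V (K + 1 + k) \<omega>) \<noteq> U' i \<omega>} +
      2 * p * prob {\<omega> \<in> space M. (\<Sum>k<i. V (K + 1 + k) \<omega>) \<noteq> U' i \<omega>} + (\<Sum>j=1..J. \<delta> j)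
    \<le> a 0 * (12 * real C * (1 + \<psi>0) * \<epsilon> + 20 * real l * \<psi>n * (1 + \<psi>0) * ?G)" for i
  proof -
    define cl where "cl = {q \<in> {K<..K + i}. near q (K + 1 + i)}"
    have fin: "finite cl" by (simp add: cl_def)
    have cl: "card cl \<le> C"
    proof -
      have "cl \<subseteq> {q. near q (K + 1 + i)}" by (auto simp: cl_def)
      from card_mono[OF near_card(1) this] near_card(2)[of "K + 1 + i"] show ?thesis
        unfolding C_def by (rule order_trans)
    qed
    have un: "{K<..K + i} = far i \<union> cl" "far i \<inter> cl = {}" by (auto simp: far_def cl_def)
    \<comment> \<open>The full partial sum exceeds \<open>U' i\<close> by the close clumps only, so
      the two differ only if one of at most \<open>C\<close> close times starts a clump.\<close>
    have split: "(\<Sum>k<i. V (K + 1 + k) \<omega>) = U' i \<omega> + (\<Sum>q\<in>cl. V q \<omega>)" for \<omega>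
      unfolding sumV un(1) U'_def by (rule sum.union_disjoint[OF fin_far fin un(2)])
    have neq: "(\<Sum>k<i. V (K + 1 + k) \<omega>) \<noteq> U' i \<omega> \<longleftrightarrow> (\<exists>q\<in>cl. V q \<omega> \<noteq> 0)" for \<omega>
      unfolding split using fin by auto
    have Vset[measurable]: "{\<omega>. V k \<omega> \<noteq> 0} \<in> sets M" for k
      unfolding V_nonzero_iff by (simp add: sets.Diff sets_vis)
    have "prob {\<omega> \<in> space M. V (K + 1 + i) \<omega> \<noteq> 0 \<and> (\<Sum>k<i. V (K + 1 + k) \<omega>) \<noteq> U' i \<omega>} =
      prob (\<Union>q\<in>cl. {\<omega>. V (K + 1 + i) \<omega> \<noteq> 0 \<and> V q \<omega> \<noteq> 0})"
      unfolding neq by (rule arg_cong[where f=prob]) auto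
    also have "\<dots> \<le> (\<Sum>q\<in>cl. prob {\<omega>. V (K + 1 + i) \<omega> \<noteq> 0 \<and> V q \<omega> \<noteq> 0})"
    proof (rule finite_measure_subadditive_finite[OF fin])
      have "{\<omega>. V (K + 1 + i) \<omega> \<noteq> 0 \<and> V q \<omega> \<noteq> 0} = {\<omega>. V (K + 1 + i) \<omega> \<noteq> 0} \<inter> {\<omega>. V q \<omega> \<noteq> 0}" for q
        by auto
      then show "(\<lambda>q. {\<omega>. V (K + 1 + i) \<omega> \<noteq> 0 \<and> V q \<omega> \<noteq> 0}) ` cl \<subseteq> sets M"
        using Vset by (auto simp del: not_gr_zero neq0_conv)
    qed
    also have "\<dots> \<le> real (card cl) * \<theta>"
      unfolding \<theta>_def by (intro sum_bounded_above V_pair_bound) (auto simp: cl_def)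
    also have "\<dots> \<le> real C * \<theta>" using cl \<theta> by (intro mult_right_mono) auto
    finally have s1: "prob {\<omega> \<in> space M. V (K + 1 + i) \<omega> \<noteq> 0 \<and> (\<Sum>k<i. V (K + 1 + k) \<omega>) \<noteq> U' i \<omega>}
      \<le> real C * \<theta>" .
    have "prob {\<omega> \<in> space M. (\<Sum>k<i. V (K + 1 + k) \<omega>) \<noteq> U' i \<omega>} = prob (\<Union>q\<in>cl. {\<omega>. V q \<omega> \<noteq> 0})"
      unfolding neq by (rule arg_cong[where f=prob]) auto
    also have "\<dots> \<le> (\<Sum>q\<in>cl. prob {\<omega>. V q \<omega> \<noteq> 0})"
      using Vset by (intro finite_measure_subadditive_finite[OF fin]) blast
    also have "\<dots> \<le> real (card cl) * (2 * a 0)"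
      by (intro sum_bounded_above probV) (auto simp: cl_def)
    also have "\<dots> \<le> real C * (2 * a 0)" using cl a0 by (intro mult_right_mono) auto
    finally have "p * prob {\<omega> \<in> space M. (\<Sum>k<i. V (K + 1 + k) \<omega>) \<noteq> U' i \<omega>} \<le> (2 * a 0) * (real C * (2 * a 0))"
      using p a0 by (intro mult_mono) auto
    also have "\<dots> = 4 * real C * a 0 * a 0" by simp
    also have "\<dots> \<le> 4 * real C * a 0 * ((1 + \<psi>0) * \<epsilon>)"
    proof (rule mult_left_mono)
      have "1 * a 0 \<le> (1 + \<psi>0) * \<epsilon>" using a0 by (intro mult_mono) auto
      then show "a 0 \<le> (1 + \<psi>0) * \<epsilon>" by simp
    qed (use a0 in simp)
    finally have s2: "p * prob {\<omega> \<in> space M. (\<Sum>k<i. V (K + 1 + k) \<omega>) \<noteq> U' i \<omega>} \<le>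
      4 * real C * a 0 * ((1 + \<psi>0) * \<epsilon>)" .
    have "(\<Sum>j=1..J. \<delta> j) \<le> (\<Sum>j=1..J. 20 * real l * \<psi>n * a (j - 1))"
    proof (rule sum_mono)
      fix j show "\<delta> j \<le> 20 * real l * \<psi>n * a (j - 1)"
        using mult_left_mono[OF a_antimono[of "j - 1" j] psi_l0] by (simp add: \<delta>_def distrib_left)
    qed
    also have "\<dots> = 20 * real l * \<psi>n * (\<Sum>e<J. a e)"
      by (simp add: sum_distrib_left sum.atLeast1_atMost_eq)
    also have "\<dots> \<le> 20 * real l * \<psi>n * ((1 + \<psi>0) * a 0 * ?G)"
      by (intro mult_left_mono sum_a_le) simp
    finally have s3: "(\<Sum>j=1..J. \<delta> j) \<le> 20 * real l * \<psi>n * ((1 + \<psi>0) * a 0 * ?G)" .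
    \<comment> \<open>The constant 12 is \<open>2 * 2 + 2 * 4\<close>: first the pairs of close
      clumps, then a close clump, of probability at most \<open>2 * a 0\<close>, weighted with
      \<open>p \<le> 2 * a 0\<close>.\<close>
    have "2 * (real C * \<theta>) + 2 * (4 * real C * a 0 * ((1 + \<psi>0) * \<epsilon>)) + 20 * real l * \<psi>n * ((1 + \<psi>0) * a 0 * ?G)
      = a 0 * (12 * real C * (1 + \<psi>0) * \<epsilon> + 20 * real l * \<psi>n * (1 + \<psi>0) * ?G)"
      by (simp add: \<theta>_def algebra_simps)
    with s1 s2 s3 show ?thesis by linarith
  qed
  have mN: "real m \<le> real N" by (simp add: m_def)
  have ma: "real m * a 0 \<le> t" using mN a0 N(1) mult_right_mono[OF mN, of "a 0"] by linarith
  have e1: "exp (- \<Gamma>) < 1" using \<Gamma>_pos by simp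
  have S: "(\<Sum>i<m. 2 * prob {\<omega> \<in> space M. V (K + 1 + i) \<omega> \<noteq> 0 \<and> (\<Sum>k<i. V (K + 1 + k) \<omega>) \<noteq> U' i \<omega>} +
      2 * p * prob {\<omega> \<in> space M. (\<Sum>k<i. V (K + 1 + k) \<omega>) \<noteq> U' i \<omega>} + (\<Sum>j=1..J. \<delta> j))
    \<le> t * (12 * real C * (1 + \<psi>0) * \<epsilon> + 20 * real l * \<psi>n * (1 + \<psi>0) * ?G)"
  proof -
    have "0 \<le> 12 * real C * (1 + \<psi>0) * \<epsilon> + 20 * real l * \<psi>n * (1 + \<psi>0) * ?G"
      using e1 by (intro add_nonneg_nonneg mult_nonneg_nonneg) auto
    note le = mult_right_mono[OF ma this]
    show ?thesis
      by (rule order_trans[OF sum_bounded_above[OF step]]) (use le in \<open>simp only: card_lessThan mult.assoc\<close>)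
  qed
  have P1: "real m * p\<^sup>2 \<le> 4 * t * \<epsilon>"
  proof -
    have "p\<^sup>2 \<le> (2 * a 0)\<^sup>2" using p by (intro power_mono) auto
    then have "real m * p\<^sup>2 \<le> real m * (2 * a 0)\<^sup>2" by (intro mult_left_mono) auto
    also have "\<dots> = 4 * (real m * a 0) * a 0" by (simp add: power2_eq_square)
    also have "\<dots> \<le> 4 * t * \<epsilon>" using ma a0 t by (intro mult_mono) auto
    finally show ?thesis .
  qed
  have P2: "\<bar>real m * p - c\<bar> \<le> 2 * real (K + 1) * \<epsilon> + 10 * real l * \<psi>n * t"
  proof -
    define T where "T = t / a 0"
    have T: "T * a 0 = t" "real N \<le> T" "T \<le> real N + 1" "0 \<le> T"
      using N a0 t by (auto simp: T_def field_simps)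
    have "c = T * (a 0 * (1 - rho M l d w))" using T(1) by (simp add: c_def mult.assoc[symmetric])
    then have ce: "c = T * (a 0 - a 1)" unfolding rho_a .
    have "{\<omega> \<in> space M. V (K + 1) \<omega> \<noteq> 0} = first 0 (K + 1)"
      unfolding V_nonzero_iff by (auto simp: first_def run_0)
    then have "\<bar>p - (a 0 - a 1)\<bar> \<le> 5 * real l * \<psi>n * (a 0 + a 1)"
      using first0[of 0] sizes(1) by (simp add: p_def)
    also have "\<dots> \<le> 5 * real l * \<psi>n * (2 * a 0)"
      using a_antimono[of 0 1] by (intro mult_left_mono) auto
    finally have pd: "\<bar>p - (a 0 - a 1)\<bar> \<le> 10 * real l * \<psi>n * a 0" by simp
    \<comment> \<open>\<open>K\<close> accounts for the discarded times and 1 for rounding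
      down.\<close>
    have mT: "\<bar>real m - T\<bar> \<le> real (K + 1)" using T by (auto simp: m_def abs_le_iff of_nat_diff_real)
    have "real m * p - c = (real m - T) * p + T * (p - (a 0 - a 1))"
      unfolding ce by (simp add: algebra_simps)
    also have "\<bar>\<dots>\<bar> \<le> \<bar>real m - T\<bar> * p + T * \<bar>p - (a 0 - a 1)\<bar>"
      using p(1) T(4) by (intro order_trans[OF abs_triangle_ineq]) (simp add: abs_mult)
    also have "\<dots> \<le> real (K + 1) * (2 * a 0) + T * (10 * real l * \<psi>n * a 0)"
      using mT p pd T(4) by (intro add_mono mult_mono mult_left_mono) auto
    also have "T * (10 * real l * \<psi>n * a 0) = 10 * real l * \<psi>n * t" using T(1) by (simp add: mult.left_commute mult.commute)
    also have "real (K + 1) * (2 * a 0) \<le> real (K + 1) * (2 * \<epsilon>)" using a0 by (intro mult_left_mono) auto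
    finally show ?thesis by (simp add: algebra_simps)
  qed
  show thesis
  proof (rule that[OF \<eta>])
    fix h :: "nat \<Rightarrow> real" assume h: "\<And>x. 0 \<le> h x \<and> h x \<le> 1"
    have sum_eq: "(\<Sum>i<m. V (K + 1 + i) \<omega>) = (\<Sum>k\<in>{K<..N}. V k \<omega>)" for \<omega>
    proof (cases "K \<le> N")
      case True
      then show ?thesis unfolding sumV by (simp add: m_def)
    qed (simp add: m_def)
    show "\<bar>(\<integral>\<omega>. h (\<Sum>k\<in>{K<..N}. V k \<omega>) \<partial>M) -
        measure_pmf.expectation (compound_poisson (t * (1 - rho M l d w)) \<eta>) h\<bar> \<le>
      12 * real (l\<^sup>2 * (2 * K + 1)) * (1 + \<psi>0) * t * \<epsilon> +
      20 * real l * \<psi>n * (1 + \<psi>0) * t * ?G + 4 * t * \<epsilon> + 2 * real (K + 1) * \<epsilon> + 10 * real l * \<psi>n * t"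
    proof -
      have "t * (12 * real C * (1 + \<psi>0) * \<epsilon> + 20 * real l * \<psi>n * (1 + \<psi>0) * ?G) =
        12 * real C * (1 + \<psi>0) * t * \<epsilon> + 20 * real l * \<psi>n * (1 + \<psi>0) * t * ?G"
        by (simp add: algebra_simps)
      note S' = S[unfolded this]
      have *: "x \<le> y1 + y2 + v1' + v2' + v3'"
        if "x \<le> s + (v1 + v2)" "s \<le> y1 + y2" "v1 \<le> v1'" "v2 \<le> v2' + v3'"
        for x s v1 v2 y1 y2 v1' v2' v3' :: real
        using that by linarith
      show ?thesis
        unfolding c_def[symmetric] C_def[symmetric]
        by (rule *[OF approx[OF h, unfolded sum_eq] S' P1 P2])
    qed
  qed
qed

text \<open>Here \<open>P\<close> is \<open>1 + \<psi>0\<close> and \<open>X\<close> is the product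
  in front of \<open>\<epsilon>\<close> on the right. Since \<open>l\<^sup>2 * (2 * K + 1)\<close>
  is at most \<open>9 * X\<close>, the coefficients of the terms with \<open>t\<close> and
  \<open>\<epsilon>\<close> add up to \<open>2 + 12 * 9 + 4 = 114\<close>, and those with
  \<open>\<psi>n\<close> to \<open>30 * real l\<close>. Both stay below
  \<open>2 ^ (2 * l + 7) = 128 * 4 ^ l\<close>.\<close>

lemma error_bound:
  assumes t: "0 < t" and N: "real N * a 0 \<le> t"
  shows "real (K + 2 * n) * \<epsilon> + real N * (2 * (1 + \<psi>0) * a 0 * \<epsilon>) +
    (12 * real (l\<^sup>2 * (2 * K + 1)) * (1 + \<psi>0) * t * \<epsilon> +
      20 * real l * \<psi>n * (1 + \<psi>0) * t * inverse (1 - exp (- \<Gamma>)) +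
      4 * t * \<epsilon> + 2 * real (K + 1) * \<epsilon> + 10 * real l * \<psi>n * t) \<le>
    2 ^ (2 * l + 7) * (1 + \<psi>0) ^ (2 * l) * (t + 1) *
      (real (d l) * (real l)\<^sup>2 * real n ^ 4 * \<epsilon> + \<psi>n * inverse (1 - exp (- \<Gamma>)))"
proof -
  define G where "G = inverse (1 - exp (- \<Gamma>))"
  define P where "P = 1 + \<psi>0"
  define X where "X = real (d l) * (real l)\<^sup>2 * real n ^ 4"
  have x: "0 < exp (- \<Gamma>)" "exp (- \<Gamma>) < 1" using \<Gamma>_pos by auto
  then have G: "1 \<le> G" unfolding G_def by (intro one_le_inverse) auto
  have P: "1 \<le> P" by (simp add: P_def)
  have l1: "1 \<le> real l" "1 \<le> (real l)\<^sup>2" "1 \<le> real (d l)" "1 \<le> real n" using l sizes by auto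
  have n4: "real n \<le> real n ^ 4" using l1 power_increasing[of 1 4 "real n"] by simp
  have Xn: "(real l)\<^sup>2 * (real (d l) * real n) \<le> X"
  proof -
    have "(real (d l) * (real l)\<^sup>2) * real n \<le> (real (d l) * (real l)\<^sup>2) * real n ^ 4"
      using n4 by (intro mult_left_mono) auto
    then show ?thesis by (simp add: X_def mult_ac)
  qed
  have dn: "real (d l) * real n \<le> X"
  proof -
    have "1 * (real (d l) * real n) \<le> (real l)\<^sup>2 * (real (d l) * real n)"
      using l1 by (intro mult_right_mono) auto
    then show ?thesis using Xn by simp
  qed
  have nX: "real n \<le> X"
  proof -
    have "1 * real n \<le> real (d l) * real n" using l1 by (intro mult_right_mono) auto
    then show ?thesis using dn by simp
  qed
  have X1: "1 \<le> X" using nX l1 by linarith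
  have KX: "real K \<le> 4 * X" using dn by (simp add: K_def)
  have CX: "real (l\<^sup>2 * (2 * K + 1)) \<le> 9 * X"
  proof -
    have "2 * real K + 1 \<le> 9 * (real (d l) * real n)"
    proof -
      have "1 * 1 \<le> real (d l) * real n" using l1 by (intro mult_mono) auto
      then show ?thesis by (simp add: K_def mult.commute)
    qed
    then have "(real l)\<^sup>2 * (2 * real K + 1) \<le> (real l)\<^sup>2 * (9 * (real (d l) * real n))"
      by (intro mult_left_mono) auto
    moreover have "real (l\<^sup>2 * (2 * K + 1)) = (real l)\<^sup>2 * (2 * real K + 1)"
      by (simp add: algebra_simps)
    moreover have "(real l)\<^sup>2 * (9 * (real (d l) * real n)) = 9 * ((real l)\<^sup>2 * (real (d l) * real n))"
      by simp
    ultimately show ?thesis using Xn by linarith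
  qed
  have PX: "X \<le> P * X" "1 \<le> P * X"
  proof -
    show "X \<le> P * X" using mult_right_mono[OF P, of X] X1 by simp
    with X1 show "1 \<le> P * X" by linarith
  qed
  have 1: "real (K + 2 * n) + 2 * real (K + 1) \<le> 114 * (P * X)"
  proof -
    have "real (K + 2 * n) + 2 * real (K + 1) = 3 * real K + 2 * real n + 2" by simp
    then show ?thesis using KX nX X1 PX by linarith
  qed
  have N2: "real N * (2 * P * a 0 * \<epsilon>) \<le> t * (2 * (P * X)) * \<epsilon>"
  proof -
    have "real N * (2 * P * a 0 * \<epsilon>) = (real N * a 0) * (2 * P * \<epsilon>)" by simp
    also have "\<dots> \<le> t * (2 * P * \<epsilon>)" using N P by (intro mult_right_mono) auto
    also have "\<dots> \<le> t * (2 * (P * X) * \<epsilon>)"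
      using t P X1 by (intro mult_left_mono mult_right_mono) auto
    finally show ?thesis by simp
  qed
  have C2: "12 * real (l\<^sup>2 * (2 * K + 1)) * P * t * \<epsilon> \<le> t * (108 * (P * X)) * \<epsilon>"
  proof -
    have "real (l\<^sup>2 * (2 * K + 1)) * (12 * P * t * \<epsilon>) \<le> (9 * X) * (12 * P * t * \<epsilon>)"
      using CX P t by (intro mult_right_mono) auto
    then show ?thesis by (simp only: mult_ac)
  qed
  have T4: "4 * t * \<epsilon> \<le> t * (4 * (P * X)) * \<epsilon>"
  proof -
    have "t * \<epsilon> * 1 \<le> t * \<epsilon> * (P * X)" using PX t by (intro mult_left_mono) auto
    then show ?thesis by (simp add: mult_ac)
  qed
  have K1: "real (K + 2 * n) * \<epsilon> + 2 * real (K + 1) * \<epsilon> \<le> 114 * (P * X) * \<epsilon>"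
    using mult_right_mono[OF 1, of \<epsilon>] by (simp add: distrib_right)
  have eps: "real (K + 2 * n) * \<epsilon> + real N * (2 * P * a 0 * \<epsilon>) +
    12 * real (l\<^sup>2 * (2 * K + 1)) * P * t * \<epsilon> + 4 * t * \<epsilon> + 2 * real (K + 1) * \<epsilon> \<le>
    114 * (t + 1) * (P * X) * \<epsilon>"
    using K1 N2 C2 T4 by (simp add: distrib_left distrib_right)
  have psi: "20 * real l * \<psi>n * P * t * G + 10 * real l * \<psi>n * t \<le> 30 * real l * (t + 1) * P * (\<psi>n * G)"
  proof -
    have "1 * 1 \<le> P * G" using P G by (intro mult_mono) auto
    then have "(10 * real l * \<psi>n * t) * 1 \<le> (10 * real l * \<psi>n * t) * (P * G)"
      using t by (intro mult_left_mono) auto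
    moreover have "0 \<le> 30 * real l * P * (\<psi>n * G)" using P G by simp
    ultimately show ?thesis by (simp add: algebra_simps)
  qed
  have four: "4 * real l \<le> 4 * 4 ^ l" "(4::real) \<le> 4 ^ l"
  proof -
    have "l < 4 ^ l" by (rule less_exp[THEN less_le_trans]) (rule power_mono, auto)
    then have "real l \<le> real (4 ^ l)" by (simp only: of_nat_le_iff less_imp_le)
    then show "4 * real l \<le> 4 * 4 ^ l" by simp
    show "(4::real) \<le> 4 ^ l" using power_increasing[of 1 l "4::real"] l by simp
  qed
  have two: "(2::real) ^ (2 * l + 7) = 128 * 4 ^ l" by (simp add: power_add power_mult)
  have Pl: "P \<le> P ^ (2 * l)" using P l power_increasing[of 1 "2 * l" P] by simp
  define R where "R = 2 ^ (2 * l + 7) * P ^ (2 * l) * (t + 1)"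
  have R1: "114 * (t + 1) * P \<le> R"
  proof -
    have "114 * P \<le> (128 * 4 ^ l) * P ^ (2 * l)" using four P Pl by (intro mult_mono) auto
    then have "114 * P * (t + 1) \<le> (128 * 4 ^ l) * P ^ (2 * l) * (t + 1)"
      using t by (intro mult_right_mono) auto
    then show ?thesis unfolding R_def two by (simp only: mult_ac)
  qed
  have R2: "30 * real l * (t + 1) * P \<le> R"
  proof -
    have "30 * real l * P \<le> (128 * 4 ^ l) * P ^ (2 * l)" using four P Pl by (intro mult_mono) auto
    then have "30 * real l * P * (t + 1) \<le> (128 * 4 ^ l) * P ^ (2 * l) * (t + 1)"
      using t by (intro mult_right_mono) auto
    then show ?thesis unfolding R_def two by (simp only: mult_ac)
  qed
  have "114 * (t + 1) * (P * X) * \<epsilon> \<le> R * (X * \<epsilon>)"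
    using mult_right_mono[OF R1, of "X * \<epsilon>"] X1 by (simp add: mult_ac)
  moreover have "30 * real l * (t + 1) * P * (\<psi>n * G) \<le> R * (\<psi>n * G)"
    using G by (intro mult_right_mono R2) auto
  ultimately have "real (K + 2 * n) * \<epsilon> + real N * (2 * P * a 0 * \<epsilon>) +
    (12 * real (l\<^sup>2 * (2 * K + 1)) * P * t * \<epsilon> + 20 * real l * \<psi>n * P * t * G + 4 * t * \<epsilon> +
      2 * real (K + 1) * \<epsilon> + 10 * real l * \<psi>n * t) \<le> R * (X * \<epsilon> + \<psi>n * G)"
    using eps psi unfolding distrib_left[of R] by linarith
  then show ?thesis unfolding R_def X_def P_def G_def .
qed

theorem visits_compound_poisson:
  fixes t :: real
  assumes t: "0 < t" and rho: "rho M l d w < 1"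
  defines "N \<equiv> nat \<lfloor>t * inverse (prob (cyl w)) ^ l\<rfloor>"
  shows "\<exists>\<eta>. set_pmf \<eta> \<subseteq> {1..J} \<and> (\<forall>L. \<bar>\<P>(\<omega> in M. visit_sum l d (cyl w) N \<omega> \<in> L) -
      measure_pmf.prob (compound_poisson (t * (1 - rho M l d w)) \<eta>) L\<bar> \<le>
    2 ^ (2 * l + 7) * (1 + \<psi>0) ^ (2 * l) * (t + 1) *
      (real (d l) * (real l)\<^sup>2 * real n ^ 4 * \<epsilon> + \<psi>n * inverse (1 - exp (- \<Gamma>))))"
proof -
  define T where "T = t * inverse (prob (cyl w)) ^ l"
  have a0: "0 < a 0" by (rule a_0_pos)
  have T: "T * a 0 = t" "0 \<le> T"
    using w_pos t by (simp_all add: T_def a_0 b_n(1) power_inverse)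
  have "real N = of_int \<lfloor>T\<rfloor>" using T(2) by (simp add: N_def T_def)
  then have "real N \<le> T" "T \<le> real N + 1" by linarith+
  then have N: "real N * a 0 \<le> t" "t \<le> (real N + 1) * a 0"
    using a0 unfolding T(1)[symmetric] by (auto intro: mult_right_mono)
  let ?c = "t * (1 - rho M l d w)" and ?S = "\<lambda>\<omega>. \<Sum>k\<in>{K<..N}. V k \<omega>"
  obtain \<eta> where \<eta>: "set_pmf \<eta> \<subseteq> {1..J}"
    and approx: "\<And>h::nat \<Rightarrow> real. (\<And>x. 0 \<le> h x \<and> h x \<le> 1) \<Longrightarrow>
      \<bar>(\<integral>\<omega>. h (?S \<omega>) \<partial>M) - measure_pmf.expectation (compound_poisson ?c \<eta>) h\<bar> \<le>
      12 * real (l\<^sup>2 * (2 * K + 1)) * (1 + \<psi>0) * t * \<epsilon> +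
      20 * real l * \<psi>n * (1 + \<psi>0) * t * inverse (1 - exp (- \<Gamma>)) +
      4 * t * \<epsilon> + 2 * real (K + 1) * \<epsilon> + 10 * real l * \<psi>n * t"
    using clumps_approximation[OF t N rho] by blast
  have S_meas: "?S \<in> measurable M (count_space UNIV)"
    by (rule measurable_sum_nat) simp
  have vs_meas: "visit_sum l d (cyl w) N \<in> measurable M (count_space UNIV)"
  proof -
    have "(\<lambda>\<omega>. of_bool (\<omega> \<in> vis k) :: nat) \<in> measurable M (count_space UNIV)" for k
      by (rule measurable_compose[of _ M "count_space UNIV"]) auto
    then have "(\<lambda>\<omega>. \<Sum>k\<in>{1..N}. of_bool (\<omega> \<in> vis k)) \<in> measurable M (count_space (UNIV :: nat set))"
      by (rule measurable_sum_nat)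
    also have "(\<lambda>\<omega>. \<Sum>k\<in>{1..N}. of_bool (\<omega> \<in> vis k)) = visit_sum l d (cyl w) N"
    proof
      fix \<omega>
      have "{k \<in> {1..N}. \<omega> \<in> vis k} = {1..N} \<inter> {k. \<omega> \<in> vis k}" by auto
      then show "(\<Sum>k\<in>{1..N}. of_bool (\<omega> \<in> vis k)) = visit_sum l d (cyl w) N \<omega>"
        unfolding visit_sum_eq by (simp add: of_bool_def sum.If_cases)
    qed
    finally show ?thesis .
  qed
  show ?thesis
  proof (intro exI[of _ \<eta>] conjI allI \<eta>)
    fix L :: "nat set"
    define A where "A = {\<omega>. visit_sum l d (cyl w) N \<omega> \<in> L}"
    define B where "B = {\<omega>. ?S \<omega> \<in> L}"
    define D where "D = {\<omega>. visit_sum l d (cyl w) N \<omega> \<noteq> ?S \<omega>}"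
    have sets: "A \<in> sets M" "B \<in> sets M" "D \<in> sets M"
    proof -
      show "A \<in> sets M" using measurable_sets[OF vs_meas, of L] by (simp add: A_def vimage_def)
      show "B \<in> sets M" using measurable_sets[OF S_meas, of L] by (simp add: B_def vimage_def)
      show "D \<in> sets M"
        using measurable_sets[OF measurable_count_space2[OF vs_meas S_meas, of "(\<noteq>)"], of "{True}"]
        by (simp add: D_def vimage_def)
    qed
    have "prob A \<le> prob (B \<union> D)" "prob B \<le> prob (A \<union> D)"
      using sets by (auto intro!: finite_measure_mono simp: A_def B_def D_def)
    then have AB: "\<bar>prob A - prob B\<bar> \<le> prob D"
      using measure_Un_le[of B M D] measure_Un_le[of A M D] sets by auto
    have "(\<integral>\<omega>. indicator L (?S \<omega>) \<partial>M) = (\<integral>\<omega>. indicator B \<omega> \<partial>M)"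
      by (intro Bochner_Integration.integral_cong) (auto simp: B_def indicator_def)
    also have "\<dots> = prob B" using sets by simp
    finally have "\<bar>prob B - measure_pmf.prob (compound_poisson ?c \<eta>) L\<bar> \<le>
      12 * real (l\<^sup>2 * (2 * K + 1)) * (1 + \<psi>0) * t * \<epsilon> +
      20 * real l * \<psi>n * (1 + \<psi>0) * t * inverse (1 - exp (- \<Gamma>)) +
      4 * t * \<epsilon> + 2 * real (K + 1) * \<epsilon> + 10 * real l * \<psi>n * t"
      using approx[of "indicator L"] by simp
    moreover have "prob D \<le> real (K + 2 * n) * \<epsilon> + real N * (2 * (1 + \<psi>0) * a 0 * \<epsilon>)"
      unfolding D_def by (rule prob_visit_sum_neq)
    moreover have "\<P>(\<omega> in M. visit_sum l d (cyl w) N \<omega> \<in> L) = prob A" by (simp add: A_def)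
    ultimately show "\<bar>\<P>(\<omega> in M. visit_sum l d (cyl w) N \<omega> \<in> L) -
        measure_pmf.prob (compound_poisson ?c \<eta>) L\<bar> \<le>
      2 ^ (2 * l + 7) * (1 + \<psi>0) ^ (2 * l) * (t + 1) *
      (real (d l) * (real l)\<^sup>2 * real n ^ 4 * \<epsilon> + \<psi>n * inverse (1 - exp (- \<Gamma>)))"
      using AB error_bound[OF t N(1)] by linarith
  qed
qed

end

section \<open>The theorem\<close>

theorem theorem2p3:
  fixes M :: "(nat \<Rightarrow> 'a::countable) measure"
    and l :: nat and d :: "nat \<Rightarrow> nat" and \<Gamma> :: real
  assumes alphabet: "\<exists>a b :: 'a. a \<noteq> b"
    and prob: "prob_space M"
    and sets_M: "sets M = sigma_sets UNIV (\<Union>n. cylinders n)"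
    and invariant: "distr M M shift = M"
    and letters: "\<And>a. measure M (cyl [a]) > 0"
    and l: "l \<ge> 1"
    and d: "d 1 \<ge> 1" "strict_mono_on {1..l} d"
    and mixing: "psi_mixing M"
    and Gamma: "\<Gamma> > 0" "\<And>n A. n \<ge> 1 \<Longrightarrow> A \<in> cylinders n \<Longrightarrow> measure M A \<le> exp (- \<Gamma> * real n)"
  shows "Sup {rho M l d w | w. w \<noteq> [] \<and> measure M (cyl w) > 0} < 1 \<and>
    (\<forall>\<omega> \<in> supp_seqs M. \<not> periodic \<omega> \<longrightarrow> (\<lambda>n. rho M l d (prefix_word \<omega> n)) \<longlonglongrightarrow> 0) \<and>
    (\<forall>(w :: 'a list) (t :: real) A n r \<rho> N.
      w \<noteq> [] \<and> n = length w \<and> A = cyl w \<and> measure M A > 0 \<and> t > 0 \<and>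
      N = nat \<lfloor>t * inverse (measure M A) ^ l\<rfloor> \<and>
      psi M n < ennreal ((3 / 2) powr (1 / (real l + 1)) - 1) \<and>
      r = first_return n A \<and> \<rho> = rho M l d w \<and> n > r * (d l + 6) \<longrightarrow>
      (\<exists>(Q :: (nat \<Rightarrow> nat) measure) (W :: (nat \<Rightarrow> nat) \<Rightarrow> nat) (\<eta> :: nat \<Rightarrow> (nat \<Rightarrow> nat) \<Rightarrow> nat).
        prob_space Q \<and>
        prob_space.indep_vars Q (\<lambda>_. count_space UNIV) (\<lambda>k. if k = 0 then W else \<eta> k) UNIV \<and>
        distr Q (count_space UNIV) W = measure_pmf (poisson_pmf (t * (1 - \<rho>))) \<and>
        (\<forall>k\<ge>1. distr Q (count_space UNIV) (\<eta> k) = distr Q (count_space UNIV) (\<eta> 1)) \<and>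
        \<P>(x in Q. \<eta> 1 x \<in> {1..n div r}) = 1 \<and>
        (SUP L :: nat set. \<bar>\<P>(\<omega> in M. visit_sum l d A N \<omega> \<in> L) -
                             \<P>(x in Q. (\<Sum>k=1..W x. \<eta> k x) \<in> L)\<bar>)
        \<le> 2 ^ (2 * l + 7) * (1 + enn2real (psi M 0)) ^ (2 * l) * (t + 1) *
            (real (d l) * (real l)\<^sup>2 * real n ^ 4 * exp (- \<Gamma> * real n / 2) +
             enn2real (psi M n) * inverse (1 - exp (- \<Gamma>))) +
          2 * wp (10 * (1 + enn2real (psi M 0)) ^ (2 * l) * real (d l) * (real n)\<^sup>2 * (t + 1) *
                    exp (- \<Gamma> * real n / 2) +
                  2 ^ l * t * enn2real (psi M n))))"
proof -
  interpret prob_space M by (rule prob)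
  interpret psi_process M \<Gamma>
    using sets_M invariant Gamma mixing by unfold_locales (auto simp: psi_mixing_def)
  have word: "word_process M \<Gamma> w l d" if "w \<noteq> []" "prob (cyl w) > 0" for w
    using that l d by unfold_locales auto
  obtain j where j: "1 \<le> j" "(1 + \<psi>0) * exp (- \<Gamma> * real j) \<le> 1 / 2"
  proof -
    have p: "0 < 1 + \<psi>0" by (simp add: add_pos_nonneg)
    obtain j where "exp (- \<Gamma>) ^ j < 1 / (2 * (1 + \<psi>0))"
      using real_arch_pow_inv[of "1 / (2 * (1 + \<psi>0))" "exp (- \<Gamma>)"] p Gamma(1) by auto
    moreover have "exp (- \<Gamma>) ^ j = exp (- \<Gamma> * real j)" for j
      by (simp add: exp_of_nat_mult[symmetric] mult.commute)
    ultimately have a: "(1 + \<psi>0) * exp (- \<Gamma> * real j) \<le> 1 / 2"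
      using p by (simp add: field_simps)
    moreover have "1 \<le> j"
    proof (rule ccontr)
      assume "\<not> 1 \<le> j"
      then have "j = 0" by simp
      then have "1 + \<psi>0 \<le> 1 / 2" using a by simp
      then show False using enn2real_nonneg[of "psi M 0"] by linarith
    qed
    ultimately show thesis using that by blast
  qed
  have rho_le: "rho M l d w \<le> 1 - 1 / (2 * real j)" if "w \<noteq> []" "prob (cyl w) > 0" for w
    by (rule word_process.rho_le_uniform[OF word[OF that] j])
  have lt1: "1 - 1 / (2 * real j) < 1" using j by simp
  have part1: "Sup {rho M l d w | w. w \<noteq> [] \<and> prob (cyl w) > 0} < 1"
  proof -
    have "Sup {rho M l d w | w. w \<noteq> [] \<and> prob (cyl w) > 0} \<le> 1 - 1 / (2 * real j)"
    proof (rule cSup_least)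
      \<comment> \<open>The supremum of reals is bounded this way only over a nonempty set; any
        one-letter word has positive probability.\<close>
      have "rho M l d [undefined] \<in> {rho M l d w | w. w \<noteq> [] \<and> prob (cyl w) > 0}"
        using letters by blast
      then show "{rho M l d w | w. w \<noteq> [] \<and> prob (cyl w) > 0} \<noteq> {}" by blast
    qed (use rho_le in auto)
    with lt1 show ?thesis by linarith
  qed
  have part2: "(\<lambda>n. rho M l d (prefix_word \<omega> n)) \<longlonglongrightarrow> 0"
    if supp: "\<omega> \<in> supp_seqs M" and np: "\<not> periodic \<omega>" for \<omega>
  proof -
    define R where "R n = first_return n (cyl (prefix_word \<omega> n))" for n
    have len: "length (prefix_word \<omega> n) = n" for n by (simp add: prefix_word_def)
    have w: "word_process M \<Gamma> (prefix_word \<omega> n) l d" if "1 \<le> n" for n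
      using that supp len[of n] by (intro word) (auto simp: supp_seqs_def)
    have "filterlim R at_top sequentially"
      unfolding filterlim_at_top
    proof
      fix Z
      \<comment> \<open>A sequence that is not \<open>p\<close>-periodic has two different letters
        at distance \<open>p\<close>, and no prefix containing both has period \<open>p\<close>. So
        each value of \<open>R\<close> is taken only finitely often.\<close>
      have "\<forall>p\<in>{1..<Z}. eventually (\<lambda>n. R n \<noteq> p) sequentially"
      proof
        fix p assume p: "p \<in> {1..<Z}"
        then have "(shift ^^ p) \<omega> \<noteq> \<omega>" using np by (auto simp: periodic_def)
        then obtain i where i: "\<omega> (i + p) \<noteq> \<omega> i" by (auto simp: fun_eq_iff funpow_shift)
        show "eventually (\<lambda>n. R n \<noteq> p) sequentially"
          using eventually_gt_at_top[of "i + p"]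
        proof eventually_elim
          case (elim n)
          then interpret word_process M \<Gamma> "prefix_word \<omega> n" l d by (intro w) simp
          show ?case
          proof
            assume "R n = p"
            then have "r = p" by (simp add: r_def R_def len)
            then have "prefix_word \<omega> n ! (i + p) = prefix_word \<omega> n ! i"
              using r_period[of i] elim by (simp add: len)
            with elim i show False by (simp add: prefix_word_def)
          qed
        qed
      qed
      then have "eventually (\<lambda>n. \<forall>p\<in>{1..<Z}. R n \<noteq> p) sequentially"
        by (intro eventually_ball_finite) auto
      with eventually_ge_at_top[of 1] show "eventually (\<lambda>n. Z \<le> R n) sequentially"
      proof eventually_elim
        case (elim n)
        interpret word_process M \<Gamma> "prefix_word \<omega> n" l d using elim by (intro w) simp
        have "1 \<le> R n" using r_bounds(1) by (simp add: r_def R_def len)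
        with elim show ?case by (metis atLeastLessThan_iff not_le)
      qed
    qed
    moreover have "(\<lambda>k. (1 + \<psi>0) * exp (- \<Gamma>) ^ k) \<longlonglongrightarrow> (1 + \<psi>0) * 0"
      using Gamma(1) by (intro tendsto_mult tendsto_const LIMSEQ_power_zero) auto
    ultimately have lim: "(\<lambda>n. (1 + \<psi>0) * exp (- \<Gamma>) ^ R n) \<longlonglongrightarrow> 0"
      using filterlim_compose by fastforce
    show ?thesis
    proof (rule tendsto_sandwich[OF _ _ tendsto_const lim])
      show "eventually (\<lambda>n. 0 \<le> rho M l d (prefix_word \<omega> n)) sequentially"
        using eventually_ge_at_top[of 1] by eventually_elim (rule word_process.rho_nonneg[OF w])
      show "eventually (\<lambda>n. rho M l d (prefix_word \<omega> n) \<le> (1 + \<psi>0) * exp (- \<Gamma>) ^ R n) sequentially"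
        using eventually_ge_at_top[of 1]
      proof eventually_elim
        case (elim n)
        interpret word_process M \<Gamma> "prefix_word \<omega> n" l d by (rule w[OF elim])
        have "exp (- \<Gamma> * real r) = exp (- \<Gamma>) ^ R n"
          by (simp add: exp_of_nat_mult[symmetric] mult.commute r_def R_def len)
        then show ?case using rho_le_exp by simp
      qed
    qed
  qed
  have part3: "\<exists>(Q :: (nat \<Rightarrow> nat) measure) (W :: (nat \<Rightarrow> nat) \<Rightarrow> nat) (\<eta> :: nat \<Rightarrow> (nat \<Rightarrow> nat) \<Rightarrow> nat).
        prob_space Q \<and>
        prob_space.indep_vars Q (\<lambda>_. count_space UNIV) (\<lambda>k. if k = 0 then W else \<eta> k) UNIV \<and>
        distr Q (count_space UNIV) W = measure_pmf (poisson_pmf (t * (1 - \<rho>))) \<and>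
        (\<forall>k\<ge>1. distr Q (count_space UNIV) (\<eta> k) = distr Q (count_space UNIV) (\<eta> 1)) \<and>
        \<P>(x in Q. \<eta> 1 x \<in> {1..n div r}) = 1 \<and>
        (SUP L :: nat set. \<bar>\<P>(\<omega> in M. visit_sum l d A N \<omega> \<in> L) -
                             \<P>(x in Q. (\<Sum>k=1..W x. \<eta> k x) \<in> L)\<bar>)
        \<le> 2 ^ (2 * l + 7) * (1 + \<psi>0) ^ (2 * l) * (t + 1) *
            (real (d l) * (real l)\<^sup>2 * real n ^ 4 * exp (- \<Gamma> * real n / 2) +
             enn2real (psi M n) * inverse (1 - exp (- \<Gamma>))) +
          2 * wp (10 * (1 + \<psi>0) ^ (2 * l) * real (d l) * (real n)\<^sup>2 * (t + 1) *
                    exp (- \<Gamma> * real n / 2) +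
                  2 ^ l * t * enn2real (psi M n))"
    if w: "w \<noteq> []" and n: "n = length w" and A: "A = cyl w" and A_pos: "prob A > 0" and t: "t > 0"
      and N: "N = nat \<lfloor>t * inverse (prob A) ^ l\<rfloor>"
      and fin: "psi M n < ennreal ((3 / 2) powr (1 / (real l + 1)) - 1)"
      and r: "r = first_return n A" and \<rho>: "\<rho> = rho M l d w" and large: "n > r * (d l + 6)"
    for w :: "'a list" and t :: real and A n r \<rho> N
  proof -
    interpret word_process M \<Gamma> w l d using w A_pos A by (intro word) auto
    have r': "r = word_process.r w" by (simp add: r n A r_def)
    have rho_lt: "rho M l d w < 1" using rho_le[OF w w_pos] lt1 by linarith
    then have c: "0 < t * (1 - \<rho>)" using t by (simp add: \<rho>)
    define main where "main = 2 ^ (2 * l + 7) * (1 + \<psi>0) ^ (2 * l) * (t + 1) *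
            (real (d l) * (real l)\<^sup>2 * real n ^ 4 * exp (- \<Gamma> * real n / 2) +
             enn2real (psi M n) * inverse (1 - exp (- \<Gamma>)))"
    have "\<exists>\<eta>. set_pmf \<eta> \<subseteq> {1..n div r} \<and> (\<forall>L. \<bar>\<P>(\<omega> in M. visit_sum l d A N \<omega> \<in> L) -
      measure_pmf.prob (compound_poisson (t * (1 - \<rho>)) \<eta>) L\<bar> \<le> main)"
    \<comment> \<open>The threshold is the inverse of the factor \<open>2 ^ (2 * l + 7)\<close>;
      above it the mixing term alone makes \<open>main\<close> at least 1.\<close>
    proof (cases "enn2real (psi M n) \<le> 1 / (128 * 4 ^ l)")
      case True
      interpret clump_process M \<Gamma> w l d
        using True large fin by unfold_locales (auto simp: r' n order.strict_trans2)
      show ?thesis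
        using visits_compound_poisson[OF t rho_lt]
        unfolding main_def \<rho> N A J_def r' n .
    next
      case False
      have e: "0 < exp (- \<Gamma>)" "exp (- \<Gamma>) < 1" using Gamma(1) by auto
      then have G: "1 \<le> inverse (1 - exp (- \<Gamma>))" by (intro one_le_inverse) auto
      have "1 * 1 \<le> (128 * 4 ^ l * enn2real (psi M n)) * inverse (1 - exp (- \<Gamma>))"
        using False G by (intro mult_mono) (auto simp: field_simps)
      also have "\<dots> \<le> 2 ^ (2 * l + 7) * (enn2real (psi M n) * inverse (1 - exp (- \<Gamma>)))"
        by (simp add: power_add power_mult)
      also have "\<dots> \<le> (2 ^ (2 * l + 7) * (1 + \<psi>0) ^ (2 * l) * (t + 1)) *
        (real (d l) * (real l)\<^sup>2 * real n ^ 4 * exp (- \<Gamma> * real n / 2) +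
          enn2real (psi M n) * inverse (1 - exp (- \<Gamma>)))"
      proof (rule mult_mono)
        have "1 * 1 \<le> (1 + \<psi>0) ^ (2 * l) * (t + 1)"
          using t by (intro mult_mono one_le_power) auto
        then have "2 ^ (2 * l + 7) * 1 \<le> 2 ^ (2 * l + 7) * ((1 + \<psi>0) ^ (2 * l) * (t + 1))"
          by (intro mult_left_mono) auto
        then show "(2::real) ^ (2 * l + 7) \<le> 2 ^ (2 * l + 7) * (1 + \<psi>0) ^ (2 * l) * (t + 1)"
          by (simp only: mult_1_right mult.assoc)
      qed (use G t Gamma(1) in \<open>auto intro!: mult_nonneg_nonneg\<close>)
      finally have "1 \<le> main" unfolding main_def by simp
      \<comment> \<open>Any law on \<open>{1..n div r}\<close> will do in this case; the point mass
        at 1 is one because \<open>r\<close> is at most \<open>n\<close>.\<close>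
      moreover have "\<bar>\<P>(\<omega> in M. visit_sum l d A N \<omega> \<in> L) -
        measure_pmf.prob (compound_poisson (t * (1 - \<rho>)) (return_pmf 1)) L\<bar> \<le> 1" for L
        using measure_pmf.prob_le_1[of "compound_poisson (t * (1 - \<rho>)) (return_pmf 1)" L]
          prob_le_1[of "{\<omega> \<in> space M. visit_sum l d A N \<omega> \<in> L}"]
          measure_nonneg[of "compound_poisson (t * (1 - \<rho>)) (return_pmf 1)" L]
          measure_nonneg[of M "{\<omega> \<in> space M. visit_sum l d A N \<omega> \<in> L}"]
        unfolding abs_le_iff by linarith
      moreover have "1 \<le> n div r"
        using r_bounds unfolding r' n by (simp add: Suc_le_eq div_greater_zero_iff)
      ultimately show ?thesis
        by (intro exI[of _ "return_pmf 1"] conjI allI) (simp, meson order_trans)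
    qed
    then obtain \<eta>0 where \<eta>0: "set_pmf \<eta>0 \<subseteq> {1..n div r}"
      and le: "\<And>L. \<bar>\<P>(\<omega> in M. visit_sum l d A N \<omega> \<in> L) -
        measure_pmf.prob (compound_poisson (t * (1 - \<rho>)) \<eta>0) L\<bar> \<le> main" by blast
    have "0 \<le> 2 * wp (10 * (1 + \<psi>0) ^ (2 * l) * real (d l) * (real n)\<^sup>2 * (t + 1) *
      exp (- \<Gamma> * real n / 2) + 2 ^ l * t * enn2real (psi M n))"
      using t unfolding wp_def by (intro mult_nonneg_nonneg add_nonneg_nonneg) auto
    then have main: "x \<le> main \<Longrightarrow> x \<le> main + 2 * wp (10 * (1 + \<psi>0) ^ (2 * l) * real (d l) * (real n)\<^sup>2 * (t + 1) *
      exp (- \<Gamma> * real n / 2) + 2 ^ l * t * enn2real (psi M n))" for x by linarith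
    from compound_poisson_realization[OF c \<eta>0] obtain Q :: "(nat \<Rightarrow> nat) measure" and W Y where
      Q: "prob_space Q"
        "prob_space.indep_vars Q (\<lambda>_. count_space UNIV) (\<lambda>k. if k = 0 then W else Y k) UNIV"
        "distr Q (count_space UNIV) W = measure_pmf (poisson_pmf (t * (1 - \<rho>)))"
        "\<forall>k\<ge>1. distr Q (count_space UNIV) (Y k) = distr Q (count_space UNIV) (Y 1)"
        "\<P>(x in Q. Y 1 x \<in> {1..n div r}) = 1"
        and law: "\<forall>L. \<P>(x in Q. (\<Sum>k=1..W x. Y k x) \<in> L) = measure_pmf.prob (compound_poisson (t * (1 - \<rho>)) \<eta>0) L"
      by (elim exE conjE)
    have "(SUP L :: nat set. \<bar>\<P>(\<omega> in M. visit_sum l d A N \<omega> \<in> L) -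
       \<P>(x in Q. (\<Sum>k=1..W x. Y k x) \<in> L)\<bar>) \<le> main"
      using le law by (intro cSUP_least) auto
    from main[OF this] show ?thesis
      unfolding main_def by (intro exI[of _ Q] exI[of _ W] exI[of _ Y] conjI Q)
  qed
  show ?thesis
    by (intro conjI part1 ballI impI allI part2; (elim conjE)?; (rule part3; assumption)?)
qed

end
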